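(* Let $c_n$ be an intermediate time-scale with parameter $\varepsilon$. For all $0<\varepsilon\le1$ and all $0<\beta<\infty$ such that $0<\alpha(\varepsilon)<1$, the following holds $\mathbb P$-almost surely if $\sum_n a_n/2^n<\infty$ and in $\mathbb P$-probability if $\sum_n a_n/2^n=\infty$: for all $t\ge0$ and all $s>0$, $$\lim_{n\to\infty}\mathcal C_n(t,s)=\mathrm{Asl}_{\alpha(\varepsilon)}\!\left(\frac{t}{t+s}\right).$$
   Context: For $n\ge 1$ let $\mathcal V_n=\{-1,1\}^n$ be the discrete cube, with edges between vertices that differ in exactly one coordinate. Let $(\mathcal H_n(x))_{x\in\mathcal V_n}$ be independent centered Gaussian random variables of variance $n$ (for all $n$ defined on a common probability space with law $\mathbb P$, called the random environment). For $\beta>0$ set $\tau_n(x)=\exp\{-\beta\mathcal H_n(x)\}$. Given the environment, $(X_n(t))_{t>0}$ is the Markov jump process on $\mathcal V_n$ with rates $\lambda_n(x,y)=1/(n\tau_n(x))$ if $(x,y)$ is an edge and $0$ otherwise, started from the uniform distribution $\pi_n(x)=2^{-n}$; $\mathcal P_{\pi_n}$ denotes its law for a fixed realization of the environment. "In $\mathbb P$-probability" refers to the randomness of the environment. Given a diverging sequence $c_n$ (time-scale), $a_n$ is defined by $a_n\mathbb P(\tau_n(x)\ge c_n)=1$. $c_n$ is an intermediate time-scale (with parameter $0<\varepsilon\le1$) if $\lim_n\frac{\log a_n}{n\log 2}=\varepsilon$ and $\lim_n a_n/2^n=0$. Set $\beta_c(\varepsilon)=\sqrt{2\varepsilon\log2}$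 and $\alpha(\varepsilon)=\beta_c(\varepsilon)/\beta$. With $(\cdot,\cdot)$ the inner product in $\mathbb R^n$, $\mathcal C_n(t,s)=\mathcal P_{\pi_n}\big(n^{-1}(X_n(c_nt),X_n(c_nu))=1\ \forall\, t\le u<t+s\big)$. For $0<a<1$, $\mathrm{Asl}_{a}(u)=\frac{\sin(a\pi)}{\pi}\int_0^u(1-x)^{-a}x^{-1+a}\,dx$ is the distribution function of the generalized arcsine law of parameter $a$. *)

theory Defs
  imports "HOL-Probability.Probability"
begin

definition exit_rate :: "'a set \<Rightarrow> ('a \<Rightarrow> 'a \<Rightarrow> real) \<Rightarrow> 'a \<Rightarrow> real" where
  "exit_rate V q x = (\<Sum>y\<in>V - {x}. q x y)"

definition jump_prob :: "'a set \<Rightarrow> ('a \<Rightarrow> 'a \<Rightarrow> real) \<Rightarrow> 'a \<Rightarrow> 'a \<Rightarrow> real" where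
  "jump_prob V q x y = (if x = y then 0 else q x y / exit_rate V q x)"

text \<open>
  The jump chain/holding time definition of a right-continuous Markov jump process
  on \<open>V\<close> with jump rates \<open>q\<close> and initial law \<open>p\<close>: the jump chain \<open>J\<close> is the Markov chain
  with initial law \<open>p\<close> and transition matrix \<open>jump_prob V q\<close>, and given \<open>J\<close> the holding times
  \<open>T 0, T 1, \<dots>\<close> are independent, \<open>T i\<close> being exponential of parameter \<open>exit_rate V q (J i)\<close>.
  Both facts are expressed by the joint law of \<open>J 0, \<dots>, J k, T 0, \<dots>, T k\<close>.
  Absorbing states are excluded, so holding times are finite. Only the values \<open>X t\<close> with
  \<open>t \<ge> 0\<close> are constrained.
\<close>

definition markov_jump_process ::
  "'a set \<Rightarrow> ('a \<Rightarrow> 'a \<Rightarrow> real) \<Rightarrow> 'a pmf \<Rightarrow> 'b measure \<Rightarrow> (real \<Rightarrow> 'b \<Rightarrow> 'a) \<Rightarrow> bool" where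
  "markov_jump_process V q p P X \<longleftrightarrow>
     prob_space P \<and>
     finite V \<and> (\<forall>x\<in>V. \<forall>y\<in>V. x \<noteq> y \<longrightarrow> 0 \<le> q x y) \<and> (\<forall>x\<in>V. 0 < exit_rate V q x) \<and>
     set_pmf p \<subseteq> V \<and>
     (\<exists>(J :: nat \<Rightarrow> 'b \<Rightarrow> 'a) (T :: nat \<Rightarrow> 'b \<Rightarrow> real).
        (\<forall>k. J k \<in> measurable P (count_space V)) \<and>
        (\<forall>k. T k \<in> borel_measurable P) \<and>
        (\<forall>k x s. (\<forall>i\<le>k. x i \<in> V \<and> 0 \<le> s i) \<longrightarrow>
           measure P {w \<in> space P. \<forall>i\<le>k. J i w = x i \<and> s i < T i w} =
             pmf p (x 0) * (\<Prod>i<k. jump_prob V q (x i) (x (Suc i)))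
                         * (\<Prod>i\<le>k. exp (- exit_rate V q (x i) * s i))) \<and>
        (\<forall>w\<in>space P. (\<forall>k. 0 < T k w) \<and>
           filterlim (\<lambda>k. \<Sum>i<k. T i w) at_top sequentially \<and>
           (\<forall>k t. (\<Sum>i<k. T i w) \<le> t \<and> t < (\<Sum>i<Suc k. T i w) \<longrightarrow> X t w = J k w)))"

definition cube :: "nat \<Rightarrow> (nat \<Rightarrow> real) set" where
  "cube n = ({..<n} \<rightarrow>\<^sub>E {-1, 1})"

definition cube_edge :: "nat \<Rightarrow> (nat \<Rightarrow> real) \<Rightarrow> (nat \<Rightarrow> real) \<Rightarrow> bool" where
  "cube_edge n x y \<longleftrightarrow> x \<in> cube n \<and> y \<in> cube n \<and> card {i. i < n \<and> x i \<noteq> y i} = 1"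

definition cube_inner :: "nat \<Rightarrow> (nat \<Rightarrow> real) \<Rightarrow> (nat \<Rightarrow> real) \<Rightarrow> real" where
  "cube_inner n x y = (\<Sum>i<n. x i * y i)"

definition tau :: "real \<Rightarrow> real \<Rightarrow> real" where
  "tau \<beta> h = exp (- \<beta> * h)"

definition hop_rate :: "nat \<Rightarrow> real \<Rightarrow> ((nat \<Rightarrow> real) \<Rightarrow> real) \<Rightarrow> (nat \<Rightarrow> real) \<Rightarrow> (nat \<Rightarrow> real) \<Rightarrow> real" where
  "hop_rate n \<beta> h x y = (if cube_edge n x y then 1 / (real n * tau \<beta> (h x)) else 0)"

definition correlation ::
  "nat \<Rightarrow> real \<Rightarrow> 'b measure \<Rightarrow> (real \<Rightarrow> 'b \<Rightarrow> (nat \<Rightarrow> real)) \<Rightarrow> real \<Rightarrow> real \<Rightarrow> real" where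
  "correlation n c P X t s =
     measure P {w \<in> space P. \<forall>u. t \<le> u \<and> u < t + s \<longrightarrow>
                  cube_inner n (X (c * t) w) (X (c * u) w) / real n = 1}"

definition intermediate_scale :: "real \<Rightarrow> (nat \<Rightarrow> real) \<Rightarrow> bool" where
  "intermediate_scale \<epsilon> a \<longleftrightarrow>
     0 < \<epsilon> \<and> \<epsilon> \<le> 1 \<and>
     (\<lambda>n. ln (a n) / (real n * ln 2)) \<longlonglongrightarrow> \<epsilon> \<and>
     (\<lambda>n. a n / 2 ^ n) \<longlonglongrightarrow> 0"

definition beta_c :: "real \<Rightarrow> real" where
  "beta_c \<epsilon> = sqrt (2 * \<epsilon> * ln 2)"

definition alpha :: "real \<Rightarrow> real \<Rightarrow> real" where
  "alpha \<epsilon> \<beta> = beta_c \<epsilon> / \<beta>"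

definition Asl :: "real \<Rightarrow> real \<Rightarrow> real" where
  "Asl a u = sin (a * pi) / pi * (LBINT x:{0..u}. (1 - x) powr (- a) * x powr (- 1 + a))"

definition converges_in_probability :: "'w measure \<Rightarrow> (nat \<Rightarrow> 'w \<Rightarrow> real) \<Rightarrow> real \<Rightarrow> bool" where
  "converges_in_probability M Y l \<longleftrightarrow>
     (\<forall>\<delta>>0. (\<lambda>n. measure M {\<omega> \<in> space M. \<delta> < \<bar>Y n \<omega> - l\<bar>}) \<longlonglongrightarrow> 0)"

end

theory Submission
  imports Defs "HOL-Real_Asymp.Real_Asymp"
begin

text \<open>
  The event in the correlation function says that the process does not jump in a time interval. Since
  holding times are memoryless, its Laplace transform in \<open>t\<close> is the mean of \<open>exp (- s r)\<close>, where \<open>r\<close> is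
  the exit rate at the site where the simple random walk on the cube is killed, the killing probability
  at \<open>x\<close> being \<open>\<phi> x = l / (l + r x)\<close>. The Green kernel of the walk is almost concentrated on the diagonal,
  and deep traps are sparse, so that the killing site has approximately the density \<open>\<phi> / (\<Sum>x. \<phi> x)\<close>. The two
  sums over the environment concentrate around Gaussian integrals by Chebyshev's inequality, with
  an error probability of order \<open>a n / 2 ^ n\<close>, and these integrals converge to integrals against
  \<open>exp (- \<alpha> x)\<close>; their quotient is the Laplace transform of the arcsine law. Up to a linear term the
  correlation is monotone in \<open>t\<close>, so convergence of its transforms implies pointwise convergence.
\<close>

section \<open>The Green kernel of the random walk on the cube\<close>

text \<open>For fixed \<open>l\<close> the transform in \<open>t\<close> reduces the problem to a
  quotient of two sums over independent sites, so no limit theorem for the clock is needed. The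
  obstacle is that deep traps may lie close together, so that the walk feels several of them at
  once. A site is deep with probability of order 1 / a n, while the rows of the Green kernel sum to
  at most 2 n^2; after rescaling by a n the interaction of distinct traps therefore has mean of
  order n^2 / a n. This is summable because a n grows exponentially. The fluctuations, of order a n
  / 2 ^ n, are the only error that may fail to be summable, which is the origin of the dichotomy
  between almost sure convergence and convergence in probability. Only the transforms at l = 1, 2,
  ... enter, so for each s there are countably many exceptional events, and none of them involves t.
  One null set thus serves all t, and monotonicity in s carries it from rational to real s.\<close>

definition hamming :: "nat \<Rightarrow> (nat \<Rightarrow> real) \<Rightarrow> (nat \<Rightarrow> real) \<Rightarrow> nat" where
  "hamming n x y = card {i. i < n \<and> x i \<noteq> y i}"

definition flip :: "nat \<Rightarrow> (nat \<Rightarrow> real) \<Rightarrow> (nat \<Rightarrow> real)" where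
  "flip i x = x(i := - x i)"

definition nbr_avg :: "nat \<Rightarrow> ((nat \<Rightarrow> real) \<Rightarrow> real) \<Rightarrow> (nat \<Rightarrow> real) \<Rightarrow> real" where
  "nbr_avg n u x = (\<Sum>i<n. u (flip i x)) / real n"

definition cube_mean :: "nat \<Rightarrow> ((nat \<Rightarrow> real) \<Rightarrow> real) \<Rightarrow> real" where
  "cube_mean n u = (\<Sum>x\<in>cube n. u x) / 2 ^ n"

definition binomial_tail :: "nat \<Rightarrow> nat \<Rightarrow> real" where
  "binomial_tail n d = (\<Sum>i\<in>{d<..n}. real (n choose i))"

text \<open>A unit source at a vertex, absorbed uniformly on the cube, sends the flow \<open>binomial_tail n j / 2 ^ n\<close>
  from the ball of radius \<open>j\<close> outwards; dividing by the number of edges leaving the ball gives, after multiplication by \<open>n\<close>,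
  the difference of the potential at distances \<open>j\<close> and \<open>j + 1\<close>.\<close>

definition green_step :: "nat \<Rightarrow> nat \<Rightarrow> real" where
  "green_step n j = binomial_tail n j / (2 ^ n * real ((n - 1) choose j))"

text \<open>Normalised to vanish at distance \<open>n\<close>, hence nonnegative. The additive
  constant is harmless in the representation formula, where the kernel only acts on functions
  \<open>u - nbr_avg n u\<close>, whose mean is zero.\<close>

definition green :: "nat \<Rightarrow> nat \<Rightarrow> real" where
  "green n d = (\<Sum>j\<in>{d..<n}. green_step n j)"

section \<open>The Poisson equation for radial functions\<close>

lemma binomial_tail_nonneg: "0 \<le> binomial_tail n d"
  unfolding binomial_tail_def by (intro sum_nonneg) auto

lemma green_step_nonneg: "0 \<le> green_step n j"
  unfolding green_step_def by (intro divide_nonneg_nonneg binomial_tail_nonneg) auto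

lemma green_nonneg: "0 \<le> green n d"
  unfolding green_def by (intro sum_nonneg green_step_nonneg)

lemma green_Suc: "d < n \<Longrightarrow> green n d = green_step n d + green n (Suc d)"
  unfolding green_def by (subst sum.atLeast_Suc_lessThan) auto

lemma binomial_tail_Suc: "d < n \<Longrightarrow> binomial_tail n d = real (n choose Suc d) + binomial_tail n (Suc d)"
proof -
  assume "d < n"
  then have "{d<..n} = insert (Suc d) {Suc d<..n}" by auto
  then show ?thesis by (simp add: binomial_tail_def)
qed

lemma binomial_tail_0: "binomial_tail n 0 = 2 ^ n - 1"
proof -
  have "(\<Sum>i\<le>n. real (n choose i)) = 2 ^ n"
    using choose_row_sum[of n] by (metis of_nat_numeral of_nat_power of_nat_sum)
  moreover have "{..n} = insert 0 {0<..n}" by auto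
  ultimately show ?thesis by (simp add: binomial_tail_def)
qed

lemma frac_cancel:
  fixes a D n C P t :: real
  assumes "a * D = n * C" "n > 0" "C > 0" "D > 0" "P > 0"
  shows "a / n * (t / (P * C)) = t / (P * D)"
proof -
  have "a = n * C / D" using assms by (simp add: field_simps)
  then show ?thesis using assms by simp
qed

text \<open>This and \<open>green_step_down\<close> describe the flow through the edges between the
  spheres of radius \<open>d\<close> and \<open>Suc d\<close>, divided by the size of the inner and
  of the outer sphere. Both come from counting these edges in two ways.\<close>

lemma green_step_up:
  assumes "d < n" shows "real (n - d) / real n * green_step n d = binomial_tail n d / (2 ^ n * real (n choose d))"
proof -
  have "(n - d) * (n choose d) = n * ((n - 1) choose d)"
    using binomial_absorb_comp[of n d] by simp
  then have e: "real (n - d) * real (n choose d) = real n * real ((n - 1) choose d)"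
    by (metis of_nat_mult)
  have "real ((n - 1) choose d) > 0" "real (n choose d) > 0" "real n > 0" using assms by auto
  then show ?thesis using e unfolding green_step_def by (intro frac_cancel) auto
qed

lemma green_step_down:
  assumes "d < n" shows "real (Suc d) / real n * green_step n d = binomial_tail n d / (2 ^ n * real (n choose Suc d))"
proof -
  have "Suc d * (n choose Suc d) = n * ((n - 1) choose d)"
    using binomial_absorption[of d n] by simp
  then have e: "real (Suc d) * real (n choose Suc d) = real n * real ((n - 1) choose d)"
    by (metis of_nat_mult)
  have "real ((n - 1) choose d) > 0" "real (n choose Suc d) > 0" "real n > 0" using assms by auto
  then show ?thesis using e unfolding green_step_def by (intro frac_cancel) auto
qed

text \<open>From distance d the walk moves inwards with probability d / n and outwards with
  probability (n - d) / n. In and out flow differ by \<open>n choose d\<close>, the absorption on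
  the sphere, which yields the term 1 / 2 ^ n. The values at the truncated \<open>d - 1\<close> for
  d = 0 and at \<open>Suc d\<close> for d = n carry the coefficient 0.\<close>

lemma green_recursion:
  assumes n: "1 \<le> n" and d: "d \<le> n"
  shows "real d / real n * green n (d - 1) + real (n - d) / real n * green n (Suc d) =
           green n d - (if d = 0 then 1 else 0) + 1 / 2 ^ n"
proof -
  have up: "real (n - d) / real n * green n (Suc d) =
      real (n - d) / real n * green n d - binomial_tail n d / (2 ^ n * real (n choose d))"
  proof (cases "d = n")
    case True then show ?thesis by (simp add: binomial_tail_def)
  next
    case False
    then have "d < n" using d by auto
    then show ?thesis using green_Suc[of d n] green_step_up[of d n] by (simp only: distrib_left)
  qed
  have split: "real (n - d) / real n = 1 - real d / real n"
    using d n by (simp add: field_simps of_nat_diff)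
  show ?thesis
  proof (cases d)
    case 0
    then show ?thesis using up n by (simp add: binomial_tail_0 field_simps)
  next
    case (Suc e)
    then have e: "e < n" using d by auto
    have ch: "real (n choose d) > 0" using d by simp
    have "real d / real n * green n e = real d / real n * green n d + binomial_tail n e / (2 ^ n * real (n choose d))"
      using green_Suc[OF e] green_step_down[OF e] Suc by (simp only: distrib_left)
    also have "binomial_tail n e / (2 ^ n * real (n choose d)) =
        1 / 2 ^ n + binomial_tail n d / (2 ^ n * real (n choose d))"
      using binomial_tail_Suc[OF e] Suc ch by (simp add: field_simps)
    finally show ?thesis using up Suc unfolding split by (simp add: algebra_simps)
  qed
qed

section \<open>Vertices, flips and the neighbour average\<close>

lemma finite_cube: "finite (cube n)"
  unfolding cube_def by (intro finite_PiE) auto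

lemma card_cube: "card (cube n) = 2 ^ n"
  unfolding cube_def by (subst card_PiE) (auto simp: numeral_2_eq_2)

lemma cube_nonempty: "cube n \<noteq> {}"
  using card_cube[of n] by (metis card.empty power_not_zero zero_neq_numeral)

lemma cube_vals: "x \<in> cube n \<Longrightarrow> i < n \<Longrightarrow> x i = -1 \<or> x i = 1"
  unfolding cube_def by (auto simp: PiE_iff)

lemma cube_ext: "x \<in> cube n \<Longrightarrow> y \<in> cube n \<Longrightarrow> (\<And>i. i < n \<Longrightarrow> x i = y i) \<Longrightarrow> x = y"
  unfolding cube_def by (rule PiE_ext[of x "{..<n}" _ y]) auto

lemma flip_cube: "x \<in> cube n \<Longrightarrow> i < n \<Longrightarrow> flip i x \<in> cube n"
  unfolding cube_def flip_def by (auto simp: PiE_iff extensional_def)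

lemma flip_flip [simp]: "flip i (flip i x) = x"
  by (simp add: flip_def fun_eq_iff)

lemma sum_cube_flip:
  assumes "i < n" shows "(\<Sum>x\<in>cube n. u (flip i x)) = (\<Sum>x\<in>cube n. u x)"
  by (rule sum.reindex_bij_witness[of _ "flip i" "flip i"]) (auto intro: flip_cube assms)

lemma hamming_le: "hamming n x y \<le> n"
proof -
  have "card {i. i < n \<and> x i \<noteq> y i} \<le> card {..<n}" by (rule card_mono) auto
  then show ?thesis by (simp add: hamming_def)
qed

lemma hamming_self [simp]: "hamming n x x = 0"
  by (simp add: hamming_def)

lemma hamming_eq_0_iff:
  assumes "x \<in> cube n" "y \<in> cube n" shows "hamming n x y = 0 \<longleftrightarrow> x = y"
  using cube_ext[OF assms] by (auto simp: hamming_def)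

lemma hamming_flip:
  assumes x: "x \<in> cube n" and y: "y \<in> cube n" and i: "i < n"
  shows "hamming n x (flip i y) = (if x i \<noteq> y i then hamming n x y - 1 else Suc (hamming n x y))"
proof -
  have ne: "x j \<noteq> - y j \<longleftrightarrow> x j = y j" if "j < n" for j
    using cube_vals[OF x that] cube_vals[OF y that] by auto
  show ?thesis
  proof (cases "x i = y i")
    case True
    then have "{j. j < n \<and> x j \<noteq> flip i y j} = insert i {j. j < n \<and> x j \<noteq> y j}"
      using i ne[OF i] by (auto simp: flip_def)
    then show ?thesis using True by (simp add: hamming_def)
  next
    case False
    then have "{j. j < n \<and> x j \<noteq> flip i y j} = {j. j < n \<and> x j \<noteq> y j} - {i}"
      using i ne[OF i] by (auto simp: flip_def)
    then show ?thesis using False i by (simp add: hamming_def)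
  qed
qed

lemma nbr_avg_green:
  assumes n: "1 \<le> n" and x: "x \<in> cube n" and y: "y \<in> cube n"
  shows "nbr_avg n (\<lambda>z. green n (hamming n x z)) y =
           green n (hamming n x y) - (if x = y then 1 else 0) + 1 / 2 ^ n"
proof -
  let ?d = "hamming n x y"
  let ?D = "{i. i < n \<and> x i \<noteq> y i}" and ?E = "{i. i < n \<and> x i = y i}"
  have U: "{..<n} = ?D \<union> ?E" "?D \<inter> ?E = {}" by auto
  have cE: "card ?E = n - ?d"
  proof -
    have "card {..<n} = card ?D + card ?E" unfolding U(1) by (rule card_Un_disjoint) (use U in auto)
    then show ?thesis by (simp add: hamming_def)
  qed
  have "(\<Sum>i<n. green n (hamming n x (flip i y))) =
      (\<Sum>i\<in>?D. green n (hamming n x (flip i y))) + (\<Sum>i\<in>?E. green n (hamming n x (flip i y)))"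
    unfolding U(1) by (rule sum.union_disjoint) (use U in auto)
  also have "(\<Sum>i\<in>?D. green n (hamming n x (flip i y))) = (\<Sum>i\<in>?D. green n (?d - 1))"
    by (rule sum.cong) (auto simp: hamming_flip[OF x y])
  also have "\<dots> = real ?d * green n (?d - 1)" by (simp add: hamming_def)
  also have "(\<Sum>i\<in>?E. green n (hamming n x (flip i y))) = (\<Sum>i\<in>?E. green n (Suc ?d))"
    by (rule sum.cong) (auto simp: hamming_flip[OF x y])
  also have "\<dots> = real (n - ?d) * green n (Suc ?d)" using cE by simp
  finally have "nbr_avg n (\<lambda>z. green n (hamming n x z)) y =
      real ?d / real n * green n (?d - 1) + real (n - ?d) / real n * green n (Suc ?d)"
    by (simp add: nbr_avg_def add_divide_distrib)
  then show ?thesis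
    using green_recursion[OF n hamming_le[of n x y]] hamming_eq_0_iff[OF x y] by simp
qed

text \<open>The averaging operator is self-adjoint for counting measure, since each flip is an
  involution of the cube.\<close>

lemma sum_cube_nbr_avg:
  "(\<Sum>x\<in>cube n. v x * nbr_avg n u x) = (\<Sum>x\<in>cube n. nbr_avg n v x * u x)"
proof -
  have "(\<Sum>x\<in>cube n. v x * nbr_avg n u x) = (\<Sum>i<n. \<Sum>x\<in>cube n. v x * u (flip i x)) / real n"
    unfolding nbr_avg_def times_divide_eq_right sum_divide_distrib[symmetric] sum_distrib_left
    by (subst sum.swap) simp
  also have "(\<Sum>i<n. \<Sum>x\<in>cube n. v x * u (flip i x)) = (\<Sum>i<n. \<Sum>x\<in>cube n. v (flip i x) * u x)"
  proof (rule sum.cong[OF refl])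
    fix i assume "i \<in> {..<n}"
    then show "(\<Sum>x\<in>cube n. v x * u (flip i x)) = (\<Sum>x\<in>cube n. v (flip i x) * u x)"
      using sum_cube_flip[of i n "\<lambda>x. v (flip i x) * u x"] by simp
  qed
  also have "(\<Sum>i<n. \<Sum>x\<in>cube n. v (flip i x) * u x) / real n = (\<Sum>x\<in>cube n. nbr_avg n v x * u x)"
    unfolding nbr_avg_def times_divide_eq_left sum_divide_distrib[symmetric] sum_distrib_right
    by (subst sum.swap) simp
  finally show ?thesis .
qed

text \<open>Self-adjointness moves the average from \<open>u\<close> onto the kernel, where the
  Poisson equation turns it into a point mass at \<open>x\<close> minus the uniform law.\<close>

lemma green_represents:
  assumes n: "1 \<le> n" and x: "x \<in> cube n"
  shows "(\<Sum>y\<in>cube n. green n (hamming n x y) * (u y - nbr_avg n u y)) = u x - cube_mean n u"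
proof -
  have "(\<Sum>y\<in>cube n. green n (hamming n x y) * (u y - nbr_avg n u y)) =
     (\<Sum>y\<in>cube n. green n (hamming n x y) * u y) - (\<Sum>y\<in>cube n. green n (hamming n x y) * nbr_avg n u y)"
    by (simp add: right_diff_distrib sum_subtractf)
  also have "\<dots> = (\<Sum>y\<in>cube n. (green n (hamming n x y) - nbr_avg n (\<lambda>z. green n (hamming n x z)) y) * u y)"
    by (simp add: sum_cube_nbr_avg left_diff_distrib sum_subtractf)
  also have "\<dots> = (\<Sum>y\<in>cube n. (if x = y then u y else 0) - u y / 2 ^ n)"
    by (rule sum.cong[OF refl]) (simp add: nbr_avg_green[OF n x] left_diff_distrib)
  also have "\<dots> = u x - cube_mean n u"
    using x finite_cube[of n] by (simp add: sum_subtractf cube_mean_def sum_divide_distrib)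
  finally show ?thesis .
qed

lemma cube_mean_nbr_avg: "1 \<le> n \<Longrightarrow> cube_mean n (nbr_avg n u) = cube_mean n u"
  using sum_cube_nbr_avg[where v="\<lambda>_. 1" and u=u and n=n]
  by (simp add: cube_mean_def nbr_avg_def)

lemma nbr_avg_mono: "(\<And>y. y \<in> cube n \<Longrightarrow> u y \<le> v y) \<Longrightarrow> x \<in> cube n \<Longrightarrow> nbr_avg n u x \<le> nbr_avg n v x"
  unfolding nbr_avg_def by (intro divide_right_mono sum_mono) (auto intro: flip_cube)

lemma nbr_avg_const: "1 \<le> n \<Longrightarrow> nbr_avg n (\<lambda>_. c) x = c"
  by (simp add: nbr_avg_def)

text \<open>The interaction of distinct killing sites. The diagonal is left out because it is close
  to 1 and is treated exactly.\<close>

definition pair_energy :: "nat \<Rightarrow> ((nat \<Rightarrow> real) \<Rightarrow> real) \<Rightarrow> real" where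
  "pair_energy n \<phi> = cube_mean n (\<lambda>x. \<Sum>y\<in>cube n - {x}. green n (hamming n x y) * (\<phi> x * \<phi> y))"

text \<open>Since \<open>u - P u\<close> has mean zero and is at most \<open>\<phi>\<close> in absolute value, the Green kernel of the
  simple random walk bounds the deviation of \<open>P u\<close> from its mean; the diagonal of the kernel is close to 1,
  which cancels in \<open>P u = u - (u - P u)\<close>.\<close>

lemma killed_mean_approx:
  assumes n: "1 \<le> n"
    and phi: "\<And>x. x \<in> cube n \<Longrightarrow> 0 \<le> \<phi> x" "\<And>x. x \<in> cube n \<Longrightarrow> \<phi> x \<le> 1"
    and f: "\<And>x. x \<in> cube n \<Longrightarrow> 0 \<le> f x" "\<And>x. x \<in> cube n \<Longrightarrow> f x \<le> 1"
    and u: "\<And>x. x \<in> cube n \<Longrightarrow> 0 \<le> u x" "\<And>x. x \<in> cube n \<Longrightarrow> u x \<le> 1"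
    and eq: "\<And>x. x \<in> cube n \<Longrightarrow> u x = \<phi> x * f x + (1 - \<phi> x) * nbr_avg n u x"
  shows "\<bar>cube_mean n (\<lambda>x. \<phi> x * f x) - cube_mean n u * cube_mean n \<phi>\<bar>
    \<le> (green n 1 + 1 / 2 ^ n) * cube_mean n \<phi> + pair_energy n \<phi>"
proof -
  define v where "v = nbr_avg n u"
  define g where "g = (\<lambda>x. u x - v x)"
  define m where "m = cube_mean n u"
  have v01: "0 \<le> v x" "v x \<le> 1" if "x \<in> cube n" for x
    using nbr_avg_mono[of n "\<lambda>_. 0" u x] nbr_avg_mono[of n u "\<lambda>_. 1" x] u that n
    by (auto simp: v_def nbr_avg_const)
  have g_eq: "g x = \<phi> x * (f x - v x)" if "x \<in> cube n" for x
    using eq[OF that] by (simp add: g_def v_def algebra_simps)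
  have g_le: "\<bar>g x\<bar> \<le> \<phi> x" if "x \<in> cube n" for x
  proof -
    have "\<bar>f x - v x\<bar> \<le> 1" using f[OF that] v01[OF that] by auto
    then have "\<phi> x * \<bar>f x - v x\<bar> \<le> \<phi> x" using phi[OF that] by (simp add: mult_left_le)
    then show ?thesis using phi[OF that] by (simp add: g_eq[OF that] abs_mult)
  qed
  have "cube_mean n g = 0"
    using cube_mean_nbr_avg[OF n, of u] by (simp add: g_def v_def cube_mean_def sum_subtractf)
  \<comment> \<open>The mean of \<open>u\<close> minus its average vanishes, so \<open>f\<close> may
    be replaced by \<open>v\<close>; after that only the deviation of \<open>v\<close> from a
    constant matters.\<close>
  then have sum0: "(\<Sum>x\<in>cube n. \<phi> x * f x) = (\<Sum>x\<in>cube n. \<phi> x * v x)"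
    by (simp add: cube_mean_def g_eq right_diff_distrib sum_subtractf cong: sum.cong)
  \<comment> \<open>The Poisson equation at distance 0 reads
    \<open>green n 0 - 1 = green n 1 - 1 / 2 ^ n\<close>.\<close>
  have diag: "\<bar>green n 0 - 1\<bar> \<le> green n 1 + 1 / 2 ^ n"
    using green_recursion[OF n, of 0] n green_nonneg[of n 1] by (auto simp: abs_le_iff)
  have dev: "\<bar>v x - m\<bar> \<le> (green n 1 + 1 / 2 ^ n) + (\<Sum>y\<in>cube n - {x}. green n (hamming n x y) * \<phi> y)"
    if x: "x \<in> cube n" for x
  proof -
    \<comment> \<open>Representing \<open>u\<close> instead of \<open>v\<close> and subtracting
      \<open>g x\<close> removes the unit mass on the diagonal, which alone would be of order
      \<open>\<phi> x\<close> and not small.\<close>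
    have "v x - m = (\<Sum>y\<in>cube n. green n (hamming n x y) * g y) - g x"
      using green_represents[OF n x, of u] by (simp add: g_def v_def m_def)
    also have "\<dots> = (green n 0 - 1) * g x + (\<Sum>y\<in>cube n - {x}. green n (hamming n x y) * g y)"
      by (subst sum.remove[OF finite_cube x]) (simp add: algebra_simps)
    also have "\<bar>\<dots>\<bar> \<le> \<bar>green n 0 - 1\<bar> * \<bar>g x\<bar> + (\<Sum>y\<in>cube n - {x}. \<bar>green n (hamming n x y) * g y\<bar>)"
      by (rule order_trans[OF abs_triangle_ineq]) (simp only: abs_mult[of "green n 0 - 1"] add_left_mono sum_abs)
    also have "\<dots> \<le> (green n 1 + 1 / 2 ^ n) * 1 + (\<Sum>y\<in>cube n - {x}. green n (hamming n x y) * \<phi> y)"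
      using diag g_le x phi(2)[OF x] green_nonneg
      by (intro add_mono mult_mono sum_mono) (force simp: abs_mult intro: mult_left_mono)+
    finally show ?thesis by simp
  qed
  have "\<bar>(\<Sum>x\<in>cube n. \<phi> x * f x) - m * (\<Sum>x\<in>cube n. \<phi> x)\<bar> = \<bar>\<Sum>x\<in>cube n. \<phi> x * (v x - m)\<bar>"
    unfolding sum0 by (simp add: right_diff_distrib sum_subtractf sum_distrib_left mult.commute)
  also have "\<dots> \<le> (\<Sum>x\<in>cube n. \<phi> x * \<bar>v x - m\<bar>)"
    using phi by (intro order_trans[OF sum_abs] sum_mono) (simp add: abs_mult)
  also have "\<dots> \<le> (\<Sum>x\<in>cube n. \<phi> x * ((green n 1 + 1 / 2 ^ n) + (\<Sum>y\<in>cube n - {x}. green n (hamming n x y) * \<phi> y)))"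
    using phi dev by (intro sum_mono mult_left_mono) auto
  also have "\<dots> = (green n 1 + 1 / 2 ^ n) * (\<Sum>x\<in>cube n. \<phi> x) +
      (\<Sum>x\<in>cube n. \<Sum>y\<in>cube n - {x}. green n (hamming n x y) * (\<phi> x * \<phi> y))"
  proof -
    have "\<phi> x * (K + (\<Sum>y\<in>cube n - {x}. green n (hamming n x y) * \<phi> y)) =
        K * \<phi> x + (\<Sum>y\<in>cube n - {x}. green n (hamming n x y) * (\<phi> x * \<phi> y))" for x K
      by (simp add: distrib_left sum_distrib_left mult_ac)
    then show ?thesis by (simp only: sum.distrib sum_distrib_left[symmetric])
  qed
  finally have "\<bar>(\<Sum>x\<in>cube n. \<phi> x * f x) - m * (\<Sum>x\<in>cube n. \<phi> x)\<bar> / 2 ^ n \<le> \<dots> / 2 ^ n"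
    by (rule divide_right_mono) simp
  moreover have "\<bar>a / 2 ^ n\<bar> = \<bar>a\<bar> / 2 ^ n" for a :: real by simp
  ultimately show ?thesis
    unfolding cube_mean_def[of n "\<lambda>x. \<phi> x * f x"] cube_mean_def[of n \<phi>] pair_energy_def m_def[symmetric]
      cube_mean_def[of n "\<lambda>x. \<Sum>y\<in>cube n - {x}. green n (hamming n x y) * (\<phi> x * \<phi> y)"]
    by (simp only: add_divide_distrib diff_divide_distrib times_divide_eq_right flip: \<open>\<And>a. \<bar>a / 2 ^ n\<bar> = \<bar>a\<bar> / 2 ^ n\<close>)
qed

section \<open>Size of the Green kernel\<close>

lemma card_hamming_le:
  assumes x: "x \<in> cube n"
  shows "real (card {y \<in> cube n. hamming n x y \<le> j}) \<le> (\<Sum>i\<le>j. real (n choose i))"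
proof -
  have c: "card {y \<in> cube n. hamming n x y = i} \<le> n choose i" for i
  proof -
    have "card {y \<in> cube n. hamming n x y = i} \<le> card {B. B \<subseteq> {..<n} \<and> card B = i}"
    proof (rule card_inj_on_le)
      show "inj_on (\<lambda>y. {i. i < n \<and> x i \<noteq> y i}) {y \<in> cube n. hamming n x y = i}"
      proof (rule inj_onI, clarify)
        fix y z assume yz: "y \<in> cube n" "z \<in> cube n" and e: "{i. i < n \<and> x i \<noteq> y i} = {i. i < n \<and> x i \<noteq> z i}"
        show "y = z"
        proof (rule cube_ext[OF yz])
          fix i assume i: "i < n"
          have "x i \<noteq> y i \<longleftrightarrow> x i \<noteq> z i" using e i by blast
          then show "y i = z i" using cube_vals[OF yz(1) i] cube_vals[OF yz(2) i] cube_vals[OF x i] by auto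
        qed
      qed
    qed (auto simp: hamming_def)
    then show ?thesis using n_subsets[of "{..<n}" i] by simp
  qed
  have "{y \<in> cube n. hamming n x y \<le> j} = (\<Union>i\<le>j. {y \<in> cube n. hamming n x y = i})" by auto
  then have "card {y \<in> cube n. hamming n x y \<le> j} \<le> (\<Sum>i\<le>j. card {y \<in> cube n. hamming n x y = i})"
    using card_UN_le[of "{..j}" "\<lambda>i. {y \<in> cube n. hamming n x y = i}"] by simp
  also have "\<dots> \<le> (\<Sum>i\<le>j. n choose i)" by (rule sum_mono) (rule c)
  finally have "card {y \<in> cube n. hamming n x y \<le> j} \<le> (\<Sum>i\<le>j. n choose i)" .
  then show ?thesis by (metis of_nat_le_iff of_nat_sum)
qed

lemma binomial_head_tail:
  assumes "j \<le> n" shows "(\<Sum>i\<le>j. real (n choose i)) + binomial_tail n j = 2 ^ n"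
proof -
  have "(\<Sum>i\<le>n. real (n choose i)) = 2 ^ n"
    using choose_row_sum[of n] by (metis of_nat_numeral of_nat_power of_nat_sum)
  moreover have "{..n} = {..j} \<union> {j<..n}" using assms by auto
  ultimately show ?thesis
    by (simp add: binomial_tail_def) (subst (asm) sum.union_disjoint; auto)
qed

text \<open>The product of head and tail of the binomial row is compared with the middle
  coefficient. For \<open>2 * j \<le> n\<close> the head is at most \<open>Suc j\<close> times its
  last term by unimodality and the tail is at most 2 ^ n; for larger j the roles are exchanged. The
  factor 2 is the price for passing from row n to row n - 1.\<close>

lemma green_step_head_le:
  assumes j: "j < n"
  shows "green_step n j * (\<Sum>i\<le>j. real (n choose i)) \<le> 2 * real n"
proof -
  let ?h = "\<Sum>i\<le>j. real (n choose i)" and ?t = "binomial_tail n j" and ?c = "real ((n - 1) choose j)"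
  have hn: "0 \<le> ?h" by (intro sum_nonneg) auto
  have tn: "0 \<le> ?t" by (rule binomial_tail_nonneg)
  have c: "?c > 0" using j by simp
  have ht: "?h * ?t \<le> 2 ^ n * (2 * real n * ?c)"
  proof (cases "2 * j \<le> n")
    case True
    have "?h \<le> (\<Sum>i\<le>j. real (n choose j))"
      using True by (intro sum_mono) (auto intro: binomial_mono)
    also have "\<dots> = real (Suc j) * real (n choose j)" by simp
    also have "\<dots> \<le> real n * (2 * ?c)"
    proof (rule mult_mono)
      have "(n - j) * (n choose j) = n * ((n - 1) choose j)"
        using binomial_absorb_comp[of n j] by simp
      then have "n * (n choose j) \<le> n * (2 * ((n - 1) choose j))"
        using True mult_le_mono1[of n "2 * (n - j)" "n choose j"] by (simp add: mult.assoc mult.left_commute)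
      then have "n choose j \<le> 2 * ((n - 1) choose j)" using j by simp
      then show "real (n choose j) \<le> 2 * ?c" by (metis of_nat_le_iff of_nat_mult of_nat_numeral)
    qed (use j in auto)
    finally have "?h \<le> 2 * real n * ?c" by simp
    moreover have "?t \<le> 2 ^ n" using binomial_head_tail[of j n] j hn by simp
    ultimately show ?thesis using tn hn mult_mono[of ?h "2 * real n * ?c" ?t "2 ^ n"]
      by (simp add: mult_ac)
  next
    case False
    have "?t \<le> (\<Sum>i\<in>{j<..n}. real (n choose Suc j))"
      unfolding binomial_tail_def using False by (intro sum_mono) (auto intro: binomial_antimono)
    also have "\<dots> = real (n - j) * real (n choose Suc j)" by simp
    also have "\<dots> \<le> real n * (2 * ?c)"
    proof (rule mult_mono)
      have "Suc j * (n choose Suc j) = n * ((n - 1) choose j)"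
        using binomial_absorption[of j n] by simp
      moreover have "n * (n choose Suc j) \<le> (2 * Suc j) * (n choose Suc j)"
        using False by (intro mult_le_mono1) simp
      ultimately have "n * (n choose Suc j) \<le> n * (2 * ((n - 1) choose j))"
        by (simp only: mult.assoc mult.left_commute)
      then have "n choose Suc j \<le> 2 * ((n - 1) choose j)" using j by simp
      then show "real (n choose Suc j) \<le> 2 * ?c" by (metis of_nat_le_iff of_nat_mult of_nat_numeral)
    qed (use j in auto)
    finally have "?t \<le> 2 * real n * ?c" by simp
    moreover have "?h \<le> 2 ^ n" using binomial_head_tail[of j n] j tn by simp
    ultimately show ?thesis using tn hn mult_mono[of ?h "2 ^ n" ?t "2 * real n * ?c"] by simp
  qed
  show ?thesis
    unfolding green_step_def using ht c by (simp add: divide_le_eq mult_ac)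
qed

text \<open>The potential is a sum of steps, so exchanging the sums turns the row sum into the steps
  weighted by ball sizes: n terms, each at most 2 n.\<close>

lemma green_row_sum_le:
  assumes x: "x \<in> cube n"
  shows "(\<Sum>y\<in>cube n. green n (hamming n x y)) \<le> 2 * (real n)\<^sup>2"
proof -
  have "(\<Sum>y\<in>cube n. green n (hamming n x y)) =
     (\<Sum>y\<in>cube n. \<Sum>j<n. if hamming n x y \<le> j then green_step n j else 0)"
  proof (rule sum.cong[OF refl])
    fix y
    have "{hamming n x y..<n} = {j \<in> {..<n}. hamming n x y \<le> j}" by auto
    then show "green n (hamming n x y) = (\<Sum>j<n. if hamming n x y \<le> j then green_step n j else 0)"
      unfolding green_def by (simp only: sum.inter_filter[OF finite_lessThan])
  qed
  also have "\<dots> = (\<Sum>j<n. \<Sum>y\<in>cube n. if hamming n x y \<le> j then green_step n j else 0)"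
    by (rule sum.swap)
  also have "\<dots> = (\<Sum>j<n. green_step n j * real (card {y \<in> cube n. hamming n x y \<le> j}))"
    using finite_cube by (simp add: sum.inter_filter[symmetric] mult.commute)
  also have "\<dots> \<le> (\<Sum>j<n. 2 * real n)"
    by (intro sum_mono order_trans[OF mult_left_mono[OF card_hamming_le[OF x] green_step_nonneg]] green_step_head_le)
       auto
  finally show ?thesis by (simp add: power2_eq_square)
qed

text \<open>A step is at most the inverse of a binomial coefficient of row n - 1. The steps 1 and n
  - 2 give 1 / (n - 1) each; the remaining ones, apart from the last, are compared with
  \<open>(n - 1) choose 2\<close>, so that even n of them are of order 1 / n.\<close>

lemma green_one_le:
  assumes n: "6 \<le> n"
  shows "green n 1 \<le> 2 / (real n - 1) + 2 * real n / ((real n - 1) * (real n - 2)) + 1 / 2 ^ n"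
proof -
  have st: "green_step n j \<le> 1 / real ((n - 1) choose j)" if "j < n" for j
  proof -
    have "binomial_tail n j \<le> 2 ^ n"
      using binomial_head_tail[of j n] that sum_nonneg[of "{..j}" "\<lambda>i. real (n choose i)"] by simp
    then show ?thesis using that unfolding green_step_def by (simp add: field_simps)
  qed
  \<comment> \<open>For j = n - 1 the bound \<open>st\<close> is only 1, but the tail consists of a
    single term and the step is known exactly.\<close>
  have last: "green_step n (n - 1) = 1 / 2 ^ n"
  proof -
    have "{n - 1<..n} = {n}" using n by auto
    then show ?thesis by (simp add: green_step_def binomial_tail_def)
  qed
  have c2: "real ((n - 1) choose 2) = (real n - 1) * (real n - 2) / 2"
  proof -
    have "2 * ((n - 1) choose 2) = (n - 1) * (n - 2)"
      using binomial_absorption[of 1 "n - 1"] by (simp add: numeral_2_eq_2)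
    then have "2 * real ((n - 1) choose 2) = real (n - 1) * real (n - 2)"
      by (metis of_nat_mult of_nat_numeral)
    then show ?thesis using n by (simp add: of_nat_diff)
  qed
  have mid: "green_step n j \<le> 2 / ((real n - 1) * (real n - 2))" if j: "2 \<le> j" "j \<le> n - 3" for j
  proof -
    have "(n - 1) choose 2 \<le> (n - 1) choose j"
    proof (cases "2 * j \<le> n - 1")
      case True then show ?thesis using j by (intro binomial_mono) auto
    next
      case False
      have "(n - 1) choose 2 \<le> (n - 1) choose (n - 1 - j)"
        using False j n by (intro binomial_mono) auto
      then show ?thesis using binomial_symmetric[of j "n - 1"] j n by simp
    qed
    then have "real ((n - 1) choose 2) \<le> real ((n - 1) choose j)" by simp
    moreover have "real ((n - 1) choose 2) > 0" using n by simp
    ultimately have "1 / real ((n - 1) choose j) \<le> 1 / real ((n - 1) choose 2)"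
      using j n by (intro divide_left_mono mult_pos_pos) auto
    moreover have "j < n" using j n by auto
    ultimately show ?thesis using st[of j] unfolding c2 by simp
  qed
  have "{1..<n} = insert 1 (insert (n - 2) (insert (n - 1) {2..n-3}))" using n by auto
  then have "green n 1 = green_step n 1 + green_step n (n - 2) + green_step n (n - 1) + (\<Sum>j=2..n-3. green_step n j)"
  proof -
    have "1 \<notin> insert (n - 2) (insert (n - 1) {2..n-3})" "n - 2 \<notin> insert (n - 1) {2..n-3}" "n - 1 \<notin> {2..n-3}"
      using n by auto
    then show ?thesis unfolding green_def \<open>{1..<n} = _\<close> by simp
  qed
  also have "(\<Sum>j=2..n-3. green_step n j) \<le> (\<Sum>j=2..n-3. 2 / ((real n - 1) * (real n - 2)))"
    by (intro sum_mono mid) auto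
  also have "\<dots> \<le> real n * (2 / ((real n - 1) * (real n - 2)))"
    using n by (simp only: sum_constant) (intro mult_right_mono, auto)
  finally have 1: "green n 1 \<le> green_step n 1 + green_step n (n - 2) + green_step n (n - 1) + real n * (2 / ((real n - 1) * (real n - 2)))"
    by simp
  have 2: "green_step n 1 \<le> 1 / (real n - 1)" using st[of 1] n by (simp add: of_nat_diff)
  have "(n - 1) choose (n - 2) = n - 1"
    using binomial_symmetric[of 1 "n - 1"] n by (simp add: numeral_2_eq_2)
  then have 3: "green_step n (n - 2) \<le> 1 / (real n - 1)" using st[of "n - 2"] n by (simp add: of_nat_diff)
  show ?thesis using 1 2 3 last by (simp add: mult.commute)
qed

lemma green_one_tendsto: "(\<lambda>n. green n 1) \<longlonglongrightarrow> 0"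
proof (rule tendsto_sandwich)
  show "eventually (\<lambda>n. 0 \<le> green n 1) sequentially" by (simp add: green_nonneg)
  show "eventually (\<lambda>n. green n 1 \<le> 2 / (real n - 1) + 2 * real n / ((real n - 1) * (real n - 2)) + 1 / 2 ^ n) sequentially"
    using eventually_ge_at_top[of 6] by eventually_elim (rule green_one_le)
  show "(\<lambda>n. 2 / (real n - 1) + 2 * real n / ((real n - 1) * (real n - 2)) + 1 / 2 ^ n) \<longlonglongrightarrow> 0"
    by real_asymp
qed auto

section \<open>Inversion of Laplace transforms\<close>

text \<open>Against this probability law the Laplace transform at k + 1 becomes the integral of the
  k-th power of exp (- t), a monomial in a variable that ranges over a bounded interval.\<close>

abbreviation exp_law :: "real measure" where
  "exp_law \<equiv> density lborel (exponential_density 1)"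

lemma prob_space_exp_law: "prob_space exp_law"
  by (rule prob_space_exponential_density) simp

lemma AE_exp_law_nonneg: "AE t in exp_law. 0 \<le> t"
  by (subst AE_density) (auto simp: exponential_density_def)

lemma integrable_exp_law:
  fixes f :: "real \<Rightarrow> real"
  assumes "f \<in> borel_measurable borel" "\<And>t. 0 \<le> t \<Longrightarrow> \<bar>f t\<bar> \<le> B"
  shows "integrable exp_law f"
proof -
  interpret prob_space exp_law by (rule prob_space_exp_law)
  show ?thesis
    by (rule integrable_const_bound[of _ B]) (use assms AE_exp_law_nonneg in auto)
qed

text \<open>Used to divide by the mass of a bump function supported in an interval.\<close>

lemma exp_law_interval_pos:
  fixes w :: "real \<Rightarrow> real"
  assumes m: "w \<in> borel_measurable borel" and nn: "\<And>r. 0 \<le> w r" and B: "\<And>r. 0 \<le> r \<Longrightarrow> w r \<le> B"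
    and pos: "\<And>r. a < r \<Longrightarrow> r < b \<Longrightarrow> 0 < w r" and ab: "0 \<le> a" "a < b"
  shows "0 < (\<integral>r. w r \<partial>exp_law)"
proof -
  have i: "integrable exp_law w" using m nn B by (intro integrable_exp_law[of _ B]) auto
  have "(\<integral>r. w r \<partial>exp_law) \<noteq> 0"
  proof
    assume "(\<integral>r. w r \<partial>exp_law) = 0"
    then have "AE r in exp_law. w r = 0"
      using integral_nonneg_eq_0_iff_AE[OF i] nn by simp
    then have "AE r in lborel. 0 < ennreal (exponential_density 1 r) \<longrightarrow> w r = 0"
      using m by (subst (asm) AE_density) auto
    then have "AE r in lborel. r \<notin> {a<..<b}"
      by eventually_elim (use pos ab in \<open>force simp: exponential_density_def\<close>)
    then have "emeasure lborel {a<..<b} = 0"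
      by (subst (asm) AE_iff_measurable[of "{a<..<b}"]) auto
    then show False using ab by simp
  qed
  moreover have "0 \<le> (\<integral>r. w r \<partial>exp_law)" using nn by simp
  ultimately show ?thesis by linarith
qed

text \<open>Polynomials in \<open>exp (- t)\<close> are dense, and the one-sided Lipschitz condition turns weak
  convergence into pointwise convergence.\<close>

lemma laplace_inversion:
  fixes g :: "nat \<Rightarrow> real \<Rightarrow> real" and G :: "real \<Rightarrow> real"
  assumes g_meas: "\<And>n. g n \<in> borel_measurable borel" and G_meas: "G \<in> borel_measurable borel"
    and g01: "\<And>n t. 0 \<le> t \<Longrightarrow> 0 \<le> g n t" "\<And>n t. 0 \<le> t \<Longrightarrow> g n t \<le> 1"
    and G01: "\<And>t. 0 \<le> t \<Longrightarrow> 0 \<le> G t" "\<And>t. 0 \<le> t \<Longrightarrow> G t \<le> 1"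
    and onesided: "\<And>n t t'. 0 \<le> t \<Longrightarrow> t \<le> t' \<Longrightarrow> g n t \<le> g n t' + C * (t' - t)"
    and G_cont: "continuous_on {0..} G" and G0: "G 0 = 0"
    and lap: "\<And>k::nat. (\<lambda>n. \<integral>r. exp (- r) ^ k * g n r \<partial>exp_law) \<longlonglongrightarrow> (\<integral>r. exp (- r) ^ k * G r \<partial>exp_law)"
    and t: "0 \<le> t"
  shows "(\<lambda>n. g n t) \<longlonglongrightarrow> G t"
proof -
  interpret E: prob_space exp_law by (rule prob_space_exp_law)
  note [measurable] = g_meas G_meas
  have bound: "\<bar>g n r - G r\<bar> \<le> 1" if "0 \<le> r" for n r
    using g01[OF that, of n] G01[OF that] by (auto simp: abs_le_iff)
  have int: "integrable exp_law (\<lambda>r. \<Psi> (exp (- r)) * q r)"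
    if \<Psi>: "continuous_on UNIV \<Psi>" and [measurable]: "q \<in> borel_measurable borel" and q: "\<And>r. 0 \<le> r \<Longrightarrow> \<bar>q r\<bar> \<le> 1"
    for \<Psi> q :: "real \<Rightarrow> real"
  proof -
    have [measurable]: "\<Psi> \<in> borel_measurable borel" using \<Psi> by (rule borel_measurable_continuous_onI)
    have "compact (\<Psi> ` {0..1})"
      by (rule compact_continuous_image) (use \<Psi> continuous_on_subset in auto)
    then have "bounded (\<Psi> ` {0..1})" by (rule compact_imp_bounded)
    then obtain B where B: "\<And>x. x \<in> {0..1} \<Longrightarrow> \<bar>\<Psi> x\<bar> \<le> B"
      unfolding bounded_iff by fastforce
    show ?thesis
    proof (rule integrable_exp_law[of _ B])
      fix r :: real assume r: "0 \<le> r"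
      have "\<bar>\<Psi> (exp (- r))\<bar> * \<bar>q r\<bar> \<le> B * 1"
        using B[of "exp (- r)"] q[OF r] r by (intro mult_mono) (auto intro: order_trans[OF abs_ge_zero])
      then show "\<bar>\<Psi> (exp (- r)) * q r\<bar> \<le> B" by (simp add: abs_mult)
    qed measurable
  qed
  have poly: "(\<lambda>n. \<integral>r. (\<Sum>i\<le>N. a i * exp (- r) ^ i) * (g n r - G r) \<partial>exp_law) \<longlonglongrightarrow> 0" for a :: "nat \<Rightarrow> real" and N
  proof -
    have ii: "integrable exp_law (\<lambda>r. exp (- r) ^ k * q r)"
      if "q \<in> borel_measurable borel" "\<And>r. 0 \<le> r \<Longrightarrow> \<bar>q r\<bar> \<le> 1" for k and q :: "real \<Rightarrow> real"
      by (rule int[of "\<lambda>x. x ^ k"]) (use that in \<open>auto intro!: continuous_intros\<close>)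
    have ig: "integrable exp_law (\<lambda>r. exp (- r) ^ k * g n r)" for k n
      by (rule ii) (use g01 in auto)
    have iG: "integrable exp_law (\<lambda>r. exp (- r) ^ k * G r)" for k
      by (rule ii) (use G01 in auto)
    have "(\<integral>r. (\<Sum>i\<le>N. a i * exp (- r) ^ i) * (g n r - G r) \<partial>exp_law) =
       (\<Sum>i\<le>N. a i * ((\<integral>r. exp (- r) ^ i * g n r \<partial>exp_law) - (\<integral>r. exp (- r) ^ i * G r \<partial>exp_law)))" for n
    proof -
      have "(\<lambda>r. (\<Sum>i\<le>N. a i * exp (- r) ^ i) * (g n r - G r)) =
          (\<lambda>r. \<Sum>i\<le>N. a i * (exp (- r) ^ i * g n r - exp (- r) ^ i * G r))"
        by (simp add: sum_distrib_right sum_distrib_left algebra_simps)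
      then show ?thesis using ig iG by simp
    qed
    moreover have "(\<lambda>n. \<Sum>i\<le>N. a i * ((\<integral>r. exp (- r) ^ i * g n r \<partial>exp_law) - (\<integral>r. exp (- r) ^ i * G r \<partial>exp_law)))
        \<longlonglongrightarrow> (\<Sum>i\<le>N. a i * ((\<integral>r. exp (- r) ^ i * G r \<partial>exp_law) - (\<integral>r. exp (- r) ^ i * G r \<partial>exp_law)))"
      by (intro tendsto_intros lap)
    ultimately show ?thesis by simp
  qed
  \<comment> \<open>Weierstrass approximation on the interval from 0 to 1 in the variable exp (- r);
    the error of \<open>p\<close> is not amplified because \<open>g n - G\<close> is bounded by
    1.\<close>
  have cont: "(\<lambda>n. \<integral>r. \<Psi> (exp (- r)) * (g n r - G r) \<partial>exp_law) \<longlonglongrightarrow> 0"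
    if \<Psi>: "continuous_on UNIV \<Psi>" for \<Psi> :: "real \<Rightarrow> real"
  proof (rule LIMSEQ_I)
    fix e :: real assume e: "0 < e"
    obtain p where p: "real_polynomial_function p" and pe: "\<And>x. x \<in> {0..1} \<Longrightarrow> \<bar>\<Psi> x - p x\<bar> < e / 2"
      using Stone_Weierstrass_real_polynomial_function[of "{0..1}" \<Psi> "e / 2"] \<Psi> e
      by (metis compact_Icc continuous_on_subset half_gt_zero subset_UNIV)
    obtain a N where pa: "p = (\<lambda>x. \<Sum>i\<le>N. a i * x ^ i)"
      using p unfolding real_polynomial_function_iff_sum by blast
    have pc: "continuous_on UNIV p" unfolding pa by (intro continuous_intros)
    obtain n0 where n0: "\<And>n. n0 \<le> n \<Longrightarrow> \<bar>\<integral>r. p (exp (- r)) * (g n r - G r) \<partial>exp_law\<bar> < e / 2"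
      using LIMSEQ_D[OF poly[of a N], of "e / 2"] e unfolding pa by auto
    show "\<exists>n0. \<forall>n\<ge>n0. norm ((\<integral>r. \<Psi> (exp (- r)) * (g n r - G r) \<partial>exp_law) - 0) < e"
    proof (intro exI allI impI)
      fix n assume n: "n0 \<le> n"
      have i1: "integrable exp_law (\<lambda>r. \<Psi> (exp (- r)) * (g n r - G r))"
        and i2: "integrable exp_law (\<lambda>r. p (exp (- r)) * (g n r - G r))"
        by (rule int; use \<Psi> pc bound in simp)+
      have "\<bar>(\<integral>r. \<Psi> (exp (- r)) * (g n r - G r) \<partial>exp_law) - (\<integral>r. p (exp (- r)) * (g n r - G r) \<partial>exp_law)\<bar>
         = \<bar>\<integral>r. \<Psi> (exp (- r)) * (g n r - G r) - p (exp (- r)) * (g n r - G r) \<partial>exp_law\<bar>"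
        using i1 i2 by simp
      also have "\<dots> \<le> (\<integral>r. e / 2 \<partial>exp_law)"
      proof (rule order_trans[OF integral_abs_bound], rule integral_mono_AE)
        show "integrable exp_law (\<lambda>r. \<bar>\<Psi> (exp (- r)) * (g n r - G r) - p (exp (- r)) * (g n r - G r)\<bar>)"
          using i1 i2 by simp
        show "AE r in exp_law. \<bar>\<Psi> (exp (- r)) * (g n r - G r) - p (exp (- r)) * (g n r - G r)\<bar> \<le> e / 2"
          using AE_exp_law_nonneg
        proof eventually_elim
          fix r :: real assume r: "0 \<le> r"
          have "\<bar>\<Psi> (exp (- r)) - p (exp (- r))\<bar> * \<bar>g n r - G r\<bar> \<le> e / 2 * 1"
            using pe[of "exp (- r)"] bound[OF r, of n] r e by (intro mult_mono) auto
          then show "\<bar>\<Psi> (exp (- r)) * (g n r - G r) - p (exp (- r)) * (g n r - G r)\<bar> \<le> e / 2"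
            by (simp add: abs_mult left_diff_distrib[symmetric])
        qed
      qed simp
      also have "(\<integral>r. e / 2 \<partial>exp_law) = e / 2" using E.prob_space by simp
      finally show "norm ((\<integral>r. \<Psi> (exp (- r)) * (g n r - G r) \<partial>exp_law) - 0) < e"
        using n0[OF n] unfolding real_norm_def diff_0_right by linarith
    qed
  qed
  \<comment> \<open>A bump in the variable x = exp (- r): it is positive exactly between the two
    parameters, which as a function of r is an open interval with reversed endpoints.\<close>
  define tent where "tent x1 x2 = (\<lambda>x::real. max 0 ((x - x1) * (x2 - x)))" for x1 x2
  have tent_cont: "continuous_on UNIV (tent x1 x2)" for x1 x2
    unfolding tent_def by (intro continuous_intros)
  have tent_pos: "0 < tent (exp (- q)) (exp (- p)) (exp (- r))" if "p < r" "r < q" for p q r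
    using that unfolding tent_def by (simp add: less_max_iff_disj)
  have tent_zero: "tent (exp (- q)) (exp (- p)) (exp (- r)) = 0" if "r \<le> p \<or> q \<le> r" "p \<le> q" for p q r
  proof -
    have "(exp (- r) - exp (- q)) * (exp (- p) - exp (- r)) \<le> 0"
      using that(1)
    proof
      assume "r \<le> p"
      then show ?thesis using that(2) by (intro mult_nonneg_nonpos) auto
    next
      assume "q \<le> r"
      then show ?thesis using that(2) by (intro mult_nonpos_nonneg) auto
    qed
    then show ?thesis unfolding tent_def by simp
  qed
  have tent_nonneg: "0 \<le> tent x1 x2 x" for x1 x2 x unfolding tent_def by simp
  \<comment> \<open>Weak convergence against one bump, in a form free of integrals: bounds that hold
    throughout the interval survive averaging. The quantifiers over \<open>x\<close> and
    \<open>y\<close> stand inside, so the threshold for n depends on p, q and e only.\<close>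
  have compare: "eventually (\<lambda>n. (\<forall>x y. (\<forall>r. p < r \<and> r < q \<longrightarrow> x \<le> g n r \<and> G r \<le> y) \<longrightarrow> x \<le> y + e) \<and>
      (\<forall>x y. (\<forall>r. p < r \<and> r < q \<longrightarrow> x \<le> G r \<and> g n r \<le> y) \<longrightarrow> x \<le> y + e)) sequentially"
    if pq: "0 \<le> p" "p < q" and e: "0 < e" for p q e
  proof -
    define W where W: "W = (\<lambda>r. tent (exp (- q)) (exp (- p)) (exp (- r)))"
    have i: "integrable exp_law (\<lambda>r. W r * f r)"
      if "f \<in> borel_measurable borel" "\<And>r. 0 \<le> r \<Longrightarrow> \<bar>f r\<bar> \<le> 1" for f :: "real \<Rightarrow> real"
      unfolding W by (rule int[OF tent_cont]) (use that in auto)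
    have iW: "integrable exp_law W" using i[of "\<lambda>_. 1"] by simp
    have ig: "integrable exp_law (\<lambda>r. W r * g n r)" for n by (rule i) (use g01 in auto)
    have iG: "integrable exp_law (\<lambda>r. W r * G r)" by (rule i) (use G01 in auto)
    have [measurable]: "tent x1 x2 \<in> borel_measurable borel" for x1 x2
      using tent_cont by (rule borel_measurable_continuous_onI)
    have pos: "0 < (\<integral>r. W r \<partial>exp_law)"
    proof (rule exp_law_interval_pos[of W 1 p q])
      show "W \<in> borel_measurable borel" unfolding W by measurable
      show "0 \<le> W r" for r unfolding W by (rule tent_nonneg)
      show "W r \<le> 1" if "0 \<le> r" for r
      proof -
        let ?x = "exp (- r)" and ?u = "exp (- q)" and ?v = "exp (- p)"
        have "0 < ?x" "?x \<le> 1" "0 < ?u" "?u \<le> 1" "0 < ?v" "?v \<le> 1" using that pq by auto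
        then have "\<bar>?x - ?u\<bar> \<le> 1" "\<bar>?v - ?x\<bar> \<le> 1" by linarith+
        then have "\<bar>(?x - ?u) * (?v - ?x)\<bar> \<le> 1 * 1" unfolding abs_mult by (intro mult_mono) auto
        then show ?thesis unfolding W tent_def by auto
      qed
      show "0 < W r" if "p < r" "r < q" for r unfolding W using that by (rule tent_pos)
    qed (use pq in auto)
    have "(\<lambda>n. \<integral>r. W r * (g n r - G r) \<partial>exp_law) \<longlonglongrightarrow> 0"
      unfolding W by (rule cont[OF tent_cont])
    moreover have "(\<integral>r. W r * (g n r - G r) \<partial>exp_law) = (\<integral>r. W r * g n r \<partial>exp_law) - (\<integral>r. W r * G r \<partial>exp_law)" for n
      using ig iG by (simp add: right_diff_distrib)
    ultimately have "eventually (\<lambda>n. \<bar>(\<integral>r. W r * g n r \<partial>exp_law) - (\<integral>r. W r * G r \<partial>exp_law)\<bar> < e * (\<integral>r. W r \<partial>exp_law)) sequentially"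
      using tendstoD[of "\<lambda>n. (\<integral>r. W r * g n r \<partial>exp_law) - (\<integral>r. W r * G r \<partial>exp_law)" 0 sequentially "e * (\<integral>r. W r \<partial>exp_law)"] e pos
      by (simp add: dist_real_def)
    then show ?thesis
    proof eventually_elim
      case (elim n)
      have le: "x \<le> y + e"
        if u: "integrable exp_law (\<lambda>r. W r * u r)" and v: "integrable exp_law (\<lambda>r. W r * v r)"
          and close: "(\<integral>r. W r * u r \<partial>exp_law) \<le> (\<integral>r. W r * v r \<partial>exp_law) + e * (\<integral>r. W r \<partial>exp_law)"
          and xy: "\<forall>r. p < r \<and> r < q \<longrightarrow> x \<le> u r \<and> v r \<le> y" for u v x y
      proof -
        have xu: "W r * x \<le> W r * u r" and vy: "W r * v r \<le> W r * y" for r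
          using xy tent_zero[of r p q] tent_nonneg[of "exp (- q)" "exp (- p)" "exp (- r)"] pq
          by (cases "p < r \<and> r < q"; auto simp: W intro: mult_left_mono)+
        have "(\<integral>r. W r * x \<partial>exp_law) \<le> (\<integral>r. W r * u r \<partial>exp_law)"
          by (rule integral_mono[OF _ u xu]) (use iW in simp)
        also note close
        also have "(\<integral>r. W r * v r \<partial>exp_law) \<le> (\<integral>r. W r * y \<partial>exp_law)"
          by (rule integral_mono[OF v _ vy]) (use iW in simp)
        finally have "(\<integral>r. W r \<partial>exp_law) * x \<le> (\<integral>r. W r \<partial>exp_law) * (y + e)"
          unfolding integral_mult_left_zero by (simp add: algebra_simps)
        then show ?thesis using pos by simp
      qed
      have "(\<integral>r. W r * g n r \<partial>exp_law) \<le> (\<integral>r. W r * G r \<partial>exp_law) + e * (\<integral>r. W r \<partial>exp_law)"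
        "(\<integral>r. W r * G r \<partial>exp_law) \<le> (\<integral>r. W r * g n r \<partial>exp_law) + e * (\<integral>r. W r \<partial>exp_law)"
        using elim by linarith+
      from le[OF ig iG this(1)] le[OF iG ig this(2)] show ?case by blast
    qed
  qed
  show ?thesis
  proof (rule LIMSEQ_I)
    fix e0 :: real assume e0: "0 < e0"
    \<comment> \<open>Three errors of size e arise: the one-sided Lipschitz bound, the continuity of
      \<open>G\<close> and the weak comparison. The fourth quarter gives strict inequality.\<close>
    define e where "e = e0 / 4"
    have e: "0 < e" using e0 by (simp add: e_def)
    obtain d where d: "0 < d" "\<And>r. 0 \<le> r \<Longrightarrow> \<bar>r - t\<bar> < d \<Longrightarrow> \<bar>G r - G t\<bar> < e"
      using G_cont t e unfolding continuous_on_iff dist_real_def by (metis atLeast_iff)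
    \<comment> \<open>\<open>h < d\<close> is for the continuity of \<open>G\<close>, and
      \<open>\<bar>C\<bar> * h \<le> e\<close> for the Lipschitz term; the added 1 avoids division
      by zero.\<close>
    define h where "h = min (d / 2) (e / (\<bar>C\<bar> + 1))"
    have h: "0 < h" "h < d" using d e by (auto simp: h_def add_nonneg_pos)
    have "h * (\<bar>C\<bar> + 1) \<le> e" unfolding h_def
      by (meson add_nonneg_pos abs_ge_zero min.cobounded2 pos_le_divide_eq zero_less_one)
    then have Ch: "\<bar>C\<bar> * h \<le> e" using h by (simp add: algebra_simps)
    have Cle: "C * x \<le> e" if "0 \<le> x" "x \<le> h" for x
    proof -
      have "C * x \<le> \<bar>C\<bar> * h" using that by (intro mult_mono) auto
      then show ?thesis using Ch by simp
    qed
    \<comment> \<open>The one-sided condition bounds the value at t by later values and from below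
      by earlier ones. The upper bound therefore averages over an interval to the right of t, the
      lower bound over one to the left.\<close>
    have upper: "eventually (\<lambda>n. g n t < G t + e0) sequentially"
    proof -
      from compare[OF t _ e, of "t + h"] have "eventually (\<lambda>n. (\<forall>x y. (\<forall>r. t < r \<and> r < t + h \<longrightarrow> x \<le> g n r \<and> G r \<le> y) \<longrightarrow> x \<le> y + e)) sequentially"
        using h by (auto elim: eventually_mono)
      then show ?thesis
      proof eventually_elim
        case (elim n)
        have "g n t - e \<le> g n r \<and> G r \<le> G t + e" if "t < r \<and> r < t + h" for r
          using onesided[OF t, of r n] Cle[of "r - t"] d(2)[of r] h t that by (auto simp: abs_less_iff)
        then have "g n t - e \<le> G t + e + e" using elim by blast
        then show ?case using e by (simp add: e_def)
      qed
    qed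
    have lower: "eventually (\<lambda>n. G t - e0 < g n t) sequentially"
    \<comment> \<open>At t = 0 there is no room to the left; nonnegativity of \<open>g n\<close> and
      \<open>G 0 = 0\<close> take the place of averaging.\<close>
    proof (cases "t = 0")
      case True
      then show ?thesis using G0 g01(1)[of 0] e0 by (auto intro!: always_eventually simp: add_pos_nonneg less_le_trans[of _ 0])
    next
      case False
      define k where "k = min h (t / 2)"
      have k: "0 < k" "k \<le> h" "k < t" using False t h by (auto simp: k_def)
      from compare[of "t - k" t e] have "eventually (\<lambda>n. (\<forall>x y. (\<forall>r. t - k < r \<and> r < t \<longrightarrow> x \<le> G r \<and> g n r \<le> y) \<longrightarrow> x \<le> y + e)) sequentially"
        using k e by (auto elim: eventually_mono)
      then show ?thesis
      proof eventually_elim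
        case (elim n)
        have "G t - e \<le> G r \<and> g n r \<le> g n t + e" if "t - k < r \<and> r < t" for r
          using onesided[of r t n] Cle[of "t - r"] d(2)[of r] h k that by (auto simp: abs_less_iff)
        then have "G t - e \<le> g n t + e + e" using elim by blast
        then show ?case using e by (simp add: e_def)
      qed
    qed
    show "\<exists>n0. \<forall>n\<ge>n0. norm (g n t - G t) < e0"
      using eventually_conj[OF upper lower] unfolding eventually_sequentially by (elim exE, intro exI allI impI) (force simp: abs_less_iff)
  qed
qed

section \<open>The generalized arcsine law\<close>

lemma nn_integral_exp_substitution:
  fixes f :: "real \<Rightarrow> real"
  assumes f[measurable]: "f \<in> borel_measurable borel" and nn: "\<And>t. 0 \<le> f t"
  shows "(\<integral>\<^sup>+t. ennreal (f t) * indicator {0<..} t \<partial>lborel) = (\<integral>\<^sup>+x. ennreal (f (exp x) * exp x) \<partial>lborel)"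
proof -
  have 1: "(\<integral>\<^sup>+t. ennreal (f t) * indicator {exp (- real n)..exp (real n)} t \<partial>lborel) =
      (\<integral>\<^sup>+x. ennreal (f (exp x) * exp x) * indicator {- real n..real n} x \<partial>lborel)" for n :: nat
  proof -
    have "(\<integral>\<^sup>+t. ennreal (f t * indicator {exp (- real n)..exp (real n)} t) \<partial>lborel) =
      (\<integral>\<^sup>+x. ennreal (f (exp x) * exp x * indicator {- real n..real n} x) \<partial>lborel)"
      by (rule nn_integral_substitution)
         (auto intro!: derivative_eq_intros continuous_intros simp: set_borel_measurable_def)
    then show ?thesis using nn
      by (simp add: ennreal_mult'' ennreal_indicator[symmetric] mult.assoc)
  qed
  \<comment> \<open>The change of variables is made on compact intervals; monotone convergence,
    expressed through the measure with density \<open>h\<close>, passes to their union.\<close>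
  have increasing: "(\<integral>\<^sup>+x. ennreal (h x) * indicator (\<Union>n. A n) x \<partial>lborel) = (SUP n. \<integral>\<^sup>+x. ennreal (h x) * indicator (A n) x \<partial>lborel)"
    if [measurable]: "h \<in> borel_measurable borel" and A: "\<And>n. A n \<in> sets borel" "incseq A" for h :: "real \<Rightarrow> real" and A :: "nat \<Rightarrow> real set"
    using SUP_emeasure_incseq[of A "density lborel h"] A by (simp add: emeasure_density image_subset_iff)
  have U1: "(\<Union>n. {exp (- real n)..exp (real n)}) = {0<..}"
  proof (intro equalityI subsetI)
    fix t :: real assume "t \<in> {0<..}"
    then have t: "0 < t" by simp
    obtain n :: nat where "\<bar>ln t\<bar> \<le> real n" using real_arch_simple by blast
    then have "- real n \<le> ln t" "ln t \<le> real n" by auto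
    then have "exp (- real n) \<le> exp (ln t)" "exp (ln t) \<le> exp (real n)" by simp_all
    then show "t \<in> (\<Union>n. {exp (- real n)..exp (real n)})" using t by auto
  qed (auto intro: less_le_trans[OF exp_gt_zero])
  have U2: "(\<Union>n. {- real n..real n}) = UNIV"
  proof (intro equalityI subsetI)
    fix x :: real
    obtain n :: nat where "\<bar>x\<bar> \<le> real n" using real_arch_simple by blast
    then show "x \<in> (\<Union>n. {- real n..real n})" by (auto simp: abs_le_iff intro!: exI[of _ n])
  qed simp
  have "incseq (\<lambda>n. {exp (- real n)..exp (real n)})" "incseq (\<lambda>n. {- real n..real n})"
    by (auto simp: incseq_def intro: order_trans[of "exp (- real _)" "exp (- real _)"])
  then have S1: "(\<integral>\<^sup>+t. ennreal (f t) * indicator {0<..} t \<partial>lborel) =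
     (SUP n. \<integral>\<^sup>+t. ennreal (f t) * indicator {exp (- real n)..exp (real n)} t \<partial>lborel)"
    and S2: "(\<integral>\<^sup>+x. ennreal (f (exp x) * exp x) \<partial>lborel) =
     (SUP n. \<integral>\<^sup>+x. ennreal (f (exp x) * exp x) * indicator {- real n..real n} x \<partial>lborel)"
    using increasing[of f "\<lambda>n. {exp (- real n)..exp (real n)}"]
      increasing[of "\<lambda>x. f (exp x) * exp x" "\<lambda>n. {- real n..real n}"]
    unfolding U1 U2 by simp_all
  show ?thesis unfolding S1 S2 1 ..
qed

text \<open>The Gamma integral under the substitution t = q exp (- x), carried out as t = exp y
  followed by the reflection y = ln q - x.\<close>

lemma nn_integral_Gamma_exponential:
  assumes a: "0 < a" and q: "0 < q"
  shows "(\<integral>\<^sup>+x. ennreal (exp (- a * x) * exp (- q * exp (- x))) \<partial>lborel) = ennreal (Gamma a * q powr (- a))"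
proof -
  have "ennreal (Gamma a) = (\<integral>\<^sup>+t. ennreal (indicator {0..} t * t powr (a - 1) / exp t) \<partial>lborel)"
    by (rule Gamma_conv_nn_integral_real[OF a])
  also have "\<dots> = (\<integral>\<^sup>+t. ennreal (\<bar>t\<bar> powr (a - 1) * exp (- t)) * indicator {0<..} t \<partial>lborel)"
    using AE_lborel_singleton[of "0::real"]
    by (intro nn_integral_cong_AE) (auto simp: exp_minus field_simps split: split_indicator elim!: eventually_mono)
  also have "\<dots> = (\<integral>\<^sup>+y. ennreal ((exp y) powr (a - 1) * exp (- exp y) * exp y) \<partial>lborel)"
    by (subst nn_integral_exp_substitution) auto
  also have "\<dots> = (\<integral>\<^sup>+y. ennreal (exp (a * y) * exp (- exp y)) \<partial>lborel)"
  proof (intro nn_integral_cong arg_cong[where f=ennreal])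
    fix y :: real
    have "(exp y) powr (a - 1) * exp y = exp (a * y)"
      by (simp add: powr_def exp_add[symmetric] algebra_simps)
    then show "(exp y) powr (a - 1) * exp (- exp y) * exp y = exp (a * y) * exp (- exp y)" by (simp add: mult_ac)
  qed
  also have "\<dots> = (\<integral>\<^sup>+x. ennreal (exp (a * (ln q + (-1) * x)) * exp (- exp (ln q + (-1) * x))) \<partial>lborel)"
    by (subst nn_integral_real_affine[where c="-1" and t="ln q"]) auto
  also have "\<dots> = (\<integral>\<^sup>+x. ennreal (q powr a) * ennreal (exp (- a * x) * exp (- q * exp (- x))) \<partial>lborel)"
  proof (rule nn_integral_cong)
    fix x :: real
    have "exp (a * (ln q + (-1) * x)) = q powr a * exp (- a * x)"
      using q by (simp add: powr_def exp_add[symmetric] algebra_simps)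
    moreover have "exp (ln q + (-1) * x) = q * exp (- x)" using q by (simp add: exp_add[symmetric] exp_diff exp_minus field_simps)
    ultimately show "ennreal (exp (a * (ln q + (-1) * x)) * exp (- exp (ln q + (-1) * x))) =
       ennreal (q powr a) * ennreal (exp (- a * x) * exp (- q * exp (- x)))"
      by (simp add: ennreal_mult[symmetric] mult_ac)
  qed
  also have "\<dots> = ennreal (q powr a) * (\<integral>\<^sup>+x. ennreal (exp (- a * x) * exp (- q * exp (- x))) \<partial>lborel)"
    by (rule nn_integral_cmult) auto
  finally have "ennreal (q powr (- a)) * ennreal (Gamma a) =
     ennreal (q powr (- a)) * (ennreal (q powr a) * (\<integral>\<^sup>+x. ennreal (exp (- a * x) * exp (- q * exp (- x))) \<partial>lborel))"
    by simp
  moreover have "ennreal (q powr (- a)) * ennreal (q powr a) = 1"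
    using q by (simp add: ennreal_mult[symmetric] powr_add[symmetric])
  moreover have "ennreal (q powr (- a)) * ennreal (Gamma a) = ennreal (Gamma a * q powr (- a))"
    using Gamma_real_pos[OF a] by (simp add: ennreal_mult[symmetric] mult.commute)
  ultimately show ?thesis by (simp add: mult.assoc[symmetric])
qed

lemma nn_integral_exp_powr:
  assumes a: "0 < a" and l: "0 < l"
  shows "(\<integral>\<^sup>+t. ennreal (indicator {0..} t * (exp (- l * t) * t powr (a - 1))) \<partial>lborel) = ennreal (Gamma a * l powr (- a))"
proof -
  let ?I = "\<integral>\<^sup>+t. ennreal (indicator {0..} t * (exp (- l * t) * t powr (a - 1))) \<partial>lborel"
  have "ennreal (Gamma a) = (\<integral>\<^sup>+t. ennreal (indicator {0..} t * t powr (a - 1) / exp t) \<partial>lborel)"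
    by (rule Gamma_conv_nn_integral_real[OF a])
  also have "\<dots> = ennreal l * (\<integral>\<^sup>+t. ennreal (indicator {0..} (0 + l * t) * (0 + l * t) powr (a - 1) / exp (0 + l * t)) \<partial>lborel)"
    using l by (subst nn_integral_real_affine[where c=l and t=0]) auto
  also have "(\<integral>\<^sup>+t. ennreal (indicator {0..} (0 + l * t) * (0 + l * t) powr (a - 1) / exp (0 + l * t)) \<partial>lborel) =
     (\<integral>\<^sup>+t. ennreal (l powr (a - 1)) * ennreal (indicator {0..} t * (exp (- l * t) * t powr (a - 1))) \<partial>lborel)"
  proof (rule nn_integral_cong)
    fix t :: real
    show "ennreal (indicator {0..} (0 + l * t) * (0 + l * t) powr (a - 1) / exp (0 + l * t)) =
       ennreal (l powr (a - 1)) * ennreal (indicator {0..} t * (exp (- l * t) * t powr (a - 1)))"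
      using l by (cases "0 \<le> t") (auto simp: ennreal_mult[symmetric] powr_mult exp_minus field_simps zero_le_mult_iff split: split_indicator)
  qed
  also have "\<dots> = ennreal (l powr (a - 1)) * ?I"
    by (rule nn_integral_cmult) auto
  finally have "ennreal (Gamma a) = ennreal (l powr a) * ?I"
    using l by (simp add: mult.assoc[symmetric] ennreal_mult[symmetric] powr_diff)
  then have "ennreal (l powr (- a)) * ennreal (Gamma a) =
     ennreal (l powr (- a)) * (ennreal (l powr a) * ?I)"
    by simp
  moreover have "ennreal (l powr (- a)) * ennreal (l powr a) = 1"
    using l by (simp add: ennreal_mult[symmetric] powr_add[symmetric])
  moreover have "ennreal (l powr (- a)) * ennreal (Gamma a) = ennreal (Gamma a * l powr (- a))"
    using Gamma_real_pos[OF a] by (simp add: ennreal_mult[symmetric] mult.commute)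
  ultimately show ?thesis by (simp add: mult.assoc[symmetric])
qed

text \<open>Here \<open>x\<close> is the logarithm of the trap depth in units of the time-scale, so
  that exp (- x) is the rescaled exit rate. The first factor is the killing probability, the second
  the probability of staying for a further time \<open>s\<close>.\<close>

definition trap_weight :: "real \<Rightarrow> real \<Rightarrow> real \<Rightarrow> real" where
  "trap_weight l s x = l / (l + exp (- x)) * exp (- s * exp (- x))"

lemma trap_weight_measurable [measurable]: "trap_weight l s \<in> borel_measurable borel"
  unfolding trap_weight_def by measurable

lemma trap_weight_nonneg: "0 < l \<Longrightarrow> 0 \<le> trap_weight l s x"
  unfolding trap_weight_def by (intro mult_nonneg_nonneg divide_nonneg_nonneg add_nonneg_nonneg) auto

lemma nn_integral_exp_Ici:
  assumes "0 < c" shows "(\<integral>\<^sup>+q. ennreal (indicator {0..} q * exp (- c * q)) \<partial>lborel) = ennreal (1 / c)"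
proof -
  have "(\<integral>\<^sup>+q. ennreal (indicator {0..} q * (exp (- c * q) * q powr (1 - 1))) \<partial>lborel) = ennreal (Gamma 1 * c powr (- 1))"
    by (rule nn_integral_exp_powr) (use assms in auto)
  moreover have "(\<integral>\<^sup>+q. ennreal (indicator {0..} q * (exp (- c * q) * q powr (1 - 1))) \<partial>lborel) =
     (\<integral>\<^sup>+q. ennreal (indicator {0..} q * exp (- c * q)) \<partial>lborel)"
    using AE_lborel_singleton[of "0::real"]
    by (intro nn_integral_cong_AE) (auto elim!: eventually_mono)
  ultimately show ?thesis using assms by (simp add: powr_minus field_simps)
qed

text \<open>The denominator l + exp (- x) is written as an exponential integral over an auxiliary
  variable q. After Fubini the integral over x is a Gamma integral with parameter q + s.\<close>

lemma nn_integral_trap_weight: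
  assumes a: "0 < a" and l: "0 < l" and s: "0 \<le> s"
  shows "(\<integral>\<^sup>+x. ennreal (trap_weight l s x * exp (- a * x)) \<partial>lborel) =
    ennreal (l * Gamma a) * (\<integral>\<^sup>+q. ennreal (indicator {0..} q * (exp (- l * q) * (q + s) powr (- a))) \<partial>lborel)"
proof -
  let ?h = "\<lambda>x q. l * indicator {0..} q * exp (- l * q) * (exp (- a * x) * exp (- (q + s) * exp (- x)))"
  let ?Q = "\<lambda>q. indicator {0..} q * (exp (- l * q) * (q + s) powr (- a))"
  have G: "0 < Gamma a" using a by (rule Gamma_real_pos)
  have "(\<integral>\<^sup>+x. ennreal (trap_weight l s x * exp (- a * x)) \<partial>lborel) =
     (\<integral>\<^sup>+x. \<integral>\<^sup>+q. ennreal (?h x q) \<partial>lborel \<partial>lborel)"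
  proof (rule nn_integral_cong)
    fix x :: real
    have p: "0 < l + exp (- x)" using l by (simp add: add_pos_pos)
    have "(\<integral>\<^sup>+q. ennreal (?h x q) \<partial>lborel) =
       (\<integral>\<^sup>+q. ennreal (l * exp (- a * x) * exp (- s * exp (- x))) * ennreal (indicator {0..} q * exp (- (l + exp (- x)) * q)) \<partial>lborel)"
      using l by (intro nn_integral_cong) (simp add: ennreal_mult[symmetric] exp_add[symmetric] algebra_simps split: split_indicator)
    also have "\<dots> = ennreal (l * exp (- a * x) * exp (- s * exp (- x))) * ennreal (1 / (l + exp (- x)))"
      by (subst nn_integral_cmult, measurable) (simp only: nn_integral_exp_Ici[OF p])
    also have "\<dots> = ennreal (trap_weight l s x * exp (- a * x))"
      using l p by (simp add: ennreal_mult[symmetric] trap_weight_def mult_ac)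
    finally show "ennreal (trap_weight l s x * exp (- a * x)) =
       (\<integral>\<^sup>+q. ennreal (?h x q) \<partial>lborel)" ..
  qed
  also have "\<dots> = (\<integral>\<^sup>+q. \<integral>\<^sup>+x. ennreal (?h x q) \<partial>lborel \<partial>lborel)"
    by (rule lborel_pair.Fubini') measurable
  \<comment> \<open>The null set q = 0 is discarded because the Gamma integral needs q + s > 0 and s
    may vanish.\<close>
  also have "\<dots> = (\<integral>\<^sup>+q. ennreal (l * Gamma a) * ennreal (?Q q) \<partial>lborel)"
    using AE_lborel_singleton[of "0::real"]
  proof (intro nn_integral_cong_AE, eventually_elim)
    fix q :: real assume q0: "q \<noteq> 0"
    show "(\<integral>\<^sup>+x. ennreal (?h x q) \<partial>lborel) =
       ennreal (l * Gamma a) * ennreal (?Q q)"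
    proof (cases "0 \<le> q")
      case True
      then have qs: "0 < q + s" using q0 s by auto
      have "(\<integral>\<^sup>+x. ennreal (?h x q) \<partial>lborel) =
        (\<integral>\<^sup>+x. ennreal (l * exp (- l * q)) * ennreal (exp (- a * x) * exp (- (q + s) * exp (- x))) \<partial>lborel)"
        using True l by (intro nn_integral_cong) (simp add: ennreal_mult[symmetric])
      also have "\<dots> = ennreal (l * exp (- l * q)) * ennreal (Gamma a * (q + s) powr (- a))"
        by (subst nn_integral_cmult, measurable) (simp only: nn_integral_Gamma_exponential[OF a qs])
      also have "\<dots> = ennreal (l * Gamma a) * ennreal (?Q q)"
        using True l G by (simp add: ennreal_mult[symmetric] mult_ac)
      finally show ?thesis .
    qed simp
  qed
  also have "\<dots> = ennreal (l * Gamma a) * (\<integral>\<^sup>+q. ennreal (?Q q) \<partial>lborel)"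
    by (rule nn_integral_cmult) auto
  finally show ?thesis .
qed

lemma Gamma_reflection_real:
  fixes a :: real shows "Gamma a * Gamma (1 - a) = pi / sin (pi * a)"
proof -
  have "complex_of_real (Gamma a * Gamma (1 - a)) = complex_of_real (pi / sin (pi * a))"
    using Gamma_reflection_complex[of "complex_of_real a"]
    by (simp add: Gamma_complex_of_real[symmetric] sin_of_real[symmetric])
  then show ?thesis unfolding of_real_eq_iff .
qed

text \<open>For s = 0 the remaining integral over q is again a Gamma integral, with parameter 1 - a,
  and the reflection formula supplies the sine.\<close>

lemma nn_integral_trap_weight_0:
  assumes a: "0 < a" "a < 1" and l: "0 < l"
  shows "(\<integral>\<^sup>+x. ennreal (trap_weight l 0 x * exp (- a * x)) \<partial>lborel) = ennreal (l powr a * (pi / sin (pi * a)))"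
proof -
  have "(\<integral>\<^sup>+q. ennreal (indicator {0..} q * (exp (- l * q) * (q + 0) powr (- a))) \<partial>lborel) = ennreal (Gamma (1 - a) * l powr (- (1 - a)))"
    using nn_integral_exp_powr[of "1 - a" l] a l by simp
  then have "(\<integral>\<^sup>+x. ennreal (trap_weight l 0 x * exp (- a * x)) \<partial>lborel) = ennreal (l * Gamma a) * ennreal (Gamma (1 - a) * l powr (- (1 - a)))"
    using nn_integral_trap_weight[OF a(1) l, of 0] by simp
  also have "\<dots> = ennreal (l * Gamma a * (Gamma (1 - a) * l powr (- (1 - a))))"
    using a l by (subst ennreal_mult) (auto simp: Gamma_real_pos less_imp_le)
  also have "l * Gamma a * (Gamma (1 - a) * l powr (- (1 - a))) = (Gamma a * Gamma (1 - a)) * (l powr 1 * l powr (a - 1))"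
    using l by simp
  also have "\<dots> = l powr a * (pi / sin (pi * a))"
    unfolding Gamma_reflection_real powr_add[symmetric] by simp
  finally show ?thesis .
qed

text \<open>For s = 0 the weight tends to 1 as x grows and decays like exp x as x tends to minus
  infinity, so exponents a strictly between 0 and 1 give finite integrals; positive s only makes the
  weight smaller.\<close>

lemma trap_weight_integral:
  assumes a: "0 < a" "a < 1" and l: "0 < l" and s: "0 \<le> s"
  shows integrable_trap_weight: "integrable lborel (\<lambda>x. trap_weight l s x * exp (- a * x))"
    and nn_integral_trap_weight_eq: "(\<integral>\<^sup>+x. ennreal (trap_weight l s x * exp (- a * x)) \<partial>lborel) =
      ennreal (\<integral>x. trap_weight l s x * exp (- a * x) \<partial>lborel)"
proof -
  have "(\<integral>\<^sup>+x. ennreal (trap_weight l s x * exp (- a * x)) \<partial>lborel) \<le> (\<integral>\<^sup>+x. ennreal (trap_weight l 0 x * exp (- a * x)) \<partial>lborel)"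
  proof (intro nn_integral_mono ennreal_leI mult_right_mono)
    fix x :: real
    show "trap_weight l s x \<le> trap_weight l 0 x"
      unfolding trap_weight_def
      by (rule mult_left_mono) (use l s in \<open>auto intro!: divide_nonneg_nonneg add_nonneg_nonneg\<close>)
  qed simp
  also have "\<dots> < \<infinity>" unfolding nn_integral_trap_weight_0[OF a l] by simp
  finally have "(\<integral>\<^sup>+x. ennreal (trap_weight l s x * exp (- a * x)) \<partial>lborel) < \<infinity>" .
  then show i: "integrable lborel (\<lambda>x. trap_weight l s x * exp (- a * x))"
    using trap_weight_nonneg[OF l] by (intro integrableI_bounded) auto
  show "(\<integral>\<^sup>+x. ennreal (trap_weight l s x * exp (- a * x)) \<partial>lborel) =
      ennreal (\<integral>x. trap_weight l s x * exp (- a * x) \<partial>lborel)"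
    using trap_weight_nonneg[OF l] by (intro nn_integral_eq_integral i) auto
qed

section \<open>The arcsine distribution function and its Laplace transform\<close>

lemma Asl_kernel_integrable:
  fixes a :: real
  assumes "0 < a" "a < 1"
  shows "set_integrable lborel {0..1} (\<lambda>x. (1 - x) powr (- a) * x powr (- 1 + a))"
  using integrable_Beta[of a "1 - a"] assms by (simp add: mult.commute)

lemma Asl_continuous:
  assumes "0 < a" "a < 1"
  shows "continuous_on {0..1} (Asl a)"
proof -
  let ?k = "\<lambda>x. (1 - x) powr (- a) * x powr (- 1 + a)"
  have i: "set_integrable lborel {0..u} ?k" if "u \<in> {0..1}" for u
    by (rule set_integrable_subset[OF Asl_kernel_integrable[OF assms]]) (use that in auto)
  have eq: "Asl a u = sin (a * pi) / pi * integral {0..u} ?k" if "u \<in> {0..1}" for u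
    unfolding Asl_def using set_borel_integral_eq_integral(2)[OF i[OF that]] by simp
  have "continuous_on {0..1} (\<lambda>u. sin (a * pi) / pi * integral {0..u} ?k)"
    using set_borel_integral_eq_integral(1)[OF i[of 1]]
    by (intro continuous_intros indefinite_integral_continuous_1) auto
  then show ?thesis using eq continuous_on_cong[of "{0..1}" "{0..1}" "Asl a" "\<lambda>u. sin (a * pi) / pi * integral {0..u} ?k"] by simp
qed

lemma Asl_0: "Asl a 0 = 0"
proof -
  have "set_lebesgue_integral lborel {0..0} (\<lambda>x. (1 - x) powr (- a) * x powr (- 1 + a)) = 0"
    unfolding set_lebesgue_integral_def
    by (rule integral_eq_zero_AE) (use AE_lborel_singleton[of "0::real"] in \<open>auto elim!: eventually_mono split: split_indicator\<close>)
  then show ?thesis by (simp add: Asl_def)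
qed

lemma sin_pi_pos: "0 < a \<Longrightarrow> a < 1 \<Longrightarrow> 0 < sin (a * pi)"
  by (intro sin_gt_zero) auto

text \<open>The total mass of the kernel is Beta a (1 - a), which by reflection is the inverse of
  the prefactor of \<open>Asl\<close>; hence the bound by 1.\<close>

lemma ennreal_Asl:
  assumes a: "0 < a" "a < 1" and u: "u \<in> {0..1}"
  shows "ennreal (Asl a u) = ennreal (sin (a * pi) / pi) * (\<integral>\<^sup>+x. ennreal (indicator {0..u} x * ((1 - x) powr (- a) * x powr (- 1 + a))) \<partial>lborel)"
    and Asl_nonneg: "0 \<le> Asl a u" and Asl_le_1: "Asl a u \<le> 1"
proof -
  let ?k = "\<lambda>x::real. (1 - x) powr (- a) * x powr (- 1 + a)"
  have i: "set_integrable lborel {0..v} ?k" if "v \<in> {0..1}" for v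
    by (rule set_integrable_subset[OF Asl_kernel_integrable[OF a]]) (use that in auto)
  have s: "0 < sin (a * pi) / pi" using sin_pi_pos[OF a] by simp
  have nn: "0 \<le> set_lebesgue_integral lborel {0..v} ?k" for v
    unfolding set_lebesgue_integral_def by (rule Bochner_Integration.integral_nonneg) auto
  have "ennreal (set_lebesgue_integral lborel {0..u} ?k) = (\<integral>\<^sup>+x. ennreal (indicator {0..u} x * ?k x) \<partial>lborel)"
    unfolding set_lebesgue_integral_def
    using i[OF u] by (subst nn_integral_eq_integral) (auto simp: set_integrable_def)
  then show "ennreal (Asl a u) = ennreal (sin (a * pi) / pi) * (\<integral>\<^sup>+x. ennreal (indicator {0..u} x * ?k x) \<partial>lborel)"
    unfolding Asl_def using s nn by (simp only: ennreal_mult less_imp_le)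
  show "0 \<le> Asl a u" unfolding Asl_def using s nn[of u] by (intro mult_nonneg_nonneg) auto
  have "set_lebesgue_integral lborel {0..u} ?k \<le> set_lebesgue_integral lborel {0..1} ?k"
    unfolding set_lebesgue_integral_def using i[OF u] i[of 1] u
    by (intro integral_mono) (auto simp: set_integrable_def split: split_indicator)
  also have "set_lebesgue_integral lborel {0..1} ?k = Beta a (1 - a)"
    using has_integral_Beta_real[of a "1 - a"] set_borel_integral_eq_integral(2)[OF i[of 1]] a
    by (simp add: mult.commute has_integral_iff)
  also have "\<dots> = pi / sin (a * pi)"
    using Gamma_reflection_real[of a] by (simp add: Beta_def mult.commute)
  finally have "Asl a u \<le> sin (a * pi) / pi * (pi / sin (a * pi))"
    unfolding Asl_def using s by (intro mult_left_mono) auto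
  then show "Asl a u \<le> 1" using sin_pi_pos[OF a] by simp
qed

text \<open>The substitution r = (t + s) x exhibits the arcsine probability as a convolution in t of
  two power functions; the powers 1, a - 1 and - a of t + s cancel.\<close>

lemma ennreal_Asl_convolution:
  assumes a: "0 < a" "a < 1" and t: "0 \<le> t" and s: "0 < s"
  shows "ennreal (Asl a (t / (t + s))) =
    ennreal (sin (a * pi) / pi) * (\<integral>\<^sup>+r. ennreal (indicator {0..t} r * (r powr (a - 1) * (t - r + s) powr (- a))) \<partial>lborel)"
proof -
  have ts: "0 < t + s" using t s by simp
  have u: "t / (t + s) \<in> {0..1}" using t s by auto
  have "(\<integral>\<^sup>+r. ennreal (indicator {0..t} r * (r powr (a - 1) * (t - r + s) powr (- a))) \<partial>lborel) =
     ennreal (t + s) * (\<integral>\<^sup>+x. ennreal (indicator {0..t} (0 + (t + s) * x) * ((0 + (t + s) * x) powr (a - 1) * (t - (0 + (t + s) * x) + s) powr (- a))) \<partial>lborel)"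
    using ts by (subst nn_integral_real_affine[where c="t + s" and t=0]) auto
  also have "\<dots> = (\<integral>\<^sup>+x. ennreal (t + s) * ennreal (indicator {0..t} (0 + (t + s) * x) * ((0 + (t + s) * x) powr (a - 1) * (t - (0 + (t + s) * x) + s) powr (- a))) \<partial>lborel)"
    by (rule nn_integral_cmult[symmetric]) measurable
  also have "\<dots> = (\<integral>\<^sup>+x. ennreal (indicator {0..t / (t + s)} x * ((1 - x) powr (- a) * x powr (- 1 + a))) \<partial>lborel)"
  proof (rule nn_integral_cong)
    fix x :: real
    show "ennreal (t + s) * ennreal (indicator {0..t} (0 + (t + s) * x) * ((0 + (t + s) * x) powr (a - 1) * (t - (0 + (t + s) * x) + s) powr (- a))) =
       ennreal (indicator {0..t / (t + s)} x * ((1 - x) powr (- a) * x powr (- 1 + a)))"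
    proof (cases "x \<in> {0..t / (t + s)}")
      case True
      then have x: "0 \<le> x" "(t + s) * x \<le> t" using ts by (auto simp: field_simps)
      have "t / (t + s) < 1" using ts s by (simp add: field_simps)
      then have x1: "0 \<le> 1 - x" using True by auto
      have e: "t - (0 + (t + s) * x) + s = (t + s) * (1 - x)" by (simp add: algebra_simps)
      have "(t + s) * (((t + s) * x) powr (a - 1) * ((t + s) * (1 - x)) powr (- a)) =
         ((t + s) powr 1 * (t + s) powr (a - 1) * (t + s) powr (- a)) * ((1 - x) powr (- a) * x powr (a - 1))"
        using ts x x1 by (simp add: powr_mult mult_ac)
      also have "(t + s) powr 1 * (t + s) powr (a - 1) * (t + s) powr (- a) = 1"
        using ts by (simp only: powr_add[symmetric]) simp
      finally show ?thesis
        unfolding e using True x ts by (simp add: ennreal_mult[symmetric])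
    next
      case False
      then have "(t + s) * x \<notin> {0..t}" using ts by (auto simp: zero_le_mult_iff pos_le_divide_eq mult.commute)
      then show ?thesis using False by simp
    qed
  qed
  finally show ?thesis using ennreal_Asl[OF a u] by simp
qed

text \<open>The transform of the convolution factorises. One factor is a Gamma integral; the other,
  \<open>Q\<close>, is the integral over q already met in \<open>nn_integral_trap_weight\<close>,
  which is why the result is a quotient of trap integrals.\<close>

lemma nn_integral_laplace_Asl:
  assumes a: "0 < a" "a < 1" and l: "0 < l" and s: "0 < s"
  shows "(\<integral>\<^sup>+t. ennreal (indicator {0..} t * exp (- l * t) * Asl a (t / (t + s))) \<partial>lborel) =
    ennreal ((\<integral>x. trap_weight l s x * exp (- a * x) \<partial>lborel) / (l * (\<integral>x. trap_weight l 0 x * exp (- a * x) \<partial>lborel)))"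
proof -
  let ?A = "\<lambda>r. sin (a * pi) / pi * (indicator {0..} r * (exp (- l * r) * r powr (a - 1)))"
  let ?B = "\<lambda>q. indicator {0..} q * (exp (- l * q) * (q + s) powr (- a))"
  define Q where "Q = (\<integral>\<^sup>+q. ennreal (?B q) \<partial>lborel)"
  have G: "0 < Gamma a" using a by (intro Gamma_real_pos) auto
  have sp: "0 < sin (a * pi) / pi" using sin_pi_pos[OF a] by simp
  have "(\<integral>\<^sup>+t. ennreal (indicator {0..} t * exp (- l * t) * Asl a (t / (t + s))) \<partial>lborel) =
    (\<integral>\<^sup>+t. \<integral>\<^sup>+r. ennreal (?A r) *
        ennreal (?B (t - r)) \<partial>lborel \<partial>lborel)"
  proof (rule nn_integral_cong)
    fix t :: real
    show "ennreal (indicator {0..} t * exp (- l * t) * Asl a (t / (t + s))) =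
      (\<integral>\<^sup>+r. ennreal (?A r) *
        ennreal (?B (t - r)) \<partial>lborel)"
    proof (cases "0 \<le> t")
      case True
      have u: "t / (t + s) \<in> {0..1}" using True s by auto
      have "ennreal (indicator {0..} t * exp (- l * t) * Asl a (t / (t + s))) = ennreal (exp (- l * t)) * ennreal (Asl a (t / (t + s)))"
        using True Asl_nonneg[OF a u] by (simp add: ennreal_mult)
      also have "\<dots> = ennreal (exp (- l * t) * (sin (a * pi) / pi)) * (\<integral>\<^sup>+r. ennreal (indicator {0..t} r * (r powr (a - 1) * (t - r + s) powr (- a))) \<partial>lborel)"
        unfolding ennreal_Asl_convolution[OF a True s] using sp by (subst ennreal_mult) (auto simp: mult.assoc)
      also have "\<dots> = (\<integral>\<^sup>+r. ennreal (exp (- l * t) * (sin (a * pi) / pi)) * ennreal (indicator {0..t} r * (r powr (a - 1) * (t - r + s) powr (- a))) \<partial>lborel)"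
        by (rule nn_integral_cmult[symmetric]) measurable
      also have "\<dots> = (\<integral>\<^sup>+r. ennreal (?A r) *
        ennreal (?B (t - r)) \<partial>lborel)"
      proof (rule nn_integral_cong)
        fix r :: real
        have "exp (- l * t) = exp (- l * r) * exp (- l * (t - r))" by (simp add: exp_add[symmetric] algebra_simps)
        then have "exp (- l * t) * (sin (a * pi) / pi) * (indicator {0..t} r * (r powr (a - 1) * (t - r + s) powr (- a))) =
          ?A r *
          (?B (t - r))"
          by (simp split: split_indicator)
        moreover have "0 \<le> exp (- l * t) * (sin (a * pi) / pi)"
            "0 \<le> sin (a * pi) / pi * (indicator {0..} r * (exp (- l * r) * r powr (a - 1)))"
          using sp by (intro mult_nonneg_nonneg; auto)+
        ultimately show "ennreal (exp (- l * t) * (sin (a * pi) / pi)) * ennreal (indicator {0..t} r * (r powr (a - 1) * (t - r + s) powr (- a))) =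
          ennreal (?A r) *
          ennreal (?B (t - r))"
          by (simp only: ennreal_mult'[symmetric])
      qed
      finally show ?thesis .
    next
      case False
      then have "indicator {0..} r * indicator {0..} (t - r) = (0::real)" for r
        by (auto split: split_indicator)
      then have "(\<lambda>r. ennreal (?A r) *
        ennreal (?B (t - r))) = (\<lambda>r. 0)"
        using False by (auto split: split_indicator)
      then show ?thesis using False by simp
    qed
  qed
  also have "\<dots> = (\<integral>\<^sup>+r. \<integral>\<^sup>+t. ennreal (?A r) *
        ennreal (?B (t - r)) \<partial>lborel \<partial>lborel)"
    by (rule lborel_pair.Fubini') measurable
  also have "\<dots> = (\<integral>\<^sup>+r. ennreal (?A r) * Q \<partial>lborel)"
  proof (rule nn_integral_cong)
    fix r :: real
    have "Q = (\<integral>\<^sup>+t. ennreal (indicator {0..} (- r + 1 * t) * (exp (- l * (- r + 1 * t)) * (- r + 1 * t + s) powr (- a))) \<partial>lborel)"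
      unfolding Q_def by (subst nn_integral_real_affine[where c=1 and t="- r"]) auto
    then have Q: "Q = (\<integral>\<^sup>+t. ennreal (?B (t - r)) \<partial>lborel)"
      by (simp only: mult_1 uminus_add_conv_diff)
    show "(\<integral>\<^sup>+t. ennreal (?A r) *
        ennreal (?B (t - r)) \<partial>lborel) =
       ennreal (?A r) * Q"
      unfolding Q by (rule nn_integral_cmult) measurable
  qed
  also have "\<dots> = (\<integral>\<^sup>+r. ennreal (?A r) \<partial>lborel) * Q"
    by (rule nn_integral_multc) measurable
  also have "(\<integral>\<^sup>+r. ennreal (?A r) \<partial>lborel) =
     (\<integral>\<^sup>+r. ennreal (sin (a * pi) / pi) * ennreal (indicator {0..} r * (exp (- l * r) * r powr (a - 1))) \<partial>lborel)"
    using sp by (simp only: ennreal_mult' less_imp_le)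
  also have "\<dots> = ennreal (sin (a * pi) / pi) * ennreal (Gamma a * l powr (- a))"
    by (subst nn_integral_cmult, measurable) (simp only: nn_integral_exp_powr[OF a(1) l])
  finally have L: "(\<integral>\<^sup>+t. ennreal (indicator {0..} t * exp (- l * t) * Asl a (t / (t + s))) \<partial>lborel) =
     ennreal (sin (a * pi) / pi) * ennreal (Gamma a * l powr (- a)) * Q" .
  let ?N = "\<lambda>s. \<integral>x. trap_weight l s x * exp (- a * x) \<partial>lborel"
  have N0: "?N 0 = l powr a * (pi / sin (pi * a))"
  proof -
    have "ennreal (?N 0) = ennreal (l powr a * (pi / sin (pi * a)))"
      using nn_integral_trap_weight_0[OF a l] nn_integral_trap_weight_eq[OF a l, of 0] by simp
    moreover have "0 \<le> ?N 0" using trap_weight_nonneg[OF l] by (intro Bochner_Integration.integral_nonneg) auto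
    moreover have "0 \<le> l powr a * (pi / sin (pi * a))" using sin_pi_pos[OF a] by (simp add: mult.commute)
    ultimately show ?thesis by (subst (asm) ennreal_inj) auto
  qed
  have Ns: "ennreal (?N s) = ennreal (l * Gamma a) * Q"
    unfolding Q_def using nn_integral_trap_weight[OF a(1) l, of s] nn_integral_trap_weight_eq[OF a l, of s] s by simp
  have "ennreal (?N s / (l * ?N 0)) = ennreal (1 / (l * ?N 0)) * ennreal (?N s)"
  proof -
    have "0 \<le> ?N 0" using trap_weight_nonneg[OF l] by (intro Bochner_Integration.integral_nonneg) auto
    then have "0 \<le> 1 / (l * ?N 0)" using l by simp
    then show ?thesis by (subst ennreal_mult'[symmetric]) simp_all
  qed
  also have "\<dots> = ennreal (1 / (l * ?N 0)) * ennreal (l * Gamma a) * Q" unfolding Ns by (simp only: mult.assoc)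
  \<comment> \<open>The denominator contains pi / sin, and inverting it produces exactly the
    prefactor of the arcsine law.\<close>
  also have "ennreal (1 / (l * ?N 0)) * ennreal (l * Gamma a) = ennreal (sin (a * pi) / pi) * ennreal (Gamma a * l powr (- a))"
  proof -
    have "1 / (l * ?N 0) * (l * Gamma a) = sin (a * pi) / pi * (Gamma a * l powr (- a))"
      unfolding N0 using l by (simp add: powr_minus field_simps)
    moreover have "0 \<le> ?N 0" using trap_weight_nonneg[OF l] by (intro Bochner_Integration.integral_nonneg) auto
    ultimately show ?thesis using l G sp by (simp add: ennreal_mult[symmetric])
  qed
  finally show ?thesis unfolding L by simp
qed

lemma trap_weight_integral_0_pos:
  assumes a: "0 < a" "a < 1" and l: "0 < l"
  shows "0 < (\<integral>x. trap_weight l 0 x * exp (- a * x) \<partial>lborel)"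
proof -
  have "0 < l powr a * (pi / sin (pi * a))" using l sin_pi_pos[OF a] by (simp add: mult.commute)
  then have "0 < ennreal (\<integral>x. trap_weight l 0 x * exp (- a * x) \<partial>lborel)"
    using nn_integral_trap_weight_0[OF a l] nn_integral_trap_weight_eq[OF a l, of 0] by (metis ennreal_less_zero_iff order_refl)
  then show ?thesis by simp
qed

section \<open>Jump chains with exponential holding times\<close>

lemma (in prob_space) exponential_distributedD_ge:
  assumes D: "distributed M lborel X (exponential_density r)" and r: "0 < r" and a: "0 \<le> a"
  shows "emeasure (distr M borel X) {a..} = ennreal (exp (- r * a))"
    and "emeasure (distr M borel X) {a<..} = ennreal (exp (- r * a))"
proof -
  have X: "X \<in> borel_measurable M" using distributed_measurable[OF D] by simp
  have gt: "emeasure (distr M borel X) {a<..} = ennreal (exp (- r * a))"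
  proof -
    have "emeasure (distr M borel X) {a<..} = emeasure M {x \<in> space M. a < X x}"
      using X by (subst emeasure_distr) (auto intro!: arg_cong[where f="emeasure M"])
    also have "\<dots> = ennreal (exp (- r * a))"
      using exponential_distributedD_gt[OF D a r] by (simp add: emeasure_eq_measure mult.commute)
    finally show ?thesis .
  qed
  have "emeasure (distr M borel X) {a} = 0"
  proof -
    have d: "distr M borel X = density lborel (exponential_density r)"
      using distributed_distr_eq_density[OF D] by (simp cong: distr_cong)
    show ?thesis unfolding d by (subst emeasure_density) (auto intro!: nn_integral_zero' AE_I'[of "{a}"] split: split_indicator)
  qed
  moreover have "{a..} = {a} \<union> {a<..}" by auto
  moreover have "emeasure (distr M borel X) ({a} \<union> {a<..}) = emeasure (distr M borel X) {a} + emeasure (distr M borel X) {a<..}"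
    by (rule plus_emeasure[symmetric]) auto
  ultimately show "emeasure (distr M borel X) {a..} = ennreal (exp (- r * a))" using gt by simp
  show "emeasure (distr M borel X) {a<..} = ennreal (exp (- r * a))" by (rule gt)
qed

text \<open>Fubini in the value of \<open>S\<close>. The first event has a weak inequality at t + s,
  to fit observation over the half-open interval from t to t + s, and the second a strict one; both
  tails of an exponential variable agree.\<close>

lemma (in prob_space) memoryless_shift:
  assumes ind: "indep_var borel T borel S"
    and D: "distributed M lborel T (exponential_density r)" and r: "0 < r" and s: "0 \<le> s"
  shows "prob {w \<in> space M. S w \<le> t \<and> t + s \<le> S w + T w} =
    exp (- r * s) * prob {w \<in> space M. S w \<le> t \<and> t < S w + T w}"
proof -
  have [measurable]: "T \<in> borel_measurable M" "S \<in> borel_measurable M"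
    using indep_var_rv1[OF ind] indep_var_rv2[OF ind] by auto
  interpret DS: prob_space "distr M borel S" by (rule prob_space_distr) simp
  interpret DT: prob_space "distr M borel T" by (rule prob_space_distr) simp
  interpret TS: pair_sigma_finite "distr M borel T" "distr M borel S" ..
  have pair: "distr M (borel \<Otimes>\<^sub>M borel) (\<lambda>w. (T w, S w)) = distr M borel T \<Otimes>\<^sub>M distr M borel S"
    using ind unfolding indep_var_distribution_eq by simp
  have calc: "emeasure M {w \<in> space M. (T w, S w) \<in> A} = (\<integral>\<^sup>+x. emeasure (distr M borel T) ((\<lambda>y. (y, x)) -` A) \<partial>distr M borel S)"
    if A: "A \<in> sets (borel \<Otimes>\<^sub>M borel)" for A :: "(real \<times> real) set"
  proof -
    have "emeasure M {w \<in> space M. (T w, S w) \<in> A} = emeasure (distr M (borel \<Otimes>\<^sub>M borel) (\<lambda>w. (T w, S w))) A"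
      using A by (subst emeasure_distr) (auto intro!: arg_cong[where f="emeasure M"])
    also have "\<dots> = (\<integral>\<^sup>+x. emeasure (distr M borel T) ((\<lambda>y. (y, x)) -` A) \<partial>distr M borel S)"
      unfolding pair using A by (subst TS.emeasure_pair_measure_alt2) (auto cong: sets_pair_measure_cong)
    finally show ?thesis .
  qed
  have sets: "{(y, x). x \<le> t \<and> t + s \<le> x + y} \<in> sets (borel \<Otimes>\<^sub>M borel)"
      "{(y, x). x \<le> t \<and> t < x + y} \<in> sets (borel \<Otimes>\<^sub>M borel)"
  proof -
    have "{(y, x). x \<le> t \<and> t + s \<le> x + y} = {z \<in> space (borel \<Otimes>\<^sub>M borel). snd z \<le> t \<and> t + s \<le> snd z + fst z}"
      "{(y, x). x \<le> t \<and> t < x + y} = {z \<in> space (borel \<Otimes>\<^sub>M borel). snd z \<le> t \<and> t < snd z + fst z}"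
      by (auto simp: space_pair_measure)
    then show "{(y, x). x \<le> t \<and> t + s \<le> x + y} \<in> sets (borel \<Otimes>\<^sub>M borel)"
      "{(y, x). x \<le> t \<and> t < x + y} \<in> sets (borel \<Otimes>\<^sub>M borel)" by simp_all
  qed
  have 1: "emeasure M {w \<in> space M. S w \<le> t \<and> t + s \<le> S w + T w} =
      (\<integral>\<^sup>+x. indicator {..t} x * ennreal (exp (- r * (t + s - x))) \<partial>distr M borel S)"
  proof -
    have "emeasure M {w \<in> space M. (T w, S w) \<in> {(y, x). x \<le> t \<and> t + s \<le> x + y}} =
       (\<integral>\<^sup>+x. emeasure (distr M borel T) ((\<lambda>y. (y, x)) -` {(y, x). x \<le> t \<and> t + s \<le> x + y}) \<partial>distr M borel S)"
      by (rule calc) (rule sets)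
    also have "\<dots> = (\<integral>\<^sup>+x. indicator {..t} x * ennreal (exp (- r * (t + s - x))) \<partial>distr M borel S)"
    proof (rule nn_integral_cong)
      fix x :: real
      show "emeasure (distr M borel T) ((\<lambda>y. (y, x)) -` {(y, x). x \<le> t \<and> t + s \<le> x + y}) =
          indicator {..t} x * ennreal (exp (- r * (t + s - x)))"
      proof (cases "x \<le> t")
        case True
        then have "(\<lambda>y. (y, x)) -` {(y, x). x \<le> t \<and> t + s \<le> x + y} = {t + s - x..}" by auto
        then show ?thesis using True s exponential_distributedD_ge(1)[OF D r, of "t + s - x"] by simp
      qed simp
    qed
    finally show ?thesis by simp
  qed
  have 2: "emeasure M {w \<in> space M. S w \<le> t \<and> t < S w + T w} =
      (\<integral>\<^sup>+x. indicator {..t} x * ennreal (exp (- r * (t - x))) \<partial>distr M borel S)"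
  proof -
    have "emeasure M {w \<in> space M. (T w, S w) \<in> {(y, x). x \<le> t \<and> t < x + y}} =
       (\<integral>\<^sup>+x. emeasure (distr M borel T) ((\<lambda>y. (y, x)) -` {(y, x). x \<le> t \<and> t < x + y}) \<partial>distr M borel S)"
      by (rule calc) (rule sets)
    also have "\<dots> = (\<integral>\<^sup>+x. indicator {..t} x * ennreal (exp (- r * (t - x))) \<partial>distr M borel S)"
    proof (rule nn_integral_cong)
      fix x :: real
      show "emeasure (distr M borel T) ((\<lambda>y. (y, x)) -` {(y, x). x \<le> t \<and> t < x + y}) =
          indicator {..t} x * ennreal (exp (- r * (t - x)))"
      proof (cases "x \<le> t")
        case True
        then have "(\<lambda>y. (y, x)) -` {(y, x). x \<le> t \<and> t < x + y} = {t - x<..}" by auto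
        then show ?thesis using True s exponential_distributedD_ge(2)[OF D r, of "t - x"] by simp
      qed simp
    qed
    finally show ?thesis by simp
  qed
  have "(\<integral>\<^sup>+x. indicator {..t} x * ennreal (exp (- r * (t + s - x))) \<partial>distr M borel S) =
     (\<integral>\<^sup>+x. ennreal (exp (- r * s)) * (indicator {..t} x * ennreal (exp (- r * (t - x)))) \<partial>distr M borel S)"
  proof (rule nn_integral_cong)
    fix x :: real
    have "exp (- r * (t + s - x)) = exp (- r * s) * exp (- r * (t - x))"
      by (simp add: exp_add[symmetric] algebra_simps)
    then show "indicator {..t} x * ennreal (exp (- r * (t + s - x))) = ennreal (exp (- r * s)) * (indicator {..t} x * ennreal (exp (- r * (t - x))))"
      by (simp add: ennreal_mult mult_ac)
  qed
  also have "\<dots> = ennreal (exp (- r * s)) * (\<integral>\<^sup>+x. indicator {..t} x * ennreal (exp (- r * (t - x))) \<partial>distr M borel S)"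
    by (rule nn_integral_cmult) measurable
  finally have "emeasure M {w \<in> space M. S w \<le> t \<and> t + s \<le> S w + T w} =
      ennreal (exp (- r * s)) * emeasure M {w \<in> space M. S w \<le> t \<and> t < S w + T w}"
    unfolding 1 2 .
  then show ?thesis by (simp add: emeasure_eq_measure ennreal_mult[symmetric])
qed

lemma (in prob_space) nn_integral_exponential:
  assumes D: "distributed M lborel T (exponential_density r)" and r: "0 < r" and l: "0 < l"
  shows "(\<integral>\<^sup>+w. ennreal (exp (- l * T w)) \<partial>M) = ennreal (r / (l + r))"
    and "(\<integral>\<^sup>+w. ennreal (1 - exp (- l * T w)) \<partial>M) = ennreal (l / (l + r))"
proof -
  have c: "(\<integral>\<^sup>+w. ennreal (g (T w)) \<partial>M) = (\<integral>\<^sup>+q. ennreal (indicator {0..} q * (r * exp (- r * q) * g q)) \<partial>lborel)"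
    if [measurable]: "g \<in> borel_measurable borel" for g :: "real \<Rightarrow> real"
    by (subst distributed_nn_integral[OF D, symmetric])
       (use r in \<open>auto intro!: nn_integral_cong simp: exponential_density_def ennreal_mult'[symmetric] ennreal_mult''[symmetric] mult_ac split: split_indicator\<close>)
  have lr: "0 < l + r" using l r by simp
  have "(\<integral>\<^sup>+q. ennreal (indicator {0..} q * (r * exp (- r * q) * exp (- l * q))) \<partial>lborel) =
     (\<integral>\<^sup>+q. ennreal r * ennreal (indicator {0..} q * exp (- (l + r) * q)) \<partial>lborel)"
    using r by (intro nn_integral_cong) (simp add: ennreal_mult[symmetric] exp_add[symmetric] algebra_simps split: split_indicator)
  also have "\<dots> = ennreal r * ennreal (1 / (l + r))"
    by (subst nn_integral_cmult, measurable) (simp only: nn_integral_exp_Ici[OF lr])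
  also have "\<dots> = ennreal (r / (l + r))" using r lr by (simp add: ennreal_mult[symmetric])
  finally show A: "(\<integral>\<^sup>+w. ennreal (exp (- l * T w)) \<partial>M) = ennreal (r / (l + r))"
    by (subst c) auto
  have T[measurable]: "T \<in> borel_measurable M" using distributed_measurable[OF D] by simp
  have "AE w in M. 0 \<le> T w"
  proof -
    have "AE x in distr M lborel T. 0 \<le> x"
      unfolding distributed_distr_eq_density[OF D] by (subst AE_density) (auto simp: exponential_density_def)
    then show ?thesis by (subst (asm) AE_distr_iff) auto
  qed
  then have ae: "AE w in M. exp (- l * T w) \<le> 1" by eventually_elim (use l in auto)
  have i: "integrable M (\<lambda>w. exp (- l * T w))"
    by (rule integrable_const_bound[of _ 1]) (use ae in auto)
  then have "(\<integral>w. exp (- l * T w) \<partial>M) = r / (l + r)"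
    using A r lr by (subst (asm) nn_integral_eq_integral) auto
  moreover have "(\<integral>\<^sup>+w. ennreal (1 - exp (- l * T w)) \<partial>M) = ennreal (\<integral>w. 1 - exp (- l * T w) \<partial>M)"
    using i ae by (intro nn_integral_eq_integral) auto
  ultimately have "(\<integral>\<^sup>+w. ennreal (1 - exp (- l * T w)) \<partial>M) = ennreal (1 - r / (l + r))"
    using i prob_space by simp
  also have "1 - r / (l + r) = l / (l + r)" using lr by (simp add: field_simps)
  finally show "(\<integral>\<^sup>+w. ennreal (1 - exp (- l * T w)) \<partial>M) = ennreal (l / (l + r))" .
qed

text \<open>The rates \<open>r\<close> are kept apart from the transition kernel \<open>K\<close>,
  so that a change of the time unit affects \<open>r\<close> and \<open>T\<close> and leaves the
  chain as it is.\<close>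

locale jump_chain = prob_space P for P :: "'b measure" +
  fixes V :: "'a set" and p :: "'a \<Rightarrow> real" and K :: "'a \<Rightarrow> 'a \<Rightarrow> real" and r :: "'a \<Rightarrow> real"
    and J :: "nat \<Rightarrow> 'b \<Rightarrow> 'a" and T :: "nat \<Rightarrow> 'b \<Rightarrow> real"
  assumes finite_V: "finite V" and rate_pos: "\<And>x. x \<in> V \<Longrightarrow> 0 < r x"
    and p_nonneg: "\<And>x. 0 \<le> p x" and K_nonneg: "\<And>x y. x \<in> V \<Longrightarrow> y \<in> V \<Longrightarrow> 0 \<le> K x y"
    and K_sum: "\<And>x. x \<in> V \<Longrightarrow> (\<Sum>y\<in>V. K x y) \<le> 1"
    and J_meas: "\<And>k. J k \<in> measurable P (count_space V)"
    and T_meas: "\<And>k. T k \<in> borel_measurable P"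
    and law: "\<And>k x s. (\<forall>i\<le>k. x i \<in> V \<and> 0 \<le> s i) \<Longrightarrow>
       prob {w \<in> space P. \<forall>i\<le>k. J i w = x i \<and> s i < T i w} =
         p (x 0) * (\<Prod>i<k. K (x i) (x (Suc i))) * (\<Prod>i\<le>k. exp (- r (x i) * s i))"
    and T_pos: "\<And>k w. w \<in> space P \<Longrightarrow> 0 < T k w"
    and T_sum: "\<And>w. w \<in> space P \<Longrightarrow> filterlim (\<lambda>k. \<Sum>i<k. T i w) at_top sequentially"
begin

definition clock :: "nat \<Rightarrow> 'b \<Rightarrow> real" where "clock k w = (\<Sum>i<k. T i w)"

definition path :: "nat \<Rightarrow> (nat \<Rightarrow> 'a) \<Rightarrow> 'b set" where
  "path k x = {w \<in> space P. \<forall>i\<le>k. J i w = x i}"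

definition weight :: "nat \<Rightarrow> (nat \<Rightarrow> 'a) \<Rightarrow> real" where
  "weight k x = p (x 0) * (\<Prod>i<k. K (x i) (x (Suc i)))"

lemma T_measurable [measurable]: "T k \<in> borel_measurable P" by (rule T_meas)

lemma J_measurable [measurable]: "J k \<in> measurable P (count_space V)" by (rule J_meas)

lemma J_in: "w \<in> space P \<Longrightarrow> J k w \<in> V"
  using measurable_space[OF J_meas[of k]] by simp

lemma J_eq_sets: "{w \<in> space P. J k w = y} \<in> sets P"
proof -
  have "{w \<in> space P. J k w = y} = J k -` ({y} \<inter> V) \<inter> space P" using J_in by auto
  also have "\<dots> \<in> sets P" by (rule measurable_sets[OF J_meas]) simp
  finally show ?thesis .
qed

lemma clock_measurable [measurable]: "clock k \<in> borel_measurable P"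
  unfolding clock_def by measurable

lemma clock_Suc: "clock (Suc k) w = clock k w + T k w"
  by (simp add: clock_def)

lemma path_sets [measurable]: "path k x \<in> sets P"
proof -
  have "path k x = (\<Inter>i\<in>{..k}. {w \<in> space P. J i w = x i})" by (auto simp: path_def)
  also have "\<dots> \<in> sets P" by (intro sets.finite_INT J_eq_sets) auto
  finally show ?thesis .
qed

text \<open>The thresholds in \<open>law\<close> are set to 0, which imposes no condition because
  holding times are positive.\<close>

lemma prob_path:
  assumes "\<And>i. i \<le> k \<Longrightarrow> x i \<in> V" shows "prob (path k x) = weight k x"
proof -
  have "path k x = {w \<in> space P. \<forall>i\<le>k. J i w = x i \<and> 0 < T i w}" using T_pos by (auto simp: path_def)
  then show ?thesis using law[of k x "\<lambda>_. 0"] assms by (simp add: weight_def)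
qed

abbreviation "cond k x \<equiv> uniform_measure P (path k x)"

text \<open>Given a path of positive weight, \<open>law\<close> says that the probabilities of joint
  exceedance factorise. The events T > s with s nonnegative suffice to determine the joint law,
  since the holding times are positive.\<close>

lemma conditional_holding_times:
  assumes x: "\<And>i. i \<le> k \<Longrightarrow> x i \<in> V" and pos: "0 < weight k x"
  shows cond_prob_space: "prob_space (cond k x)"
    and cond_indep: "prob_space.indep_vars (cond k x) (\<lambda>_. borel) T {..k}"
    and cond_exponential: "\<And>i. i \<le> k \<Longrightarrow> distributed (cond k x) lborel (T i) (exponential_density (r (x i)))"
proof -
  have pp: "prob (path k x) = weight k x" by (rule prob_path) (rule x)
  have e0: "emeasure P (path k x) \<noteq> 0" "emeasure P (path k x) \<noteq> \<infinity>"
    using pos pp by (auto simp: emeasure_eq_measure)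
  show Q: "prob_space (cond k x)" by (rule prob_space_uniform_measure) (use e0 in auto)
  interpret Q: prob_space "cond k x" by (rule Q)
  have TQ[measurable]: "T i \<in> borel_measurable (cond k x)" for i by simp
  have law': "measure (cond k x) {w \<in> space P. \<forall>i\<le>k. s i < T i w} = (\<Prod>i\<le>k. exp (- r (x i) * s i))"
    if s: "\<And>i. i \<le> k \<Longrightarrow> 0 \<le> s i" for s
  proof -
    have "{w \<in> space P. \<forall>i\<le>k. s i < T i w} \<in> sets P" by measurable
    then have "measure (cond k x) {w \<in> space P. \<forall>i\<le>k. s i < T i w} =
        prob (path k x \<inter> {w \<in> space P. \<forall>i\<le>k. s i < T i w}) / prob (path k x)"
      using e0 by (intro measure_uniform_measure) auto
    also have "path k x \<inter> {w \<in> space P. \<forall>i\<le>k. s i < T i w} = {w \<in> space P. \<forall>i\<le>k. J i w = x i \<and> s i < T i w}"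
      by (auto simp: path_def)
    also have "prob \<dots> = weight k x * (\<Prod>i\<le>k. exp (- r (x i) * s i))"
      using law[of k x s] x s by (simp add: weight_def)
    finally show ?thesis using pp pos by simp
  qed
  \<comment> \<open>All thresholds but one are set to 0.\<close>
  have single: "measure (cond k x) {w \<in> space P. a < T i w} = exp (- r (x i) * a)" if i: "i \<le> k" and a: "0 \<le> a" for i a
  proof -
    have "{w \<in> space P. a < T i w} = {w \<in> space P. \<forall>j\<le>k. (if j = i then a else 0) < T j w}"
      using T_pos i by auto
    then have "measure (cond k x) {w \<in> space P. a < T i w} = (\<Prod>j\<le>k. exp (- r (x j) * (if j = i then a else 0)))"
      using law'[of "\<lambda>j. if j = i then a else 0"] a by simp
    also have "\<dots> = (\<Prod>j\<le>k. if j = i then exp (- r (x i) * a) else 1)" by (rule prod.cong) auto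
    also have "\<dots> = exp (- r (x i) * a)" using i by simp
    finally show ?thesis .
  qed
  show "distributed (cond k x) lborel (T i) (exponential_density (r (x i)))" if i: "i \<le> k" for i
  proof (subst Q.exponential_distributed_iff, intro rate_pos x i, intro conjI allI impI)
    fix a :: real assume a: "0 \<le> a"
    have "{w \<in> space (cond k x). T i w \<le> a} = space (cond k x) - {w \<in> space P. a < T i w}" by auto
    then show "Q.prob {w \<in> space (cond k x). T i w \<le> a} = 1 - exp (- a * r (x i))"
      using Q.prob_compl[of "{w \<in> space P. a < T i w}"] single[OF i a] by (simp add: mult.commute)
  qed simp
  \<comment> \<open>Every generator has a preimage of the form T > b with b nonnegative: a ray with
    negative endpoint is cut at 0, and the whole line corresponds to b = 0.\<close>
  have trunc: "\<exists>b. 0 \<le> b \<and> T j -` A \<inter> space P = {w \<in> space P. b < T j w}"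
    if A: "A \<in> insert UNIV (range greaterThan)" for A j
  proof -
    consider "A = UNIV" | c where "A = {c<..}" using A by blast
    then show ?thesis
    proof cases
      case 1 then show ?thesis using T_pos by (intro exI[of _ 0]) auto
    next
      case 2
      then have "T j -` A \<inter> space P = {w \<in> space P. max c 0 < T j w}" using T_pos[of _ j] by (simp add: set_eq_iff) blast
      then show ?thesis by (intro exI[of _ "max c 0"]) auto
    qed
  qed
  show "Q.indep_vars (\<lambda>_. borel) T {..k}"
  proof (subst Q.indep_vars_finite[where E="\<lambda>_. insert UNIV (range greaterThan)"])
    show "sets borel = sigma_sets (space borel) (insert UNIV (range greaterThan :: real set set))"
    proof -
      have "sets (borel :: real measure) = sigma_sets UNIV (range greaterThan)"
        unfolding borel_Ioi by simp
      also have "\<dots> = sigma_sets UNIV (insert UNIV (range greaterThan))"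
        by (rule antisym; rule sigma_sets_mono) (auto intro: sigma_sets_top sigma_sets.Basic)
      finally show ?thesis by simp
    qed
    show "Int_stable (insert UNIV (range greaterThan :: real set set))"
    proof (rule Int_stableI)
      fix a b :: "real set" assume "a \<in> insert UNIV (range greaterThan)" "b \<in> insert UNIV (range greaterThan)"
      moreover have "{c<..} \<inter> {d<..} = {max c d<..}" for c d :: real by auto
      ultimately show "a \<inter> b \<in> insert UNIV (range greaterThan)" by auto
    qed
    show "\<forall>A\<in>{..k} \<rightarrow> insert UNIV (range greaterThan).
       Q.prob (\<Inter>j\<in>{..k}. T j -` A j \<inter> space (cond k x)) = (\<Prod>j\<le>k. Q.prob (T j -` A j \<inter> space (cond k x)))"
    proof
      fix A :: "nat \<Rightarrow> real set" assume A: "A \<in> {..k} \<rightarrow> insert UNIV (range greaterThan)"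
      have "\<forall>j\<in>{..k}. \<exists>b. 0 \<le> b \<and> T j -` A j \<inter> space P = {w \<in> space P. b < T j w}"
      proof
        fix j assume "j \<in> {..k}"
        with A have "A j \<in> insert UNIV (range greaterThan)" by (rule Pi_mem)
        then show "\<exists>b. 0 \<le> b \<and> T j -` A j \<inter> space P = {w \<in> space P. b < T j w}" by (rule trunc)
      qed
      from bchoice[OF this] obtain b where
        b: "\<forall>j\<in>{..k}. 0 \<le> b j \<and> T j -` A j \<inter> space P = {w \<in> space P. b j < T j w}" ..
      have "(\<Inter>j\<in>{..k}. T j -` A j \<inter> space (cond k x)) = (\<Inter>j\<in>{..k}. {w \<in> space P. b j < T j w})"
        using b by (intro INF_cong) simp_all
      also have "\<dots> = {w \<in> space P. \<forall>i\<le>k. b i < T i w}" by auto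
      finally have "(\<Inter>j\<in>{..k}. T j -` A j \<inter> space (cond k x)) = {w \<in> space P. \<forall>i\<le>k. b i < T i w}" .
      then have "Q.prob (\<Inter>j\<in>{..k}. T j -` A j \<inter> space (cond k x)) = (\<Prod>j\<le>k. exp (- r (x j) * b j))"
        using law'[of b] b by simp
      also have "\<dots> = (\<Prod>j\<le>k. Q.prob (T j -` A j \<inter> space (cond k x)))"
        using b single by (intro prod.cong) auto
      finally show "Q.prob (\<Inter>j\<in>{..k}. T j -` A j \<inter> space (cond k x)) = (\<Prod>j\<le>k. Q.prob (T j -` A j \<inter> space (cond k x)))" .
    qed
  qed (auto simp: TQ)
qed

text \<open>Under the conditional law the k-th holding time is independent of the sum
  \<open>clock k\<close> of the earlier ones, so memorylessness applies; paths of weight zero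
  contribute nothing on either side.\<close>

lemma path_holding:
  assumes x: "\<And>i. i \<le> k \<Longrightarrow> x i \<in> V" and s: "0 \<le> s"
  shows "prob (path k x \<inter> {w \<in> space P. clock k w \<le> t \<and> t + s \<le> clock (Suc k) w}) =
    exp (- r (x k) * s) * prob (path k x \<inter> {w \<in> space P. clock k w \<le> t \<and> t < clock (Suc k) w})"
proof -
  have pp: "prob (path k x) = weight k x" by (rule prob_path) (rule x)
  show ?thesis
  proof (cases "weight k x = 0")
    case True
    then have "prob (path k x) = 0" using pp by simp
    moreover have "prob (path k x \<inter> A) \<le> prob (path k x)" for A
      by (rule finite_measure_mono) auto
    ultimately have "prob (path k x \<inter> A) = 0" for A
      by (metis measure_le_0_iff)
    then show ?thesis by simp
  next
    case False
    moreover have "0 \<le> weight k x" using pp by (metis measure_nonneg)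
    ultimately have pos: "0 < weight k x" by simp
    interpret Q: prob_space "cond k x" by (rule cond_prob_space[OF x pos])
    have e0: "emeasure P (path k x) \<noteq> 0" "emeasure P (path k x) \<noteq> \<infinity>"
      using pos pp by (auto simp: emeasure_eq_measure)
    have "Q.indep_vars (\<lambda>_. borel) T {..k}" by (rule cond_indep[OF x pos])
    moreover have "{..k} = insert k {..<k}" by auto
    ultimately have "Q.indep_vars (\<lambda>_. borel) T (insert k {..<k})" by (simp only:)
    then have ind: "Q.indep_var borel (T k) borel (clock k)"
      unfolding clock_def[abs_def] by (intro Q.indep_vars_sum) simp_all
    have dk: "distributed (cond k x) lborel (T k) (exponential_density (r (x k)))"
      by (rule cond_exponential[OF x pos order_refl])
    have e: "measure (cond k x) A = prob (path k x \<inter> A) / prob (path k x)" if "A \<in> sets P" for A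
      using that e0 by (intro measure_uniform_measure) auto
    have "measure (cond k x) {w \<in> space P. clock k w \<le> t \<and> t + s \<le> clock k w + T k w} =
      exp (- r (x k) * s) * measure (cond k x) {w \<in> space P. clock k w \<le> t \<and> t < clock k w + T k w}"
      using Q.memoryless_shift[OF ind dk rate_pos[OF x[OF order_refl]] s, of t] by simp
    moreover have "{w \<in> space P. clock k w \<le> t \<and> t + s \<le> clock k w + T k w} \<in> sets P"
      "{w \<in> space P. clock k w \<le> t \<and> t < clock k w + T k w} \<in> sets P" by measurable
    ultimately have "prob (path k x \<inter> {w \<in> space P. clock k w \<le> t \<and> t + s \<le> clock k w + T k w}) / prob (path k x) =
      exp (- r (x k) * s) * (prob (path k x \<inter> {w \<in> space P. clock k w \<le> t \<and> t < clock k w + T k w}) / prob (path k x))"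
      by (simp only: e)
    then show ?thesis
      unfolding clock_Suc using pp pos by simp
  qed
qed

section \<open>Decomposition along paths and the event of no jump\<close>

abbreviation paths :: "nat \<Rightarrow> (nat \<Rightarrow> 'a) set" where "paths k \<equiv> {..k} \<rightarrow>\<^sub>E V"

lemma finite_paths: "finite (paths k)"
  by (intro finite_PiE finite_V) auto

lemma prob_eq_sum_paths:
  assumes A: "A \<in> sets P" shows "prob A = (\<Sum>x\<in>paths k. prob (path k x \<inter> A))"
proof -
  have eq: "A = (\<Union>x\<in>paths k. path k x \<inter> A)"
  proof (intro equalityI subsetI)
    fix w assume w: "w \<in> A"
    then have "w \<in> space P" using sets.sets_into_space[OF A] by auto
    then have "restrict (\<lambda>i. J i w) {..k} \<in> paths k" "w \<in> path k (restrict (\<lambda>i. J i w) {..k})"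
      using J_in by (auto simp: path_def)
    then show "w \<in> (\<Union>x\<in>paths k. path k x \<inter> A)" using w by blast
  qed auto
  have "disjoint_family_on (\<lambda>x. path k x \<inter> A) (paths k)"
    unfolding disjoint_family_on_def
  proof (intro ballI impI)
    fix x y assume xy: "x \<in> paths k" "y \<in> paths k" "x \<noteq> y"
    then obtain i where "i \<le> k" "x i \<noteq> y i" using PiE_ext[of x "{..k}" "\<lambda>_. V" y] by auto
    then show "path k x \<inter> A \<inter> (path k y \<inter> A) = {}" by (auto simp: path_def)
  qed
  then have "prob (\<Union>x\<in>paths k. path k x \<inter> A) = (\<Sum>x\<in>paths k. prob (path k x \<inter> A))"
    using A by (intro finite_measure_finite_Union finite_paths) auto
  then show ?thesis by (rule trans[OF arg_cong[OF eq, of prob]])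
qed

lemma clock_mono: "w \<in> space P \<Longrightarrow> i \<le> j \<Longrightarrow> clock i w \<le> clock j w"
  unfolding clock_def by (rule sum_mono2) (auto intro: less_imp_le T_pos)

lemma clock_strict: "w \<in> space P \<Longrightarrow> clock i w < clock (Suc i) w"
  using T_pos by (simp add: clock_Suc)

lemma clock_interval_unique:
  assumes "w \<in> space P" "clock i w \<le> t" "t < clock (Suc i) w" "clock j w \<le> t" "t < clock (Suc j) w"
  shows "i = j"
proof (rule ccontr)
  assume "i \<noteq> j"
  then consider "Suc i \<le> j" | "Suc j \<le> i" by linarith
  then show False using clock_mono[OF assms(1), of "Suc i" j] clock_mono[OF assms(1), of "Suc j" i] assms
    by cases linarith+
qed

lemma clock_interval_exists:
  assumes w: "w \<in> space P" and t: "0 \<le> t"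
  obtains k where "clock k w \<le> t" "t < clock (Suc k) w"
proof -
  have "eventually (\<lambda>k. t < clock k w) sequentially"
    using T_sum[OF w] unfolding filterlim_at_top_dense clock_def by blast
  then have ex: "\<exists>k. t < clock k w" by (auto simp: eventually_sequentially)
  define m where "m = (LEAST k. t < clock k w)"
  have m: "t < clock m w" unfolding m_def using ex by (rule LeastI_ex)
  have "m \<noteq> 0"
  proof
    assume "m = 0" then show False using m t by (simp add: clock_def)
  qed
  then obtain k where k: "m = Suc k" by (cases m) auto
  have "\<not> t < clock k w" using not_less_Least[of k "\<lambda>k. t < clock k w"] k by (simp add: m_def)
  then show ?thesis using that[of k] m k by simp
qed

text \<open>A jump at time t + s itself is allowed, because the correlation function only inspects
  times before t + s.\<close>

definition no_jump :: "real \<Rightarrow> real \<Rightarrow> 'b set" where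
  "no_jump t s = {w \<in> space P. \<exists>k. clock k w \<le> t \<and> t + s \<le> clock (Suc k) w}"

definition occupation :: "nat \<Rightarrow> (nat \<Rightarrow> 'a) \<Rightarrow> real \<Rightarrow> real" where
  "occupation k x t = prob (path k x \<inter> {w \<in> space P. clock k w \<le> t \<and> t < clock (Suc k) w})"

lemma occupation_nonneg: "0 \<le> occupation k x t" by (simp add: occupation_def)

lemma no_jump_sets [measurable]: "no_jump t s \<in> sets P"
  unfolding no_jump_def by measurable

text \<open>The interval lies within a single holding period, whose index k is unique since s > 0;
  memorylessness replaces the survival condition by the factor exp (- r s).\<close>

lemma no_jump_sums:
  assumes s: "0 < s"
  shows "(\<lambda>k. \<Sum>x\<in>paths k. exp (- r (x k) * s) * occupation k x t) sums prob (no_jump t s)"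
proof -
  define F where "F k = {w \<in> space P. clock k w \<le> t \<and> t + s \<le> clock (Suc k) w}" for k
  have F: "F k \<in> sets P" for k unfolding F_def by measurable
  have "disjoint_family F"
    unfolding disjoint_family_on_def
  proof (intro ballI impI, rule ccontr)
    fix i j assume ij: "i \<noteq> j" "F i \<inter> F j \<noteq> {}"
    then obtain w where "w \<in> F i" "w \<in> F j" by blast
    then show False using clock_interval_unique[of w i t j] ij(1) s by (simp add: F_def)
  qed
  then have "(\<lambda>k. prob (F k)) sums prob (\<Union>k. F k)"
    using F by (intro finite_measure_UNION) auto
  moreover have "(\<Union>k. F k) = no_jump t s" by (auto simp: F_def no_jump_def)
  moreover have "prob (F k) = (\<Sum>x\<in>paths k. exp (- r (x k) * s) * occupation k x t)" for k
  proof -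
    have "prob (F k) = (\<Sum>x\<in>paths k. prob (path k x \<inter> F k))" by (rule prob_eq_sum_paths[OF F])
    also have "\<dots> = (\<Sum>x\<in>paths k. exp (- r (x k) * s) * occupation k x t)"
      unfolding F_def occupation_def using s by (intro sum.cong refl path_holding) auto
    finally show ?thesis .
  qed
  ultimately show ?thesis by simp
qed

text \<open>This is non-explosion: every time t lies in some holding period.\<close>

lemma occupation_sums:
  assumes t: "0 \<le> t"
  shows "(\<lambda>k. \<Sum>x\<in>paths k. occupation k x t) sums 1"
proof -
  define F where "F k = {w \<in> space P. clock k w \<le> t \<and> t < clock (Suc k) w}" for k
  have F: "F k \<in> sets P" for k unfolding F_def by measurable
  have "disjoint_family F"
    unfolding disjoint_family_on_def
  proof (intro ballI impI, rule ccontr)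
    fix i j assume ij: "i \<noteq> j" "F i \<inter> F j \<noteq> {}"
    then obtain w where "w \<in> F i" "w \<in> F j" by blast
    then show False using clock_interval_unique[of w i t j] ij(1) by (simp add: F_def)
  qed
  then have "(\<lambda>k. prob (F k)) sums prob (\<Union>k. F k)"
    using F by (intro finite_measure_UNION) auto
  moreover have "(\<Union>k. F k) = space P"
  proof (intro equalityI subsetI)
    fix w assume w: "w \<in> space P"
    obtain k where "clock k w \<le> t" "t < clock (Suc k) w" by (rule clock_interval_exists[OF w t])
    with w show "w \<in> (\<Union>k. F k)" by (auto simp: F_def)
  qed (auto simp: F_def)
  moreover have "prob (F k) = (\<Sum>x\<in>paths k. occupation k x t)" for k
    using prob_eq_sum_paths[OF F[of k], of k] by (simp only: F_def occupation_def)
  ultimately show ?thesis by (simp add: prob_space)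
qed

lemma no_jump_antimono:
  assumes "s \<le> s'" shows "prob (no_jump t s') \<le> prob (no_jump t s)"
proof (rule finite_measure_mono)
  show "no_jump t s' \<subseteq> no_jump t s"
  proof
    fix w assume "w \<in> no_jump t s'"
    then obtain k where "w \<in> space P" "clock k w \<le> t" "t + s' \<le> clock (Suc k) w" by (auto simp: no_jump_def)
    moreover from this have "t + s \<le> clock (Suc k) w" using assms by linarith
    ultimately show "w \<in> no_jump t s" unfolding no_jump_def by blast
  qed
qed (rule no_jump_sets)

text \<open>The constant is uniform in the exit rates: exp (- q s) \<le> 1 / (q s) and 1 - exp (- q
  (s' - s)) \<le> q (s' - s), and in the product of the two bounds the rate q cancels.\<close>

lemma no_jump_lipschitz:
  assumes t: "0 \<le> t" and s: "0 < s" "s \<le> s'"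
  shows "prob (no_jump t s) \<le> prob (no_jump t s') + (s' - s) / s"
proof (rule sums_le)
  show "(\<lambda>k. \<Sum>x\<in>paths k. exp (- r (x k) * s) * occupation k x t) sums prob (no_jump t s)"
    by (rule no_jump_sums) (rule s)
  show "(\<lambda>k. (\<Sum>x\<in>paths k. exp (- r (x k) * s') * occupation k x t) + (s' - s) / s * (\<Sum>x\<in>paths k. occupation k x t))
     sums (prob (no_jump t s') + (s' - s) / s)"
    using sums_add[OF no_jump_sums[of s' t] sums_mult[OF occupation_sums[OF t], of "(s' - s) / s"]] s by simp
  have e: "exp (- q * s) \<le> exp (- q * s') + (s' - s) / s" if q: "0 < q" for q :: real
  proof -
    have "1 - exp (- q * (s' - s)) \<le> q * (s' - s)" using exp_ge_add_one_self[of "- q * (s' - s)"] by simp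
    moreover have "exp (- q * s) \<le> 1 / (q * s)"
    proof -
      have "q * s \<le> exp (q * s)" using exp_ge_add_one_self[of "q * s"] by linarith
      then have "1 / exp (q * s) \<le> 1 / (q * s)" using q s by (intro divide_left_mono) auto
      then show ?thesis by (simp add: exp_minus field_simps)
    qed
    moreover have "0 \<le> 1 - exp (- q * (s' - s))" using q s by simp
    ultimately have "exp (- q * s) * (1 - exp (- q * (s' - s))) \<le> 1 / (q * s) * (q * (s' - s))"
      using q s by (intro mult_mono) auto
    moreover have "exp (- q * s) * exp (- q * (s' - s)) = exp (- q * s')"
      by (simp add: exp_add[symmetric] algebra_simps)
    moreover have "1 / (q * s) * (q * (s' - s)) = (s' - s) / s" using q by simp
    ultimately show ?thesis by (simp only: right_diff_distrib mult_1_right)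
  qed
  fix k
  have "(\<Sum>x\<in>paths k. exp (- r (x k) * s) * occupation k x t) \<le>
      (\<Sum>x\<in>paths k. (exp (- r (x k) * s') + (s' - s) / s) * occupation k x t)"
    by (intro sum_mono mult_right_mono e occupation_nonneg rate_pos) auto
  then show "(\<Sum>x\<in>paths k. exp (- r (x k) * s) * occupation k x t) \<le>
      (\<Sum>x\<in>paths k. exp (- r (x k) * s') * occupation k x t) + (s' - s) / s * (\<Sum>x\<in>paths k. occupation k x t)"
    by (simp add: distrib_right sum.distrib sum_distrib_left)
qed

text \<open>No jump on the interval of length s from t implies none on its part after t', of length
  s - (t' - t); prolonging that part to length s costs the Lipschitz bound. As long as the part has
  length at least s / 2 the constant is at most 2 / s, and otherwise the right-hand side exceeds
  1.\<close>

lemma no_jump_onesided: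
  assumes t: "0 \<le> t" "t \<le> t'" and s: "0 < s"
  shows "prob (no_jump t s) \<le> prob (no_jump t' s) + 2 / s * (t' - t)"
proof (cases "t' - t \<le> s / 2")
  case True
  have "prob (no_jump t s) \<le> prob (no_jump t' (s - (t' - t)))"
  proof (rule finite_measure_mono)
    show "no_jump t s \<subseteq> no_jump t' (s - (t' - t))"
    proof
      fix w assume "w \<in> no_jump t s"
      then obtain k where "w \<in> space P" "clock k w \<le> t" "t + s \<le> clock (Suc k) w" by (auto simp: no_jump_def)
      moreover from this have "clock k w \<le> t'" "t' + (s - (t' - t)) \<le> clock (Suc k) w" using t by linarith+
      ultimately show "w \<in> no_jump t' (s - (t' - t))" unfolding no_jump_def by blast
    qed
  qed (rule no_jump_sets)
  also have "\<dots> \<le> prob (no_jump t' s) + (s - (s - (t' - t))) / (s - (t' - t))"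
    using t s True by (intro no_jump_lipschitz) auto
  also have "s - (s - (t' - t)) = t' - t" by simp
  also have "(t' - t) / (s - (t' - t)) \<le> (t' - t) / (s / 2)"
    using t s True by (intro divide_left_mono) auto
  also have "(t' - t) / (s / 2) = 2 / s * (t' - t)" by simp
  finally show ?thesis by simp
next
  case False
  then have "1 \<le> 2 / s * (t' - t)" using s by (simp add: field_simps)
  then show ?thesis using prob_le_1[of "no_jump t s"] measure_nonneg[of P "no_jump t' s"] by linarith
qed

section \<open>Laplace transform in time and the killed chain\<close>

lemma occupation_measurable [measurable]: "occupation k x \<in> borel_measurable borel"
proof -
  \<comment> \<open>Measurability in t holds because the occupation probability is a difference of
    two monotone functions.\<close>
  define G where "G j t = prob (path k x \<inter> {w \<in> space P. clock j w \<le> t})" for j t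
  have Gm: "G j \<in> borel_measurable borel" for j
  proof (rule borel_measurable_mono, rule monoI)
    fix t t' :: real assume "t \<le> t'"
    then show "G j t \<le> G j t'" unfolding G_def by (intro finite_measure_mono) auto
  qed
  have "occupation k x t = G k t - G (Suc k) t" for t
  proof -
    have "path k x \<inter> {w \<in> space P. clock k w \<le> t \<and> t < clock (Suc k) w} =
        (path k x \<inter> {w \<in> space P. clock k w \<le> t}) - (path k x \<inter> {w \<in> space P. clock (Suc k) w \<le> t})"
      by auto
    moreover have "path k x \<inter> {w \<in> space P. clock (Suc k) w \<le> t} \<subseteq> path k x \<inter> {w \<in> space P. clock k w \<le> t}"
      using clock_strict[of _ k] by fastforce
    ultimately show ?thesis
      unfolding occupation_def G_def by (simp add: finite_measure_Diff)
  qed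
  then have "occupation k x = (\<lambda>t. G k t - G (Suc k) t)" by auto
  then show ?thesis using Gm by simp
qed

lemma no_jump_measurable:
  assumes s: "0 < s" shows "(\<lambda>t. prob (no_jump t s)) \<in> borel_measurable borel"
proof -
  have "(\<lambda>t. prob (no_jump t s)) = (\<lambda>t. \<Sum>k. \<Sum>x\<in>paths k. exp (- r (x k) * s) * occupation k x t)"
    using no_jump_sums[OF s] by (auto simp: sums_iff)
  also have "\<dots> \<in> borel_measurable borel" by measurable
  finally show ?thesis .
qed

lemma nn_integral_exp_interval:
  assumes l: "0 < l" and ab: "(a::real) \<le> b"
  shows "(\<integral>\<^sup>+t. ennreal (if a \<le> t \<and> t < b then exp (- l * t) else 0) \<partial>lborel) = ennreal ((exp (- l * a) - exp (- l * b)) / l)"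
proof -
  have "(\<integral>\<^sup>+t. ennreal (if a \<le> t \<and> t < b then exp (- l * t) else 0) \<partial>lborel) =
     (\<integral>\<^sup>+t. ennreal (exp (- l * t)) * indicator {a..b} t \<partial>lborel)"
    using AE_lborel_singleton[of b]
    by (intro nn_integral_cong_AE) (auto elim!: eventually_mono split: split_indicator)
  also have "\<dots> = ennreal (- exp (- l * b) / l - (- exp (- l * a) / l))"
    by (rule nn_integral_FTC_Icc[where F="\<lambda>t. - exp (- l * t) / l"])
       (use l ab in \<open>auto intro!: derivative_eq_intros simp: field_simps\<close>)
  also have "- exp (- l * b) / l - (- exp (- l * a) / l) = (exp (- l * a) - exp (- l * b)) / l"
    by (simp add: diff_divide_distrib)
  finally show ?thesis .
qed

text \<open>Integrating exp (- l t) over the k-th holding period gives a product of functions of the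
  individual holding times, independent given the path. Each completed stay contributes its
  transform r / (l + r), the current one 1 / (l + r).\<close>

lemma occupation_laplace:
  assumes x: "\<And>i. i \<le> k \<Longrightarrow> x i \<in> V" and l: "0 < l"
  shows "(\<integral>\<^sup>+t. ennreal (indicator {0..} t * exp (- l * t) * occupation k x t) \<partial>lborel) =
    ennreal (weight k x * (\<Prod>i<k. r (x i) / (l + r (x i))) * (1 / (l + r (x k))))"
proof -
  let ?f = "\<lambda>w t. if clock k w \<le> t \<and> t < clock (Suc k) w then exp (- l * t) else 0"
  \<comment> \<open>One family indexed up to k, with a different last member, so that independence
    is applied once to the whole product.\<close>
  let ?g = "\<lambda>i w. if i < k then ennreal (exp (- l * T i w)) else ennreal (1 - exp (- l * T i w))"
  let ?S = "\<lambda>t. {w \<in> space P. clock k w \<le> t \<and> t < clock (Suc k) w}"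
  have pp: "prob (path k x) = weight k x" by (rule prob_path) (rule x)
  have wnn: "0 \<le> weight k x" using pp by (metis measure_nonneg)
  show ?thesis
  proof (cases "weight k x = 0")
    case True
    then have "occupation k x t = 0" for t
      using pp finite_measure_mono[of "path k x \<inter> (?S t)" "path k x"]
        occupation_nonneg[of k x t] by (auto simp: occupation_def measure_le_0_iff)
    then show ?thesis using True by simp
  next
    case False
    then have pos: "0 < weight k x" using wnn by simp
    interpret Q: prob_space "cond k x" by (rule cond_prob_space[OF x pos])
    have e0: "emeasure P (path k x) \<noteq> 0" "emeasure P (path k x) \<noteq> \<infinity>"
      using pos pp by (auto simp: emeasure_eq_measure)
    have dk: "distributed (cond k x) lborel (T i) (exponential_density (r (x i)))" if "i \<le> k" for i
      by (rule cond_exponential[OF x pos that])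
    have ind: "Q.indep_vars (\<lambda>_. borel) T {..k}" by (rule cond_indep[OF x pos])
    have cm[measurable]: "clock j \<in> borel_measurable (cond k x)" for j by simp
    have occ: "ennreal (indicator {0..} t * exp (- l * t) * occupation k x t) =
        ennreal (weight k x) * (\<integral>\<^sup>+w. ennreal (?f w t) \<partial>cond k x)" for t
    proof (cases "0 \<le> t")
      case True
      have m: "(?S t) \<in> sets P" by measurable
      have "occupation k x t = weight k x * Q.prob (?S t)"
        unfolding occupation_def using measure_uniform_measure[OF e0 m] pp pos by simp
      moreover have "(\<integral>\<^sup>+w. ennreal (?f w t) \<partial>cond k x) =
        (\<integral>\<^sup>+w. ennreal (exp (- l * t)) * indicator (?S t) w \<partial>cond k x)"
        by (intro nn_integral_cong) (auto split: split_indicator)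
      moreover have "\<dots> = ennreal (exp (- l * t)) * ennreal (Q.prob (?S t))"
        using m by (simp add: nn_integral_cmult_indicator Q.emeasure_eq_measure)
      ultimately show ?thesis using True wnn by (simp add: ennreal_mult[symmetric] mult_ac)
    next
      case False
      have "(\<integral>\<^sup>+w. ennreal (?f w t) \<partial>cond k x) = (\<integral>\<^sup>+w. 0 \<partial>cond k x)"
      proof (rule nn_integral_cong)
        fix w assume "w \<in> space (cond k x)"
        then have "0 \<le> clock k w" using clock_mono[of w 0 k] by (simp add: clock_def)
        then show "ennreal (?f w t) = 0" using False by auto
      qed
      then show ?thesis using False by simp
    qed
    interpret QL: pair_sigma_finite "cond k x" lborel ..
    have "(\<integral>\<^sup>+t. ennreal (indicator {0..} t * exp (- l * t) * occupation k x t) \<partial>lborel) =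
       ennreal (weight k x) * (\<integral>\<^sup>+t. \<integral>\<^sup>+w. ennreal (?f w t) \<partial>cond k x \<partial>lborel)"
      unfolding occ by (rule nn_integral_cmult) measurable
    also have "(\<integral>\<^sup>+t. \<integral>\<^sup>+w. ennreal (?f w t) \<partial>cond k x \<partial>lborel) =
       (\<integral>\<^sup>+w. \<integral>\<^sup>+t. ennreal (?f w t) \<partial>lborel \<partial>cond k x)"
      by (rule QL.Fubini') measurable
    also have "\<dots> = (\<integral>\<^sup>+w. ennreal (1 / l) * (\<Prod>i\<in>{..k}. ?g i w) \<partial>cond k x)"
    proof (rule nn_integral_cong)
      fix w assume "w \<in> space (cond k x)"
      then have w: "w \<in> space P" by simp
      have "(\<integral>\<^sup>+t. ennreal (?f w t) \<partial>lborel) =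
         ennreal ((exp (- l * clock k w) - exp (- l * clock (Suc k) w)) / l)"
        using clock_strict[OF w, of k] by (intro nn_integral_exp_interval l) simp
      also have "(exp (- l * clock k w) - exp (- l * clock (Suc k) w)) / l = 1 / l * (exp (- l * clock k w) * (1 - exp (- l * T k w)))"
      proof -
        have "exp (- l * clock (Suc k) w) = exp (- l * clock k w) * exp (- l * T k w)"
          by (simp add: clock_Suc exp_add[symmetric] algebra_simps)
        then show ?thesis using l by (simp add: field_simps)
      qed
      also have "exp (- l * clock k w) = (\<Prod>i<k. exp (- l * T i w))"
        unfolding clock_def by (simp add: sum_distrib_left exp_sum)
      also have "ennreal (1 / l * ((\<Prod>i<k. exp (- l * T i w)) * (1 - exp (- l * T k w)))) =
         ennreal (1 / l) * ((\<Prod>i<k. ennreal (exp (- l * T i w))) * ennreal (1 - exp (- l * T k w)))"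
      proof -
        have A: "0 \<le> (\<Prod>i<k. exp (- l * T i w))" by (intro prod_nonneg) simp
        have B: "0 \<le> 1 - exp (- l * T k w)" using l T_pos[OF w, of k] by simp
        have "(\<Prod>i<k. ennreal (exp (- l * T i w))) = ennreal (\<Prod>i<k. exp (- l * T i w))"
          by (rule prod_ennreal) simp
        moreover have "0 \<le> 1 / l" using l by simp
        ultimately show ?thesis using A B by (simp only: ennreal_mult mult_nonneg_nonneg)
      qed
      also have "(\<Prod>i<k. ennreal (exp (- l * T i w))) * ennreal (1 - exp (- l * T k w)) =
         (\<Prod>i\<in>{..k}. ?g i w)"
      proof -
        have "{..k} = insert k {..<k}" by auto
        then have "(\<Prod>i\<in>{..k}. ?g i w) =
          ennreal (1 - exp (- l * T k w)) * (\<Prod>i\<in>{..<k}. ?g i w)"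
          by (simp only:) (subst prod.insert, simp_all)
        also have "(\<Prod>i\<in>{..<k}. ?g i w) = (\<Prod>i<k. ennreal (exp (- l * T i w)))"
          by (rule prod.cong) auto
        finally show ?thesis by (simp add: mult.commute)
      qed
      finally show "(\<integral>\<^sup>+t. ennreal (?f w t) \<partial>lborel) =
         ennreal (1 / l) * (\<Prod>i\<in>{..k}. ?g i w)" .
    qed
    also have "\<dots> = ennreal (1 / l) * (\<integral>\<^sup>+w. (\<Prod>i\<in>{..k}. ?g i w) \<partial>cond k x)"
      by (rule nn_integral_cmult) measurable
    also have "(\<integral>\<^sup>+w. (\<Prod>i\<in>{..k}. ?g i w) \<partial>cond k x) =
       (\<Prod>i\<in>{..k}. \<integral>\<^sup>+w. (?g i w) \<partial>cond k x)"
    proof (rule Q.indep_vars_nn_integral)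
      show "Q.indep_vars (\<lambda>_. borel) (\<lambda>i w. ?g i w) {..k}"
        by (rule Q.indep_vars_compose2[OF ind, of "\<lambda>i y. if i < k then ennreal (exp (- l * y)) else ennreal (1 - exp (- l * y))"]) measurable
    qed auto
    also have "\<dots> = (\<Prod>i\<in>{..k}. if i < k then ennreal (r (x i) / (l + r (x i))) else ennreal (l / (l + r (x i))))"
      by (rule prod.cong[OF refl]) (use Q.nn_integral_exponential[OF dk rate_pos[OF x] l] in auto)
    also have "\<dots> = (\<Prod>i<k. ennreal (r (x i) / (l + r (x i)))) * ennreal (l / (l + r (x k)))"
    proof -
      have "{..k} = insert k {..<k}" by auto
      then have "(\<Prod>i\<in>{..k}. if i < k then ennreal (r (x i) / (l + r (x i))) else ennreal (l / (l + r (x i)))) =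
        ennreal (l / (l + r (x k))) * (\<Prod>i\<in>{..<k}. if i < k then ennreal (r (x i) / (l + r (x i))) else ennreal (l / (l + r (x i))))"
        by (simp only:) (subst prod.insert, simp_all)
      also have "(\<Prod>i\<in>{..<k}. if i < k then ennreal (r (x i) / (l + r (x i))) else ennreal (l / (l + r (x i)))) = (\<Prod>i<k. ennreal (r (x i) / (l + r (x i))))"
        by (rule prod.cong) auto
      finally show ?thesis by (simp add: mult.commute)
    qed
    also have "(\<Prod>i<k. ennreal (r (x i) / (l + r (x i)))) = ennreal (\<Prod>i<k. r (x i) / (l + r (x i)))"
      using l rate_pos[OF x] by (intro prod_ennreal) (simp add: less_imp_le add_pos_pos)
    also have "ennreal (weight k x) * (ennreal (1 / l) * (ennreal (\<Prod>i<k. r (x i) / (l + r (x i))) * ennreal (l / (l + r (x k))))) =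
      ennreal (weight k x * (\<Prod>i<k. r (x i) / (l + r (x i))) * (1 / (l + r (x k))))"
    proof -
      have "0 \<le> (\<Prod>i<k. r (x i) / (l + r (x i)))" using l rate_pos[OF x] by (intro prod_nonneg) (simp add: less_imp_le add_pos_pos)
      moreover have "0 < l + r (x k)" using l rate_pos[OF x] by (simp add: add_pos_pos)
      ultimately show ?thesis using wnn l by (simp add: ennreal_mult[symmetric])
    qed
    finally show ?thesis .
  qed
qed

text \<open>One step of the walk that is killed at \<open>x\<close> with probability l / (l + r x):
  the factor in front is the probability of surviving.\<close>

definition step_op :: "real \<Rightarrow> ('a \<Rightarrow> real) \<Rightarrow> 'a \<Rightarrow> real" where
  "step_op l u x = r x / (l + r x) * (\<Sum>y\<in>V. K x y * u y)"

lemma sum_paths_Suc: "(\<Sum>x\<in>paths (Suc k). F x) = (\<Sum>x\<in>paths k. \<Sum>y\<in>V. F (x(Suc k := y)))"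
proof -
  have "{..Suc k} = insert (Suc k) {..k}" by auto
  then have "paths (Suc k) = (\<lambda>(y, g). g(Suc k := y)) ` (V \<times> paths k)"
    using PiE_insert_eq[of "Suc k" "{..k}" "\<lambda>_. V"] by simp
  moreover have "inj_on (\<lambda>(y, g). g(Suc k := y)) (V \<times> paths k)"
    using inj_combinator[of "Suc k" "{..k}" "\<lambda>_. V"] by simp
  ultimately have "(\<Sum>x\<in>paths (Suc k). F x) = (\<Sum>(y, g)\<in>V \<times> paths k. F (g(Suc k := y)))"
    by (simp add: sum.reindex case_prod_unfold)
  also have "\<dots> = (\<Sum>y\<in>V. \<Sum>g\<in>paths k. F (g(Suc k := y)))"
    by (rule sum.cartesian_product[symmetric])
  also have "\<dots> = (\<Sum>g\<in>paths k. \<Sum>y\<in>V. F (g(Suc k := y)))" by (rule sum.swap)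
  finally show ?thesis .
qed

text \<open>The last step of the path is absorbed into the terminal function, which is therefore
  arbitrary in the induction.\<close>

lemma sum_paths_weight:
  "(\<Sum>x\<in>paths k. weight k x * (\<Prod>i<k. r (x i) / (l + r (x i))) * \<psi> (x k)) = (\<Sum>x\<in>V. p x * (step_op l ^^ k) \<psi> x)"
proof (induction k arbitrary: \<psi>)
  case 0
  have "(\<Sum>x\<in>paths 0. weight 0 x * (\<Prod>i<0. r (x i) / (l + r (x i))) * \<psi> (x 0)) = (\<Sum>y\<in>V. p y * \<psi> y)"
    by (rule sum.reindex_bij_witness[where j="\<lambda>x. x 0" and i="\<lambda>y. \<lambda>i\<in>{..0}. y"])
       (auto simp: weight_def PiE_iff extensional_def fun_eq_iff)
  then show ?case by simp
next
  case (Suc k)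
  have "(\<Sum>x\<in>paths (Suc k). weight (Suc k) x * (\<Prod>i<Suc k. r (x i) / (l + r (x i))) * \<psi> (x (Suc k))) =
     (\<Sum>x\<in>paths k. weight k x * (\<Prod>i<k. r (x i) / (l + r (x i))) * step_op l \<psi> (x k))"
    unfolding sum_paths_Suc
  proof (rule sum.cong[OF refl])
    fix x assume "x \<in> paths k"
    have e1: "weight (Suc k) (x(Suc k := y)) = weight k x * K (x k) y" for y
    proof -
      have "(\<Prod>i<k. K ((x(Suc k := y)) i) ((x(Suc k := y)) (Suc i))) = (\<Prod>i<k. K (x i) (x (Suc i)))"
        by (rule prod.cong) auto
      then show ?thesis by (simp add: weight_def)
    qed
    have e2: "(\<Prod>i<Suc k. r ((x(Suc k := y)) i) / (l + r ((x(Suc k := y)) i))) = (\<Prod>i<Suc k. r (x i) / (l + r (x i)))" for y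
      by (rule prod.cong) auto
    show "(\<Sum>y\<in>V. weight (Suc k) (x(Suc k := y)) * (\<Prod>i<Suc k. r ((x(Suc k := y)) i) / (l + r ((x(Suc k := y)) i))) * \<psi> ((x(Suc k := y)) (Suc k))) =
       weight k x * (\<Prod>i<k. r (x i) / (l + r (x i))) * step_op l \<psi> (x k)"
      unfolding e1 e2 by (simp add: step_op_def sum_distrib_left sum_divide_distrib mult_ac)
  qed
  also have "\<dots> = (\<Sum>x\<in>V. p x * (step_op l ^^ k) (step_op l \<psi>) x)" by (rule Suc.IH)
  finally show ?case by (simp only: funpow_Suc_right o_apply)
qed

text \<open>The killed walk: it is stopped at \<open>x\<close> with probability \<open>l / (l + r x)\<close>, and \<open>u x\<close> is the expectation
  of \<open>exp (- s r)\<close> at the stopping site when the walk starts at \<open>x\<close>.\<close>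

lemma no_jump_laplace:
  assumes s: "0 < s" and l: "0 < l"
  obtains u where "\<And>x. x \<in> V \<Longrightarrow> 0 \<le> u x" "\<And>x. x \<in> V \<Longrightarrow> u x \<le> 1"
    and "\<And>x. x \<in> V \<Longrightarrow> u x = l / (l + r x) * exp (- r x * s) + (1 - l / (l + r x)) * (\<Sum>y\<in>V. K x y * u y)"
    and "(\<integral>\<^sup>+t. ennreal (indicator {0..} t * exp (- l * t) * prob (no_jump t s)) \<partial>lborel) = ennreal ((\<Sum>x\<in>V. p x * u x) / l)"
proof -
  let ?F = "\<lambda>k x t. indicator {0..} t * exp (- l * t) * occupation k x t"
  let ?G = "\<lambda>t. indicator {0..} t * exp (- l * t) * prob (no_jump t s)"
  define \<psi> where "\<psi> x = l / (l + r x) * exp (- r x * s)" for x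
  define a where "a k = (step_op l ^^ k) \<psi>" for k
  \<comment> \<open>The Neumann series of the killed walk, with \<open>a k x\<close> the
    contribution of being killed after k steps.\<close>
  define u where "u x = (\<Sum>k. a k x)" for x
  have lr: "0 < l + r x" if "x \<in> V" for x using rate_pos[OF that] l by simp
  have a0: "a 0 = \<psi>" and aS: "a (Suc k) = step_op l (a k)" for k by (simp_all add: a_def)
  have a_nonneg: "0 \<le> a k x" if "x \<in> V" for k x
    using that
  proof (induction k arbitrary: x)
    case 0 then show ?case using l lr[of x] by (simp add: a0 \<psi>_def)
  next
    case (Suc k)
    then show ?case unfolding aS step_op_def
      using rate_pos[of x] lr[of x] K_nonneg by (intro mult_nonneg_nonneg sum_nonneg) auto
  qed
  have step_sum: "(\<Sum>k<m. step_op l (a k) x) = step_op l (\<lambda>y. \<Sum>k<m. a k y) x" for m x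
    unfolding step_op_def sum_distrib_left by (subst sum.swap) simp
  \<comment> \<open>Killing within finitely many steps has probability at most 1; in the induction l
    / (l + r) and r / (l + r) add up to 1.\<close>
  have partial: "(\<Sum>k<m. a k x) \<le> 1" if "x \<in> V" for m x
    using that
  proof (induction m arbitrary: x)
    case 0 then show ?case by simp
  next
    case (Suc m)
    have "(\<Sum>k<Suc m. a k x) = \<psi> x + step_op l (\<lambda>y. \<Sum>k<m. a k y) x"
      by (subst sum.lessThan_Suc_shift) (simp add: a0 aS step_sum)
    also have "\<dots> \<le> l / (l + r x) * 1 + r x / (l + r x) * 1"
      unfolding step_op_def \<psi>_def
    proof (intro add_mono mult_left_mono)
      have "(\<Sum>y\<in>V. K x y * (\<Sum>k<m. a k y)) \<le> (\<Sum>y\<in>V. K x y * 1)"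
        using Suc K_nonneg by (intro sum_mono mult_left_mono) auto
      then show "(\<Sum>y\<in>V. K x y * (\<Sum>k<m. a k y)) \<le> 1" using K_sum[OF Suc.prems] by simp
    qed (use l s lr[OF Suc.prems] rate_pos[OF Suc.prems] in auto)
    also have "\<dots> = 1" using lr[OF Suc.prems] by (simp add: add_divide_distrib[symmetric])
    finally show ?case .
  qed
  have summ: "summable (\<lambda>k. a k x)" if "x \<in> V" for x
    by (rule summableI_nonneg_bounded[of _ 1]) (use a_nonneg partial that in auto)
  have u0: "0 \<le> u x" if "x \<in> V" for x unfolding u_def using summ a_nonneg that by (intro suminf_nonneg) auto
  have u1: "u x \<le> 1" if "x \<in> V" for x unfolding u_def using summ partial that by (intro suminf_le_const) auto
  have ueq: "u x = l / (l + r x) * exp (- r x * s) + (1 - l / (l + r x)) * (\<Sum>y\<in>V. K x y * u y)" if x: "x \<in> V" for x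
  proof -
    have "u x = \<psi> x + (\<Sum>k. a (Suc k) x)"
      unfolding u_def using suminf_split_head[OF summ[OF x]] by (simp add: a0)
    also have "(\<Sum>k. a (Suc k) x) = r x / (l + r x) * (\<Sum>y\<in>V. K x y * u y)"
    proof (rule sums_unique[symmetric])
      show "(\<lambda>k. a (Suc k) x) sums (r x / (l + r x) * (\<Sum>y\<in>V. K x y * u y))"
        unfolding aS step_op_def u_def
        using summ by (intro sums_mult sums_sum summable_sums) auto
    qed
    also have "r x / (l + r x) = 1 - l / (l + r x)" using lr[OF x] by (simp add: field_simps)
    finally show ?thesis by (simp add: \<psi>_def)
  qed
  have "(\<integral>\<^sup>+t. ennreal (?G t) \<partial>lborel) =
     (\<integral>\<^sup>+t. (\<Sum>k. \<Sum>x\<in>paths k. ennreal (exp (- r (x k) * s)) * ennreal (?F k x t)) \<partial>lborel)"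
  proof (rule nn_integral_cong)
    fix t
    have "(\<lambda>k. \<Sum>x\<in>paths k. exp (- r (x k) * s) * (?F k x t)) sums
       (?G t)"
      using sums_mult[OF no_jump_sums[OF s, of t], of "indicator {0..} t * exp (- l * t)"]
      by (simp add: sum_distrib_left mult_ac)
    then have "(\<Sum>k. ennreal (\<Sum>x\<in>paths k. exp (- r (x k) * s) * (?F k x t))) =
       ennreal (?G t)"
      by (intro suminf_ennreal_eq sum_nonneg mult_nonneg_nonneg) (auto simp: occupation_nonneg)
    moreover have "ennreal (\<Sum>x\<in>paths k. exp (- r (x k) * s) * (?F k x t)) =
      (\<Sum>x\<in>paths k. ennreal (exp (- r (x k) * s)) * ennreal (?F k x t))" for k
      by (subst sum_ennreal[symmetric]) (auto simp: occupation_nonneg ennreal_mult' intro!: sum.cong)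
    ultimately show "ennreal (?G t) =
       (\<Sum>k. \<Sum>x\<in>paths k. ennreal (exp (- r (x k) * s)) * ennreal (?F k x t))"
      by simp
  qed
  also have "\<dots> = (\<Sum>k. \<integral>\<^sup>+t. (\<Sum>x\<in>paths k. ennreal (exp (- r (x k) * s)) * ennreal (?F k x t)) \<partial>lborel)"
    by (rule nn_integral_suminf) measurable
  also have "\<dots> = (\<Sum>k. ennreal ((\<Sum>x\<in>V. p x * a k x) / l))"
  proof (rule suminf_cong)
    fix k
    have "(\<integral>\<^sup>+t. (\<Sum>x\<in>paths k. ennreal (exp (- r (x k) * s)) * ennreal (?F k x t)) \<partial>lborel) =
       (\<Sum>x\<in>paths k. \<integral>\<^sup>+t. ennreal (exp (- r (x k) * s)) * ennreal (?F k x t) \<partial>lborel)"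
      by (rule nn_integral_sum) measurable
    also have "\<dots> = (\<Sum>x\<in>paths k. ennreal (weight k x * (\<Prod>i<k. r (x i) / (l + r (x i))) * \<psi> (x k) / l))"
    proof (rule sum.cong[OF refl])
      fix x assume "x \<in> paths k"
      then have x: "x i \<in> V" if "i \<le> k" for i using that by auto
      have "(\<integral>\<^sup>+t. ennreal (exp (- r (x k) * s)) * ennreal (?F k x t) \<partial>lborel) =
         ennreal (exp (- r (x k) * s)) * (\<integral>\<^sup>+t. ennreal (?F k x t) \<partial>lborel)"
        by (rule nn_integral_cmult) measurable
      also have "(\<integral>\<^sup>+t. ennreal (?F k x t) \<partial>lborel) =
          ennreal (weight k x * (\<Prod>i<k. r (x i) / (l + r (x i))) * (1 / (l + r (x k))))"
        by (rule occupation_laplace[OF _ l]) (rule x)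
      finally show "(\<integral>\<^sup>+t. ennreal (exp (- r (x k) * s)) * ennreal (?F k x t) \<partial>lborel) =
         ennreal (weight k x * (\<Prod>i<k. r (x i) / (l + r (x i))) * \<psi> (x k) / l)"
        using l by (simp add: ennreal_mult'[symmetric] \<psi>_def mult_ac)
    qed
    also have "\<dots> = ennreal (\<Sum>x\<in>paths k. weight k x * (\<Prod>i<k. r (x i) / (l + r (x i))) * \<psi> (x k) / l)"
    proof (rule sum_ennreal)
      fix x assume "x \<in> paths k"
      then have x: "x i \<in> V" if "i \<le> k" for i using that by auto
      have "prob (path k x) = weight k x" by (rule prob_path) (rule x)
      then have "0 \<le> weight k x" by (metis measure_nonneg)
      moreover have "0 \<le> (\<Prod>i<k. r (x i) / (l + r (x i)))"
        using lr x rate_pos by (intro prod_nonneg) (auto simp: less_imp_le)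
      moreover have "0 \<le> \<psi> (x k)" using a_nonneg[OF x[OF order_refl], of 0] by (simp add: a0)
      ultimately show "0 \<le> weight k x * (\<Prod>i<k. r (x i) / (l + r (x i))) * \<psi> (x k) / l" using l by simp
    qed
    also have "(\<Sum>x\<in>paths k. weight k x * (\<Prod>i<k. r (x i) / (l + r (x i))) * \<psi> (x k) / l) = (\<Sum>x\<in>V. p x * a k x) / l"
      unfolding sum_divide_distrib[symmetric] sum_paths_weight a_def ..
    finally show "(\<integral>\<^sup>+t. (\<Sum>x\<in>paths k. ennreal (exp (- r (x k) * s)) * ennreal (?F k x t)) \<partial>lborel) =
       ennreal ((\<Sum>x\<in>V. p x * a k x) / l)" .
  qed
  also have "\<dots> = ennreal ((\<Sum>x\<in>V. p x * u x) / l)"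
  proof (rule suminf_ennreal_eq)
    show "0 \<le> (\<Sum>x\<in>V. p x * a k x) / l" for k
      using l a_nonneg p_nonneg by (intro divide_nonneg_nonneg sum_nonneg mult_nonneg_nonneg) auto
    show "(\<lambda>k. (\<Sum>x\<in>V. p x * a k x) / l) sums ((\<Sum>x\<in>V. p x * u x) / l)"
      unfolding u_def using summ by (intro sums_divide sums_sum sums_mult summable_sums) auto
  qed
  finally show ?thesis using that[of u] u0 u1 ueq by blast
qed

section \<open>From the jump chain to the observed process\<close>

lemma prob_stay_0:
  assumes K0: "\<And>x. x \<in> V \<Longrightarrow> K x x = 0"
  shows "AE w in P. \<forall>k. J (Suc k) w \<noteq> J k w"
proof (subst AE_all_countable, rule allI)
  fix k
  have m: "{w \<in> space P. J (Suc k) w = J k w} \<in> sets P"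
  proof -
    have "{w \<in> space P. J (Suc k) w = J k w} = (\<Union>y\<in>V. {w \<in> space P. J (Suc k) w = y} \<inter> {w \<in> space P. J k w = y})"
      using J_in by auto
    then show ?thesis using finite_V J_eq_sets by auto
  qed
  have "prob (path (Suc k) x \<inter> {w \<in> space P. J (Suc k) w = J k w}) = 0" if x: "x \<in> paths (Suc k)" for x
  proof (cases "x (Suc k) = x k")
    case True
    have xV: "x i \<in> V" if "i \<le> Suc k" for i using x that by auto
    have "prob (path (Suc k) x) = weight (Suc k) x" by (rule prob_path) (rule xV)
    also have "\<dots> = 0" using True K0[OF xV[of k]] by (simp add: weight_def)
    finally show ?thesis
      using finite_measure_mono[of "path (Suc k) x \<inter> {w \<in> space P. J (Suc k) w = J k w}" "path (Suc k) x"]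
      by (simp add: measure_le_0_iff)
  next
    case False
    then have "path (Suc k) x \<inter> {w \<in> space P. J (Suc k) w = J k w} = {}" by (auto simp: path_def)
    then show ?thesis by simp
  qed
  then have "prob {w \<in> space P. J (Suc k) w = J k w} = 0"
    using prob_eq_sum_paths[OF m, of "Suc k"] by simp
  then show "AE w in P. J (Suc k) w \<noteq> J k w"
    using m by (intro AE_I[where N="{w \<in> space P. J (Suc k) w = J k w}"]) (auto simp: emeasure_eq_measure)
qed

text \<open>Consecutive states differ almost surely, so constancy of the path detects the absence of
  jumps. The condition over uncountably many times is first rewritten as the countable condition
  \<open>?F\<close> on chain and clock, which makes the event measurable.\<close>

lemma prob_constant_path:
  assumes K0: "\<And>x. x \<in> V \<Longrightarrow> K x x = 0"
    and X: "\<And>w k u. w \<in> space P \<Longrightarrow> clock k w \<le> u \<Longrightarrow> u < clock (Suc k) w \<Longrightarrow> X u w = J k w"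
    and t: "0 \<le> t" and s: "0 < s"
  shows "prob {w \<in> space P. \<forall>u. t \<le> u \<and> u < t + s \<longrightarrow> X u w = X t w} = prob (no_jump t s)"
proof -
  let ?E = "{w \<in> space P. \<forall>u. t \<le> u \<and> u < t + s \<longrightarrow> X u w = X t w}"
  let ?F = "{w \<in> space P. \<forall>k j. clock k w \<le> t \<and> t < clock (Suc k) w \<and> k \<le> j \<and> clock j w < t + s \<longrightarrow> J j w = J k w}"
  have EF: "?E = ?F"
  proof (rule Collect_cong, rule conj_cong[OF refl])
    fix w assume w: "w \<in> space P"
    obtain k where k: "clock k w \<le> t" "t < clock (Suc k) w" by (rule clock_interval_exists[OF w t])
    have Xt: "X t w = J k w" by (rule X[OF w k])
    show "(\<forall>u. t \<le> u \<and> u < t + s \<longrightarrow> X u w = X t w) =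
      (\<forall>k j. clock k w \<le> t \<and> t < clock (Suc k) w \<and> k \<le> j \<and> clock j w < t + s \<longrightarrow> J j w = J k w)"
    proof (intro iffI allI impI)
      fix k' j assume a: "\<forall>u. t \<le> u \<and> u < t + s \<longrightarrow> X u w = X t w"
        and b: "clock k' w \<le> t \<and> t < clock (Suc k') w \<and> k' \<le> j \<and> clock j w < t + s"
      have kk: "k' = k" using clock_interval_unique[OF w _ _ k] b by blast
      show "J j w = J k' w"
      proof (cases "j = k'")
        case False
        then have "Suc k' \<le> j" using b by linarith
        then have "clock (Suc k') w \<le> clock j w" by (rule clock_mono[OF w])
        \<comment> \<open>Constancy is tested at the jump time \<open>clock j w\<close>, where the
          process takes the value \<open>J j w\<close>.\<close>
        then have "t \<le> clock j w \<and> clock j w < t + s" using b by linarith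
        then have "X (clock j w) w = X t w" using a by blast
        moreover have "X (clock j w) w = J j w" by (rule X[OF w order_refl clock_strict[OF w]])
        ultimately show ?thesis using Xt kk by simp
      qed simp
    next
      fix u assume a: "\<forall>k j. clock k w \<le> t \<and> t < clock (Suc k) w \<and> k \<le> j \<and> clock j w < t + s \<longrightarrow> J j w = J k w"
        and u: "t \<le> u \<and> u < t + s"
      obtain j where j: "clock j w \<le> u" "u < clock (Suc j) w" by (rule clock_interval_exists[OF w, of u]) (use t u in auto)
      have "k \<le> j"
      proof (rule ccontr)
        assume "\<not> k \<le> j"
        then have "clock (Suc j) w \<le> clock k w" by (intro clock_mono[OF w]) auto
        then show False using j k u by linarith
      qed
      then have "J j w = J k w" using a k j u by auto
      then show "X u w = X t w" using X[OF w j] Xt by simp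
    qed
  qed
  have Jm: "{w \<in> space P. J j w = J k w} \<in> sets P" for j k
  proof -
    have "{w \<in> space P. J j w = J k w} = (\<Union>y\<in>V. {w \<in> space P. J j w = y} \<inter> {w \<in> space P. J k w = y})"
      using J_in by auto
    then show ?thesis using finite_V J_eq_sets by auto
  qed
  have Fm: "?F \<in> sets P"
  proof (intro sets.sets_Collect_countable_All)
    fix k j
    have "{w \<in> space P. clock k w \<le> t \<and> t < clock (Suc k) w \<and> k \<le> j \<and> clock j w < t + s} \<in> sets P" by measurable
    from sets.sets_Collect_imp[OF Jm this]
    show "{w \<in> space P. clock k w \<le> t \<and> t < clock (Suc k) w \<and> k \<le> j \<and> clock j w < t + s \<longrightarrow> J j w = J k w} \<in> sets P" .
  qed
  have stay: "AE w in P. \<forall>k. J (Suc k) w \<noteq> J k w" by (rule prob_stay_0) (rule K0)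
  have "AE w in P. w \<in> ?F \<longleftrightarrow> w \<in> no_jump t s"
    using stay AE_space
  proof eventually_elim
    case (elim w)
    note w = \<open>w \<in> space P\<close>
    obtain k where k: "clock k w \<le> t" "t < clock (Suc k) w" by (rule clock_interval_exists[OF w t])
    show ?case
    proof
      assume F: "w \<in> ?F"
      have "t + s \<le> clock (Suc k) w"
      proof (rule ccontr)
        assume "\<not> t + s \<le> clock (Suc k) w"
        then have "clock (Suc k) w < t + s" by linarith
        moreover have "k \<le> Suc k" by simp
        ultimately have "J (Suc k) w = J k w" using F k by blast
        then show False using elim(1) by blast
      qed
      then show "w \<in> no_jump t s" unfolding no_jump_def using w k by blast
    next
      assume "w \<in> no_jump t s"
      then obtain i where i: "clock i w \<le> t" "t + s \<le> clock (Suc i) w" by (auto simp: no_jump_def)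
      have jk: "j = k'" if a: "clock k' w \<le> t" "t < clock (Suc k') w" "k' \<le> j" "clock j w < t + s" for k' j
      proof -
        have "k' = i" using clock_interval_unique[OF w a(1,2) i(1)] i(2) s by linarith
        moreover have "\<not> Suc i \<le> j" using clock_mono[OF w, of "Suc i" j] i a by linarith
        ultimately show ?thesis using a by linarith
      qed
      show "w \<in> ?F"
      proof (intro CollectI conjI w allI impI, elim conjE)
        fix k' j assume "clock k' w \<le> t" "t < clock (Suc k') w" "k' \<le> j" "clock j w < t + s"
        then have "j = k'" by (rule jk)
        then show "J j w = J k' w" by simp
      qed
    qed
  qed
  then show ?thesis unfolding EF by (rule measure_eq_AE[OF _ Fm no_jump_sets])
qed

end

section \<open>Gaussian traps\<close>

text \<open>What remains of a Gaussian expectation after recentring at a high level: the density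
  becomes an exponential tilt with a quadratic correction that disappears in the limit.\<close>

definition gauss_tilt :: "real \<Rightarrow> real \<Rightarrow> (real \<Rightarrow> real) \<Rightarrow> real" where
  "gauss_tilt b \<theta> F = (\<integral>x. F x * exp (- \<theta> * x - b * x\<^sup>2) \<partial>lborel)"

text \<open>Substituting y = - (q + x) / \<beta> and expanding the square: the constant term gives
  the prefactor, the linear term the tilt q / (n \<beta>^2), the quadratic term the
  correction.\<close>

lemma (in prob_space) expectation_gaussian_tilt:
  assumes h: "distributed M lborel h (normal_density 0 (sqrt (real n)))" and n: "1 \<le> n" and \<beta>: "0 < \<beta>"
    and F[measurable]: "F \<in> borel_measurable borel"
  shows "expectation (\<lambda>\<omega>. F (- \<beta> * h \<omega> - q)) =
    exp (- q\<^sup>2 / (2 * real n * \<beta>\<^sup>2)) / (\<beta> * sqrt (2 * pi * real n))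
      * gauss_tilt (1 / (2 * real n * \<beta>\<^sup>2)) (q / (real n * \<beta>\<^sup>2)) F"
proof -
  have "expectation (\<lambda>\<omega>. F (- \<beta> * h \<omega> - q)) = (\<integral>y. normal_density 0 (sqrt (real n)) y * F (- \<beta> * y - q) \<partial>lborel)"
    by (rule distributed_integral[OF h, symmetric]) auto
  also have "\<dots> = \<bar>- 1 / \<beta>\<bar> *\<^sub>R (\<integral>x. normal_density 0 (sqrt (real n)) (- q / \<beta> + - 1 / \<beta> * x) * F (- \<beta> * (- q / \<beta> + - 1 / \<beta> * x) - q) \<partial>lborel)"
    by (rule lborel_integral_real_affine) (use \<beta> in simp)
  also have "(\<lambda>x. normal_density 0 (sqrt (real n)) (- q / \<beta> + - 1 / \<beta> * x) * F (- \<beta> * (- q / \<beta> + - 1 / \<beta> * x) - q)) =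
     (\<lambda>x. exp (- q\<^sup>2 / (2 * real n * \<beta>\<^sup>2)) / sqrt (2 * pi * real n) *
        (F x * exp (- (q / (real n * \<beta>\<^sup>2)) * x - 1 / (2 * real n * \<beta>\<^sup>2) * x\<^sup>2)))"
  proof
    fix x :: real
    have Fx: "- \<beta> * (- q / \<beta> + - 1 / \<beta> * x) - q = x" using \<beta> by (simp add: field_simps)
    have "- (- q / \<beta> + - 1 / \<beta> * x)\<^sup>2 / (2 * real n) =
       - q\<^sup>2 / (2 * real n * \<beta>\<^sup>2) + (- (q / (real n * \<beta>\<^sup>2)) * x - 1 / (2 * real n * \<beta>\<^sup>2) * x\<^sup>2)"
      using \<beta> n by (simp add: field_simps power2_eq_square)
    then have "exp (- (- q / \<beta> + - 1 / \<beta> * x)\<^sup>2 / (2 * real n)) =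
       exp (- q\<^sup>2 / (2 * real n * \<beta>\<^sup>2)) * exp (- (q / (real n * \<beta>\<^sup>2)) * x - 1 / (2 * real n * \<beta>\<^sup>2) * x\<^sup>2)"
      by (simp only: exp_add)
    then show "normal_density 0 (sqrt (real n)) (- q / \<beta> + - 1 / \<beta> * x) * F (- \<beta> * (- q / \<beta> + - 1 / \<beta> * x) - q) =
      exp (- q\<^sup>2 / (2 * real n * \<beta>\<^sup>2)) / sqrt (2 * pi * real n) *
        (F x * exp (- (q / (real n * \<beta>\<^sup>2)) * x - 1 / (2 * real n * \<beta>\<^sup>2) * x\<^sup>2))"
      unfolding Fx normal_density_def by (simp add: mult_ac)
  qed
  also have "(\<integral>x. exp (- q\<^sup>2 / (2 * real n * \<beta>\<^sup>2)) / sqrt (2 * pi * real n) *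
        (F x * exp (- (q / (real n * \<beta>\<^sup>2)) * x - 1 / (2 * real n * \<beta>\<^sup>2) * x\<^sup>2)) \<partial>lborel) =
     exp (- q\<^sup>2 / (2 * real n * \<beta>\<^sup>2)) / sqrt (2 * pi * real n) * gauss_tilt (1 / (2 * real n * \<beta>\<^sup>2)) (q / (real n * \<beta>\<^sup>2)) F"
    unfolding gauss_tilt_def by (rule integral_mult_right_zero)
  finally show ?thesis using \<beta> by simp
qed

text \<open>Dominated convergence. A tilt between \<alpha>1 and \<alpha>2 is dominated by the first
  exponential for nonnegative x and by the second for negative x, hence always by their sum.\<close>

lemma gauss_tilt_tendsto:
  assumes F[measurable]: "F \<in> borel_measurable borel" and nn: "\<And>x. 0 \<le> F x"
    and i1: "integrable lborel (\<lambda>x. F x * exp (- \<alpha>1 * x))" and i2: "integrable lborel (\<lambda>x. F x * exp (- \<alpha>2 * x))"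
    and \<alpha>: "\<alpha>1 < \<alpha>" "\<alpha> < \<alpha>2" and \<theta>: "\<theta> \<longlonglongrightarrow> \<alpha>" and b: "b \<longlonglongrightarrow> 0" and b0: "\<And>n. 0 \<le> b n"
  shows "(\<lambda>n. gauss_tilt (b n) (\<theta> n) F) \<longlonglongrightarrow> (\<integral>x. F x * exp (- \<alpha> * x) \<partial>lborel)"
proof -
  \<comment> \<open>Finitely many tilts may lie outside the window; replacing them by the limit
    makes the domination valid for every n.\<close>
  define \<theta>' where "\<theta>' n = (if \<alpha>1 \<le> \<theta> n \<and> \<theta> n \<le> \<alpha>2 then \<theta> n else \<alpha>)" for n
  have ev: "eventually (\<lambda>n. \<theta>' n = \<theta> n) sequentially"
    using order_tendstoD(1)[OF \<theta> \<alpha>(1)] order_tendstoD(2)[OF \<theta> \<alpha>(2)]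
    by eventually_elim (simp add: \<theta>'_def)
  have \<theta>': "\<theta>' \<longlonglongrightarrow> \<alpha>"
    by (rule Lim_transform_eventually[OF \<theta>]) (use ev in eventually_elim, simp)
  have bd: "\<alpha>1 \<le> \<theta>' n" "\<theta>' n \<le> \<alpha>2" for n using \<alpha> by (auto simp: \<theta>'_def)
  have "(\<lambda>n. gauss_tilt (b n) (\<theta>' n) F) \<longlonglongrightarrow> (\<integral>x. F x * exp (- \<alpha> * x) \<partial>lborel)"
    unfolding gauss_tilt_def
  proof (rule integral_dominated_convergence[where w="\<lambda>x. F x * exp (- \<alpha>1 * x) + F x * exp (- \<alpha>2 * x)"])
    show "integrable lborel (\<lambda>x. F x * exp (- \<alpha>1 * x) + F x * exp (- \<alpha>2 * x))" using i1 i2 by simp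
    show "AE x in lborel. (\<lambda>n. F x * exp (- \<theta>' n * x - b n * x\<^sup>2)) \<longlonglongrightarrow> F x * exp (- \<alpha> * x)"
    proof (rule AE_I2)
      fix x :: real
      have "(\<lambda>n. F x * exp (- \<theta>' n * x - b n * x\<^sup>2)) \<longlonglongrightarrow> F x * exp (- \<alpha> * x - 0 * x\<^sup>2)"
        by (intro tendsto_intros \<theta>' b)
      then show "(\<lambda>n. F x * exp (- \<theta>' n * x - b n * x\<^sup>2)) \<longlonglongrightarrow> F x * exp (- \<alpha> * x)" by simp
    qed
    show "AE x in lborel. norm (F x * exp (- \<theta>' n * x - b n * x\<^sup>2)) \<le> F x * exp (- \<alpha>1 * x) + F x * exp (- \<alpha>2 * x)" for n
    proof (rule AE_I2)
      fix x :: real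
      have "exp (- \<theta>' n * x - b n * x\<^sup>2) \<le> exp (- \<theta>' n * x)" using b0[of n] by simp
      also have "\<dots> \<le> exp (- \<alpha>1 * x) + exp (- \<alpha>2 * x)"
      proof (cases "0 \<le> x")
        case True
        then have "exp (- \<theta>' n * x) \<le> exp (- \<alpha>1 * x)" using bd[of n] by (simp add: mult_right_mono)
        then show ?thesis by (simp add: add_increasing2)
      next
        case False
        then have "exp (- \<theta>' n * x) \<le> exp (- \<alpha>2 * x)" using bd[of n] by (simp add: mult_right_mono_neg)
        then show ?thesis by (simp add: add_increasing)
      qed
      finally have "F x * exp (- \<theta>' n * x - b n * x\<^sup>2) \<le> F x * (exp (- \<alpha>1 * x) + exp (- \<alpha>2 * x))"
        using nn by (intro mult_left_mono)
      then show "norm (F x * exp (- \<theta>' n * x - b n * x\<^sup>2)) \<le> F x * exp (- \<alpha>1 * x) + F x * exp (- \<alpha>2 * x)"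
        using nn[of x] by (simp add: distrib_left)
    qed
  qed measurable
  then show ?thesis
    by (rule Lim_transform_eventually) (use ev in eventually_elim, simp)
qed

text \<open>The window has endpoints \<alpha> / 2 and (1 + \<alpha>) / 2, which stay strictly
  between 0 and 1, where trap integrals are finite.\<close>

lemma gauss_tilt_trap_weight:
  assumes \<alpha>: "0 < \<alpha>" "\<alpha> < 1" and l: "0 < l" and s: "0 \<le> s"
    and \<theta>: "\<theta> \<longlonglongrightarrow> \<alpha>" and b: "b \<longlonglongrightarrow> 0" and b0: "\<And>n. 0 \<le> b n"
  shows "(\<lambda>n. gauss_tilt (b n) (\<theta> n) (trap_weight l s)) \<longlonglongrightarrow> (\<integral>x. trap_weight l s x * exp (- \<alpha> * x) \<partial>lborel)"
proof -
  have "integrable lborel (\<lambda>x. trap_weight l s x * exp (- c * x))" if "0 < c" "c < 1" for c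
    by (rule integrable_trap_weight[OF that l s])
  moreover have "0 < \<alpha> / 2" "\<alpha> / 2 < 1" "0 < (1 + \<alpha>) / 2" "(1 + \<alpha>) / 2 < 1" using \<alpha> by auto
  ultimately have "integrable lborel (\<lambda>x. trap_weight l s x * exp (- (\<alpha> / 2) * x))"
    "integrable lborel (\<lambda>x. trap_weight l s x * exp (- ((1 + \<alpha>) / 2) * x))"
    by blast+
  from gauss_tilt_tendsto[OF _ trap_weight_nonneg[OF l] this _ _ \<theta> b b0]
  show ?thesis using \<alpha> by simp
qed

lemma integrable_exp_Ici:
  fixes c :: real
  assumes "0 < c" shows "integrable lborel (\<lambda>x. indicator {0..} x * exp (- c * x))"
    and "(\<integral>x. indicator {0..} x * exp (- c * x) \<partial>lborel) = 1 / c"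
proof -
  show i: "integrable lborel (\<lambda>x. indicator {0..} x * exp (- c * x))"
    by (rule integrableI_bounded) (use nn_integral_exp_Ici[OF assms] in \<open>auto simp: abs_mult\<close>)
  have "ennreal (\<integral>x. indicator {0..} x * exp (- c * x) \<partial>lborel) = ennreal (1 / c)"
    using nn_integral_eq_integral[OF i] nn_integral_exp_Ici[OF assms] by simp
  then show "(\<integral>x. indicator {0..} x * exp (- c * x) \<partial>lborel) = 1 / c"
    using assms by (subst (asm) ennreal_inj) (auto intro!: Bochner_Integration.integral_nonneg)
qed

lemma gauss_tilt_Ici:
  assumes \<alpha>: "0 < \<alpha>" and \<theta>: "\<theta> \<longlonglongrightarrow> \<alpha>" and b: "b \<longlonglongrightarrow> 0" and b0: "\<And>n. 0 \<le> b n"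
  shows "(\<lambda>n. gauss_tilt (b n) (\<theta> n) (indicator {0..})) \<longlonglongrightarrow> 1 / \<alpha>"
proof -
  have "(\<lambda>n. gauss_tilt (b n) (\<theta> n) (indicator {0..})) \<longlonglongrightarrow> (\<integral>x. indicator {0..} x * exp (- \<alpha> * x) \<partial>lborel)"
    by (rule gauss_tilt_tendsto[OF _ _ integrable_exp_Ici(1)[of "\<alpha> / 2"] integrable_exp_Ici(1)[of "2 * \<alpha>"] _ _ \<theta> b b0])
       (use \<alpha> in auto)
  then show ?thesis using integrable_exp_Ici(2)[OF \<alpha>] by simp
qed

text \<open>From above by the full Gaussian integral, from below by the part over the unit interval.
  Such crude bounds suffice because they are only used after taking logarithms and dividing by
  n.\<close>

lemma gauss_tilt_Ici_bounds:
  assumes \<theta>: "0 \<le> \<theta>" and b: "0 < b"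
  shows "gauss_tilt b \<theta> (indicator {0..}) \<le> sqrt (pi / b)"
    and "exp (- \<theta> - b) \<le> gauss_tilt b \<theta> (indicator {0..})"
proof -
  define \<sigma> where "\<sigma> = sqrt (1 / (2 * b))"
  have \<sigma>: "0 < \<sigma>" "\<sigma>\<^sup>2 = 1 / (2 * b)" using b by (auto simp: \<sigma>_def)
  have nd: "exp (- b * x\<^sup>2) = sqrt (pi / b) * normal_density 0 \<sigma> x" for x
    using b by (simp add: normal_density_def \<sigma>(2))
  have ig: "integrable lborel (\<lambda>x. exp (- b * x\<^sup>2))" and Ig: "(\<integral>x. exp (- b * x\<^sup>2) \<partial>lborel) = sqrt (pi / b)"
    unfolding nd using \<sigma> by simp_all
  have dom: "indicator {0..} x * exp (- \<theta> * x - b * x\<^sup>2) \<le> exp (- b * x\<^sup>2)" for x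
    using \<theta> by (auto split: split_indicator)
  have i: "integrable lborel (\<lambda>x. indicator {0..} x * exp (- \<theta> * x - b * x\<^sup>2))"
    by (rule Bochner_Integration.integrable_bound[OF ig]) (use dom in \<open>auto simp: abs_mult\<close>)
  show "gauss_tilt b \<theta> (indicator {0..}) \<le> sqrt (pi / b)"
    unfolding gauss_tilt_def Ig[symmetric] by (rule integral_mono[OF i ig]) (rule dom)
  have "exp (- \<theta> - b) = (\<integral>x. indicator {0..1} (x::real) * exp (- \<theta> - b) \<partial>lborel)" by simp
  also have "\<dots> \<le> gauss_tilt b \<theta> (indicator {0..})"
    unfolding gauss_tilt_def
  proof (rule integral_mono[OF _ i])
    show "integrable lborel (\<lambda>x::real. indicator {0..1} x * exp (- \<theta> - b))" by simp
    fix x :: real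
    show "indicator {0..1} x * exp (- \<theta> - b) \<le> indicator {0..} x * exp (- \<theta> * x - b * x\<^sup>2)"
    proof (cases "x \<in> {0..1}")
      case True
      then have "\<theta> * x \<le> \<theta> * 1" "b * x\<^sup>2 \<le> b * 1" using \<theta> b by (intro mult_left_mono; simp add: power_le_one)+
      then show ?thesis using True by simp
    qed simp
  qed
  finally show "exp (- \<theta> - b) \<le> gauss_tilt b \<theta> (indicator {0..})" .
qed

text \<open>The tail \<open>1 / a\<close> of the Gaussian law pins down the tilt \<open>ln c / (n \<beta>\<^sup>2)\<close>: up to lower order terms,
  \<open>ln a = n \<beta>\<^sup>2 \<theta>\<^sup>2 / 2\<close>.\<close>

lemma tilt_tendsto_alpha:
  fixes a c :: "nat \<Rightarrow> real"
  assumes \<beta>: "0 < \<beta>" and \<epsilon>: "0 < \<epsilon>"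
    and c: "filterlim c at_top sequentially"
    and tail: "\<And>n. 1 \<le> n \<Longrightarrow> 0 < c n \<Longrightarrow> a n * (exp (- (ln (c n))\<^sup>2 / (2 * real n * \<beta>\<^sup>2)) / (\<beta> * sqrt (2 * pi * real n))
      * gauss_tilt (1 / (2 * real n * \<beta>\<^sup>2)) (ln (c n) / (real n * \<beta>\<^sup>2)) (indicator {0..})) = 1"
    and lim: "(\<lambda>n. ln (a n) / (real n * ln 2)) \<longlonglongrightarrow> \<epsilon>"
  shows "(\<lambda>n. ln (c n) / (real n * \<beta>\<^sup>2)) \<longlonglongrightarrow> alpha \<epsilon> \<beta>"
proof -
  define \<theta> where "\<theta> n = ln (c n) / (real n * \<beta>\<^sup>2)" for n
  define y where "y n = ln (a n) / real n" for n
  define d where "d n = ln (\<beta> * sqrt (2 * pi * real n)) / real n + 1 / (2 * (real n)\<^sup>2 * \<beta>\<^sup>2)" for n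
  \<comment> \<open>The logarithm of the tail equation. Both bounds on the half-line integral
    together cost only \<open>\<theta> n / real n + d n\<close> after division by n.\<close>
  have key: "eventually (\<lambda>n. 0 \<le> \<theta> n \<and> \<beta>\<^sup>2 * (\<theta> n)\<^sup>2 / 2 \<le> y n \<and> y n \<le> \<beta>\<^sup>2 * (\<theta> n)\<^sup>2 / 2 + \<theta> n / real n + d n) sequentially"
    using eventually_ge_at_top[of "1::nat"] filterlim_at_top_dense[THEN iffD1, OF c, rule_format, of 1]
  proof eventually_elim
    case (elim n)
    let ?b = "1 / (2 * real n * \<beta>\<^sup>2)" and ?S = "\<beta> * sqrt (2 * pi * real n)"
    define G where "G = gauss_tilt ?b (\<theta> n) (indicator {0..})"
    have n: "0 < real n" using elim by simp
    have c0: "0 < c n" using elim(2) by simp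
    have th: "0 \<le> \<theta> n" unfolding \<theta>_def using elim n \<beta> by (intro divide_nonneg_nonneg mult_nonneg_nonneg) auto
    have b: "0 < ?b" using n \<beta> by simp
    have S: "0 < ?S" using n \<beta> by simp
    \<comment> \<open>The full Gaussian integral equals the normalising factor, so the lower bound
      on ln (a n) has no error term.\<close>
    have sq: "sqrt (pi / ?b) = ?S" using \<beta> n by (simp add: real_sqrt_mult mult_ac)
    have G1: "G \<le> ?S" using gauss_tilt_Ici_bounds(1)[OF th b] unfolding G_def sq .
    have G2: "exp (- \<theta> n - ?b) \<le> G" using gauss_tilt_Ici_bounds(2)[OF th b] unfolding G_def .
    have G0: "0 < G" using G2 exp_gt_zero[of "- \<theta> n - ?b"] by linarith
    have E: "- (ln (c n))\<^sup>2 / (2 * real n * \<beta>\<^sup>2) = - (real n * (\<beta>\<^sup>2 * (\<theta> n)\<^sup>2 / 2))"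
      unfolding \<theta>_def using n \<beta> by (simp add: field_simps power2_eq_square)
    have "a n * (exp (- (real n * (\<beta>\<^sup>2 * (\<theta> n)\<^sup>2 / 2))) / ?S * G) = 1"
      using tail[OF elim(1) c0] unfolding G_def \<theta>_def[symmetric] E .
    then have a: "a n = exp (real n * (\<beta>\<^sup>2 * (\<theta> n)\<^sup>2 / 2)) * ?S / G"
      using S G0 by (simp add: exp_minus field_simps)
    have la: "ln (a n) = real n * (\<beta>\<^sup>2 * (\<theta> n)\<^sup>2 / 2) + ln ?S - ln G"
    proof -
      have "ln (exp R * s / g) = R + ln s - ln g" if "0 < s" "0 < g" for R s g :: real
        using that by (simp add: ln_div ln_mult)
      then show ?thesis unfolding a using S G0 by blast
    qed
    have l1: "ln G \<le> ln ?S" using G0 G1 S by (subst ln_le_cancel_iff) auto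
    have l2: "- \<theta> n - ?b \<le> ln G" using G0 G2 by (subst ln_ge_iff) auto
    have "real n * (\<beta>\<^sup>2 * (\<theta> n)\<^sup>2 / 2) \<le> ln (a n)" using la l1 by linarith
    then have 1: "\<beta>\<^sup>2 * (\<theta> n)\<^sup>2 / 2 \<le> y n" unfolding y_def using n by (simp add: pos_le_divide_eq mult.commute)
    have "ln (a n) \<le> real n * (\<beta>\<^sup>2 * (\<theta> n)\<^sup>2 / 2) + ln ?S + \<theta> n + ?b" using la l2 by linarith
    then have "y n \<le> (real n * (\<beta>\<^sup>2 * (\<theta> n)\<^sup>2 / 2) + ln ?S + \<theta> n + ?b) / real n"
      unfolding y_def using n by (intro divide_right_mono) auto
    also have "\<dots> = \<beta>\<^sup>2 * (\<theta> n)\<^sup>2 / 2 + \<theta> n / real n + d n"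
      unfolding d_def using n by (simp add: add_divide_distrib power2_eq_square)
    finally show ?case using th 1 by blast
  qed
  have y: "y \<longlonglongrightarrow> \<epsilon> * ln 2"
  proof -
    have "(\<lambda>n. ln (a n) / (real n * ln 2) * ln 2) \<longlonglongrightarrow> \<epsilon> * ln 2" by (intro tendsto_intros lim)
    then show ?thesis by (simp add: y_def[abs_def])
  qed
  have d: "d \<longlonglongrightarrow> 0" unfolding d_def[abs_def] using \<beta> by real_asymp
  have y0: "(\<lambda>n. (1 + 2 * y n / \<beta>\<^sup>2) / real n) \<longlonglongrightarrow> 0"
  proof -
    have "(\<lambda>n. (1 + 2 * y n / \<beta>\<^sup>2) * (1 / real n)) \<longlonglongrightarrow> (1 + 2 * (\<epsilon> * ln 2) / \<beta>\<^sup>2) * 0"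
      by (intro tendsto_intros y lim_1_over_n) (use \<beta> in simp)
    then show ?thesis by simp
  qed
  have sq: "(\<lambda>n. \<beta>\<^sup>2 * (\<theta> n)\<^sup>2 / 2) \<longlonglongrightarrow> \<epsilon> * ln 2"
  proof (rule tendsto_sandwich[of "\<lambda>n. y n - (1 + 2 * y n / \<beta>\<^sup>2) / real n - d n" _ _ y])
    show "eventually (\<lambda>n. y n - (1 + 2 * y n / \<beta>\<^sup>2) / real n - d n \<le> \<beta>\<^sup>2 * (\<theta> n)\<^sup>2 / 2) sequentially"
      using key
    proof eventually_elim
      case (elim n)
      \<comment> \<open>The error \<theta> / n must be controlled before \<theta> is known to be
        bounded; 1 + \<theta>^2 is bounded through \<open>y\<close>, which converges.\<close>
      have "\<theta> n \<le> 1 + (\<theta> n)\<^sup>2"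
      proof -
        have "0 \<le> (\<theta> n - 1)\<^sup>2" by simp
        then have "2 * \<theta> n \<le> 1 + (\<theta> n)\<^sup>2" by (simp add: power2_diff)
        then show ?thesis using elim by linarith
      qed
      also have "(\<theta> n)\<^sup>2 \<le> 2 * y n / \<beta>\<^sup>2" using elim \<beta> by (simp add: field_simps)
      finally have "\<theta> n / real n \<le> (1 + 2 * y n / \<beta>\<^sup>2) / real n" by (intro divide_right_mono) auto
      then show ?case using elim by linarith
    qed
    show "eventually (\<lambda>n. \<beta>\<^sup>2 * (\<theta> n)\<^sup>2 / 2 \<le> y n) sequentially" using key by eventually_elim blast
    have "(\<lambda>n. y n - (1 + 2 * y n / \<beta>\<^sup>2) / real n - d n) \<longlonglongrightarrow> \<epsilon> * ln 2 - 0 - 0"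
      by (intro tendsto_intros y y0 d)
    then show "(\<lambda>n. y n - (1 + 2 * y n / \<beta>\<^sup>2) / real n - d n) \<longlonglongrightarrow> \<epsilon> * ln 2" by simp
  qed (rule y)
  \<comment> \<open>The square root only recovers the absolute value of \<theta>; its sign is known
    from \<open>key\<close>.\<close>
  have "(\<lambda>n. sqrt (2 / \<beta>\<^sup>2 * (\<beta>\<^sup>2 * (\<theta> n)\<^sup>2 / 2))) \<longlonglongrightarrow> sqrt (2 / \<beta>\<^sup>2 * (\<epsilon> * ln 2))"
    by (intro tendsto_intros sq)
  moreover have "2 / \<beta>\<^sup>2 * (\<beta>\<^sup>2 * (\<theta> n)\<^sup>2 / 2) = (\<theta> n)\<^sup>2" for n using \<beta> by simp
  moreover have "sqrt (2 / \<beta>\<^sup>2 * (\<epsilon> * ln 2)) = alpha \<epsilon> \<beta>"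
    unfolding alpha_def beta_c_def using \<beta> by (simp add: real_sqrt_divide real_sqrt_mult)
  ultimately have "(\<lambda>n. \<bar>\<theta> n\<bar>) \<longlonglongrightarrow> alpha \<epsilon> \<beta>" by simp
  moreover have "eventually (\<lambda>n. \<bar>\<theta> n\<bar> = \<theta> n) sequentially" using key by eventually_elim simp
  ultimately have "\<theta> \<longlonglongrightarrow> alpha \<epsilon> \<beta>" by (rule Lim_transform_eventually)
  then show ?thesis by (simp add: \<theta>_def[abs_def])
qed

section \<open>Growth of the inverse tail probability\<close>

lemma eventually_exponential_growth:
  fixes a :: "nat \<Rightarrow> real"
  assumes lim: "(\<lambda>n. ln (a n) / (real n * ln 2)) \<longlonglongrightarrow> \<epsilon>" and \<epsilon>: "0 < \<epsilon>" and pos: "\<And>n. 1 \<le> n \<Longrightarrow> 0 < a n"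
  shows "eventually (\<lambda>n. exp (\<epsilon> * ln 2 / 2 * real n) \<le> a n) sequentially"
proof -
  have "eventually (\<lambda>n. \<epsilon> / 2 < ln (a n) / (real n * ln 2)) sequentially"
    using lim \<epsilon> by (intro order_tendstoD(1)) auto
  then show ?thesis using eventually_ge_at_top[of "1::nat"]
  proof eventually_elim
    case (elim n)
    have "0 < real n * ln 2" using elim by simp
    then have "\<epsilon> * ln 2 / 2 * real n \<le> ln (a n)" using elim(1) by (simp add: pos_less_divide_eq mult_ac)
    then show ?case using pos[OF elim(2)] by (rule iffD1[OF ln_ge_iff, rotated])
  qed
qed

lemma summable_square_over_growth:
  fixes a :: "nat \<Rightarrow> real"
  assumes k: "0 < k" and ev: "eventually (\<lambda>n. exp (k * real n) \<le> a n) sequentially"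
  shows "summable (\<lambda>n. (real n)\<^sup>2 / a n)"
proof (rule summable_comparison_test_ev)
  \<comment> \<open>The fourth power makes n^2 / a n at most 1 / n^2, a convergent comparison
    series.\<close>
  have "eventually (\<lambda>n. (real n)^4 * exp (- k * real n) \<le> 1) sequentially"
  proof -
    have "(\<lambda>n. (real n)^4 * exp (- k * real n)) \<longlonglongrightarrow> 0" using k by real_asymp
    then have "eventually (\<lambda>n. (real n)^4 * exp (- k * real n) < 1) sequentially" by (rule order_tendstoD) simp
    then show ?thesis by eventually_elim simp
  qed
  then show "eventually (\<lambda>n. norm ((real n)\<^sup>2 / a n) \<le> inverse ((real n)^2)) sequentially"
    using ev eventually_ge_at_top[of "1::nat"]
  proof eventually_elim
    case (elim n)
    have a: "0 < a n" using elim(2) exp_gt_zero[of "k * real n"] by linarith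
    have "(real n)\<^sup>2 * (real n)\<^sup>2 \<le> exp (k * real n)"
      using elim(1) by (simp add: exp_minus field_simps power2_eq_square power4_eq_xxxx)
    also have "\<dots> \<le> a n" by (rule elim(2))
    finally have "(real n)\<^sup>2 / a n \<le> inverse ((real n)^2)" using a elim(3) by (simp add: field_simps)
    then show ?case using a by simp
  qed
  show "summable (\<lambda>n. inverse ((real n)^2))" by (rule inverse_power_summable) simp
qed

section \<open>Moment bounds for sums over independent sites\<close>

lemma (in prob_space) indep_pair_expectation:
  fixes Y :: "'i \<Rightarrow> 'a \<Rightarrow> real"
  assumes ind: "indep_vars (\<lambda>_. borel) Y I" and i: "i \<in> I" "j \<in> I" "i \<noteq> j"
    and int: "\<And>i. i \<in> I \<Longrightarrow> integrable M (Y i)"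
  shows "expectation (\<lambda>\<omega>. Y i \<omega> * Y j \<omega>) = expectation (Y i) * expectation (Y j)"
    and "integrable M (\<lambda>\<omega>. Y i \<omega> * Y j \<omega>)"
proof -
  have ind2: "indep_vars (\<lambda>_. borel) Y {i, j}" by (rule indep_vars_subset[OF ind]) (use i in auto)
  have int2: "integrable M (Y k)" if "k \<in> {i, j}" for k using int i that by auto
  show "expectation (\<lambda>\<omega>. Y i \<omega> * Y j \<omega>) = expectation (Y i) * expectation (Y j)"
    using indep_vars_lebesgue_integral[OF _ ind2 int2] i by simp
  show "integrable M (\<lambda>\<omega>. Y i \<omega> * Y j \<omega>)"
    using indep_vars_integrable[OF _ ind2 int2] i by simp
qed

text \<open>Off-diagonal terms vanish by independence, and for variables between 0 and 1 the square
  is at most the variable itself, so each variance is at most \<mu>. Bounding it by the small mean,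
  and not by 1, is what makes the concentration effective for rare deep traps.\<close>

lemma (in prob_space) second_moment_indep_sum:
  fixes Y :: "'i \<Rightarrow> 'a \<Rightarrow> real"
  assumes I: "finite I" and ind: "indep_vars (\<lambda>_. borel) Y I"
    and Y01: "\<And>i \<omega>. i \<in> I \<Longrightarrow> 0 \<le> Y i \<omega>" "\<And>i \<omega>. i \<in> I \<Longrightarrow> Y i \<omega> \<le> 1"
    and mean: "\<And>i. i \<in> I \<Longrightarrow> expectation (Y i) = \<mu>"
  shows "integrable M (\<lambda>\<omega>. (\<Sum>i\<in>I. Y i \<omega> - \<mu>)\<^sup>2)"
    and "expectation (\<lambda>\<omega>. (\<Sum>i\<in>I. Y i \<omega> - \<mu>)\<^sup>2) \<le> real (card I) * \<mu>"
proof -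
  have rv: "Y i \<in> borel_measurable M" if "i \<in> I" for i
    using ind that by (auto simp: indep_vars_def)
  have intY: "integrable M (Y i)" if "i \<in> I" for i
    by (rule integrable_const_bound[of _ 1]) (use Y01[OF that] rv[OF that] in \<open>auto simp: abs_le_iff intro: order_trans[of _ 0]\<close>)
  have intYY: "integrable M (\<lambda>\<omega>. Y i \<omega> * Y i \<omega>)" if "i \<in> I" for i
    by (rule integrable_const_bound[of _ 1])
       (use Y01[OF that] rv[OF that] in \<open>auto intro!: mult_le_one\<close>)
  define Z where "Z i \<omega> = Y i \<omega> - \<mu>" for i \<omega>
  have indZ: "indep_vars (\<lambda>_. borel) Z I"
    unfolding Z_def[abs_def] by (rule indep_vars_compose2[OF ind]) simp
  have intZ: "integrable M (Z i)" if "i \<in> I" for i unfolding Z_def[abs_def] using intY[OF that] by simp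
  have EZ: "expectation (Z i) = 0" if "i \<in> I" for i
    unfolding Z_def[abs_def] using intY[OF that] mean[OF that] prob_space by simp
  have intZZ: "integrable M (\<lambda>\<omega>. Z i \<omega> * Z j \<omega>)" if "i \<in> I" "j \<in> I" for i j
  proof (cases "i = j")
    case True
    have "(\<lambda>\<omega>. Z i \<omega> * Z i \<omega>) = (\<lambda>\<omega>. Y i \<omega> * Y i \<omega> - 2 * \<mu> * Y i \<omega> + \<mu> * \<mu>)"
      by (simp add: Z_def algebra_simps fun_eq_iff)
    then show ?thesis using True intYY[OF that(1)] intY[OF that(1)] by simp
  next
    case False
    show ?thesis by (rule indep_pair_expectation(2)[OF indZ that False intZ])
  qed
  have EZZ: "expectation (\<lambda>\<omega>. Z i \<omega> * Z j \<omega>) \<le> (if i = j then \<mu> else 0)" if ij: "i \<in> I" "j \<in> I" for i j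
  proof (cases "i = j")
    case True
    have "(\<lambda>\<omega>. Z i \<omega> * Z i \<omega>) = (\<lambda>\<omega>. Y i \<omega> * Y i \<omega> - 2 * \<mu> * Y i \<omega> + \<mu> * \<mu>)"
      by (simp add: Z_def algebra_simps fun_eq_iff)
    then have "expectation (\<lambda>\<omega>. Z i \<omega> * Z i \<omega>) = expectation (\<lambda>\<omega>. Y i \<omega> * Y i \<omega>) - \<mu> * \<mu>"
      using intYY[OF ij(1)] intY[OF ij(1)] mean[OF ij(1)] prob_space by simp
    also have "expectation (\<lambda>\<omega>. Y i \<omega> * Y i \<omega>) \<le> expectation (Y i)"
      using Y01[OF ij(1)] by (intro integral_mono intYY intY ij) (simp add: mult_left_le)
    finally have "expectation (\<lambda>\<omega>. Z i \<omega> * Z i \<omega>) \<le> \<mu>"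
      using mean[OF ij(1)] zero_le_square[of \<mu>] by linarith
    then show ?thesis using True by simp
  next
    case False
    show ?thesis using indep_pair_expectation(1)[OF indZ ij False intZ] EZ ij False by simp
  qed
  have sq: "(\<Sum>i\<in>I. Y i \<omega> - \<mu>)\<^sup>2 = (\<Sum>i\<in>I. \<Sum>j\<in>I. Z i \<omega> * Z j \<omega>)" for \<omega>
    by (simp add: power2_eq_square sum_product Z_def)
  show "integrable M (\<lambda>\<omega>. (\<Sum>i\<in>I. Y i \<omega> - \<mu>)\<^sup>2)"
    unfolding sq by (intro Bochner_Integration.integrable_sum intZZ)
  have "expectation (\<lambda>\<omega>. (\<Sum>i\<in>I. Y i \<omega> - \<mu>)\<^sup>2) = (\<Sum>i\<in>I. \<Sum>j\<in>I. expectation (\<lambda>\<omega>. Z i \<omega> * Z j \<omega>))"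
    unfolding sq using intZZ by (simp add: Bochner_Integration.integral_sum)
  also have "\<dots> \<le> (\<Sum>i\<in>I. \<Sum>j\<in>I. if i = j then \<mu> else 0)"
    by (intro sum_mono EZZ)
  also have "\<dots> = real (card I) * \<mu>" using I by simp
  finally show "expectation (\<lambda>\<omega>. (\<Sum>i\<in>I. Y i \<omega> - \<mu>)\<^sup>2) \<le> real (card I) * \<mu>" .
qed

text \<open>Chebyshev's inequality. The variance of the rescaled mean is at most a^2 \<mu> / 2 ^ n;
  in applications a \<mu> stays bounded, which leaves a / 2 ^ n.\<close>

lemma (in prob_space) cube_mean_concentration:
  fixes Y :: "(nat \<Rightarrow> real) \<Rightarrow> 'a \<Rightarrow> real"
  assumes ind: "indep_vars (\<lambda>_. borel) Y (cube n)"
    and Y01: "\<And>x \<omega>. x \<in> cube n \<Longrightarrow> 0 \<le> Y x \<omega>" "\<And>x \<omega>. x \<in> cube n \<Longrightarrow> Y x \<omega> \<le> 1"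
    and mean: "\<And>x. x \<in> cube n \<Longrightarrow> expectation (Y x) = \<mu>"
    and a: "0 < a" and \<eta>: "0 < \<eta>"
  shows "{\<omega> \<in> space M. \<eta> \<le> \<bar>a * cube_mean n (\<lambda>x. Y x \<omega>) - a * \<mu>\<bar>} \<in> events"
    and "prob {\<omega> \<in> space M. \<eta> \<le> \<bar>a * cube_mean n (\<lambda>x. Y x \<omega>) - a * \<mu>\<bar>} \<le> a / 2 ^ n * (a * \<mu>) / \<eta>\<^sup>2"
proof -
  let ?A = "{\<omega> \<in> space M. \<eta> \<le> \<bar>a * cube_mean n (\<lambda>x. Y x \<omega>) - a * \<mu>\<bar>}"
  have rv[measurable]: "Y x \<in> borel_measurable M" if "x \<in> cube n" for x
    using ind that by (auto simp: indep_vars_def)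
  show "?A \<in> events"
    unfolding cube_mean_def by measurable
  have eq: "a * cube_mean n (\<lambda>x. Y x \<omega>) - a * \<mu> = a / 2 ^ n * (\<Sum>x\<in>cube n. Y x \<omega> - \<mu>)" for \<omega>
    by (simp add: cube_mean_def sum_subtractf card_cube field_simps)
  \<comment> \<open>The level for the squared unnormalised sum that corresponds to a deviation
    \<eta> of the rescaled mean.\<close>
  define t where "t = (\<eta> * 2 ^ n / a)\<^sup>2"
  have t: "0 < t" using a \<eta> by (simp add: t_def)
  have "\<eta> \<le> \<bar>a * cube_mean n (\<lambda>x. Y x \<omega>) - a * \<mu>\<bar> \<longleftrightarrow> t \<le> (\<Sum>x\<in>cube n. Y x \<omega> - \<mu>)\<^sup>2" for \<omega>
  proof -
    have "\<eta> \<le> \<bar>a * cube_mean n (\<lambda>x. Y x \<omega>) - a * \<mu>\<bar> \<longleftrightarrow> \<eta> * 2 ^ n / a \<le> \<bar>\<Sum>x\<in>cube n. Y x \<omega> - \<mu>\<bar>"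
      unfolding eq using a by (simp add: abs_mult field_simps)
    also have "\<dots> \<longleftrightarrow> t \<le> (\<Sum>x\<in>cube n. Y x \<omega> - \<mu>)\<^sup>2"
      unfolding t_def using a \<eta> by (subst abs_le_square_iff[symmetric]) simp
    finally show ?thesis .
  qed
  then have "prob ?A =
      prob {\<omega> \<in> space M. t \<le> (\<Sum>x\<in>cube n. Y x \<omega> - \<mu>)\<^sup>2}" by simp
  also have "\<dots> \<le> expectation (\<lambda>\<omega>. (\<Sum>x\<in>cube n. Y x \<omega> - \<mu>)\<^sup>2) / t"
    by (rule integral_Markov_inequality_measure[OF second_moment_indep_sum(1)[OF finite_cube ind Y01 mean], of "{}"])
       (use t in auto)
  also have "\<dots> \<le> (real (card (cube n)) * \<mu>) / t"
    using t by (intro divide_right_mono second_moment_indep_sum(2)[OF finite_cube ind Y01 mean]) auto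
  also have "\<dots> = a / 2 ^ n * (a * \<mu>) / \<eta>\<^sup>2"
    unfolding t_def card_cube using a \<eta> by (simp add: field_simps power2_eq_square)
  finally show "prob ?A \<le> a / 2 ^ n * (a * \<mu>) / \<eta>\<^sup>2" .
qed

text \<open>Markov's inequality is enough. Distinct sites are independent, so each pair has mean
  \<mu>^2, and the rows of the kernel sum to at most 2 n^2; with a \<mu> bounded the result is of
  order n^2 / a.\<close>

lemma (in prob_space) pair_energy_concentration:
  fixes Y :: "(nat \<Rightarrow> real) \<Rightarrow> 'a \<Rightarrow> real"
  assumes ind: "indep_vars (\<lambda>_. borel) Y (cube n)"
    and Y01: "\<And>x \<omega>. x \<in> cube n \<Longrightarrow> 0 \<le> Y x \<omega>" "\<And>x \<omega>. x \<in> cube n \<Longrightarrow> Y x \<omega> \<le> 1"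
    and mean: "\<And>x. x \<in> cube n \<Longrightarrow> expectation (Y x) = \<mu>"
    and a: "0 < a" and \<eta>: "0 < \<eta>"
  shows "{\<omega> \<in> space M. \<eta> \<le> a * pair_energy n (\<lambda>x. Y x \<omega>)} \<in> events"
    and "prob {\<omega> \<in> space M. \<eta> \<le> a * pair_energy n (\<lambda>x. Y x \<omega>)} \<le> 2 * (real n)\<^sup>2 / a * (a * \<mu>)\<^sup>2 / \<eta>"
proof -
  let ?A = "{\<omega> \<in> space M. \<eta> \<le> a * pair_energy n (\<lambda>x. Y x \<omega>)}"
  let ?E = "\<lambda>\<omega>. a * pair_energy n (\<lambda>x. Y x \<omega>)"
  have rv[measurable]: "Y x \<in> borel_measurable M" if "x \<in> cube n" for x
    using ind that by (auto simp: indep_vars_def)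
  have intY: "integrable M (Y i)" if "i \<in> cube n" for i
    by (rule integrable_const_bound[of _ 1]) (use Y01[OF that] rv[OF that] in \<open>auto simp: abs_le_iff intro: order_trans[of _ 0]\<close>)
  note pair = indep_pair_expectation[OF ind _ _ _ intY]
  have i0: "integrable M (\<lambda>\<omega>. Y x \<omega> * Y y \<omega>)" if "x \<in> cube n" "y \<in> cube n - {x}" for x y
    using pair(2)[of x y] that by auto
  have int: "integrable M ?E"
    unfolding pair_energy_def cube_mean_def
    by (intro integrable_mult_right integrable_divide_zero Bochner_Integration.integrable_sum) (use i0 in auto)
  show "?A \<in> events"
    using borel_measurable_integrable[OF int] by measurable
  have "expectation ?E =
      a * ((\<Sum>x\<in>cube n. \<Sum>y\<in>cube n - {x}. green n (hamming n x y) * expectation (\<lambda>\<omega>. Y x \<omega> * Y y \<omega>)) / 2 ^ n)"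
  proof -
    have i1: "integrable M (\<lambda>\<omega>. green n (hamming n x y) * (Y x \<omega> * Y y \<omega>))" if "x \<in> cube n" "y \<in> cube n - {x}" for x y
      using i0[OF that] by simp
    have "expectation (\<lambda>\<omega>. \<Sum>x\<in>cube n. \<Sum>y\<in>cube n - {x}. green n (hamming n x y) * (Y x \<omega> * Y y \<omega>)) =
       (\<Sum>x\<in>cube n. expectation (\<lambda>\<omega>. \<Sum>y\<in>cube n - {x}. green n (hamming n x y) * (Y x \<omega> * Y y \<omega>)))"
      by (intro Bochner_Integration.integral_sum Bochner_Integration.integrable_sum i1)
    also have "\<dots> = (\<Sum>x\<in>cube n. \<Sum>y\<in>cube n - {x}. expectation (\<lambda>\<omega>. green n (hamming n x y) * (Y x \<omega> * Y y \<omega>)))"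
      by (intro sum.cong refl Bochner_Integration.integral_sum i1)
    finally show ?thesis unfolding pair_energy_def cube_mean_def by simp
  qed
  also have "(\<Sum>x\<in>cube n. \<Sum>y\<in>cube n - {x}. green n (hamming n x y) * expectation (\<lambda>\<omega>. Y x \<omega> * Y y \<omega>)) =
     (\<Sum>x\<in>cube n. \<Sum>y\<in>cube n - {x}. green n (hamming n x y) * (\<mu> * \<mu>))"
    using pair(1) mean by (intro sum.cong) auto
  also have "\<dots> \<le> (\<Sum>x\<in>cube n. 2 * (real n)\<^sup>2 * (\<mu> * \<mu>))"
  proof (rule sum_mono)
    fix x assume x: "x \<in> cube n"
    have "(\<Sum>y\<in>cube n - {x}. green n (hamming n x y)) \<le> (\<Sum>y\<in>cube n. green n (hamming n x y))"
      by (rule sum_mono2) (auto simp: finite_cube green_nonneg)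
    also have "\<dots> \<le> 2 * (real n)\<^sup>2" by (rule green_row_sum_le[OF x])
    finally show "(\<Sum>y\<in>cube n - {x}. green n (hamming n x y) * (\<mu> * \<mu>)) \<le> 2 * (real n)\<^sup>2 * (\<mu> * \<mu>)"
      unfolding sum_distrib_right[symmetric] by (rule mult_right_mono) simp
  qed
  also have "a * ((\<Sum>x\<in>cube n. 2 * (real n)\<^sup>2 * (\<mu> * \<mu>)) / 2 ^ n) = 2 * (real n)\<^sup>2 / a * (a * \<mu>)\<^sup>2"
    using a by (simp add: card_cube power2_eq_square)
  finally have E: "expectation ?E \<le> 2 * (real n)\<^sup>2 / a * (a * \<mu>)\<^sup>2"
    using a by (simp add: divide_right_mono mult_left_mono)
  have "prob ?A \<le> expectation ?E / \<eta>"
  proof (rule integral_Markov_inequality_measure[OF int, of "{}"])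
    show "AE \<omega> in M. 0 \<le> a * pair_energy n (\<lambda>x. Y x \<omega>)"
      unfolding pair_energy_def cube_mean_def using a Y01 green_nonneg
      by (intro AE_I2 mult_nonneg_nonneg divide_nonneg_nonneg sum_nonneg) auto
  qed (use \<eta> in auto)
  also have "\<dots> \<le> 2 * (real n)\<^sup>2 / a * (a * \<mu>)\<^sup>2 / \<eta>" using E \<eta> by (intro divide_right_mono) auto
  finally show "prob ?A \<le> 2 * (real n)\<^sup>2 / a * (a * \<mu>)\<^sup>2 / \<eta>" .
qed

section \<open>The correlation function of the trap dynamics\<close>

lemma cube_edge_iff:
  assumes x: "x \<in> cube n" and y: "y \<in> cube n"
  shows "cube_edge n x y \<longleftrightarrow> (\<exists>i<n. y = flip i x)"
proof
  assume "cube_edge n x y"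
  then have "card {i. i < n \<and> x i \<noteq> y i} = 1" by (simp add: cube_edge_def)
  then obtain i where i: "{i. i < n \<and> x i \<noteq> y i} = {i}" by (auto simp: card_1_singleton_iff)
  then have "i \<in> {i. i < n \<and> x i \<noteq> y i}" by simp
  then have i1: "i < n" "x i \<noteq> y i" by auto
  have i2: "x j = y j" if "j < n" "j \<noteq> i" for j using i that by blast
  have "y = flip i x"
  proof (rule cube_ext[OF y flip_cube[OF x i1(1)]])
    fix j assume j: "j < n"
    show "y j = flip i x j"
      using i1 i2[OF j] cube_vals[OF x j] cube_vals[OF y j] by (auto simp: flip_def)
  qed
  then show "\<exists>i<n. y = flip i x" using i1 by blast
next
  assume "\<exists>i<n. y = flip i x"
  then obtain i where i: "i < n" "y = flip i x" by blast
  have "{j. j < n \<and> x j \<noteq> y j} = {i}"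
    using i cube_vals[OF x i(1)] by (auto simp: flip_def)
  then show "cube_edge n x y" using x y by (simp add: cube_edge_def)
qed

lemma sum_cube_edge:
  assumes x: "x \<in> cube n"
  shows "(\<Sum>y\<in>cube n. if cube_edge n x y then g y else 0) = (\<Sum>i<n. g (flip i x))"
proof -
  have inj: "inj_on (\<lambda>i. flip i x) {..<n}"
  proof (rule inj_onI)
    fix i j assume ij: "i \<in> {..<n}" "j \<in> {..<n}" and e: "flip i x = flip j x"
    show "i = j"
    proof (rule ccontr)
      assume "i \<noteq> j"
      then have "flip i x i \<noteq> flip j x i" using cube_vals[OF x, of i] ij by (auto simp: flip_def)
      then show False using e by simp
    qed
  qed
  have "(\<Sum>y\<in>cube n. if cube_edge n x y then g y else 0) = (\<Sum>y\<in>{y \<in> cube n. cube_edge n x y}. g y)"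
    by (rule sum.inter_filter[symmetric]) (rule finite_cube)
  also have "{y \<in> cube n. cube_edge n x y} = (\<lambda>i. flip i x) ` {..<n}"
    using cube_edge_iff[OF x] flip_cube[OF x] by auto
  also have "(\<Sum>y\<in>(\<lambda>i. flip i x) ` {..<n}. g y) = (\<Sum>i<n. g (flip i x))"
    using sum.reindex[OF inj, of g] by simp
  finally show ?thesis .
qed

lemma not_cube_edge_self: "\<not> cube_edge n x x"
  by (simp add: cube_edge_def)

lemma exit_rate_hop:
  assumes x: "x \<in> cube n" and n: "1 \<le> n"
  shows "exit_rate (cube n) (hop_rate n \<beta> h) x = 1 / tau \<beta> (h x)"
proof -
  have "exit_rate (cube n) (hop_rate n \<beta> h) x = (\<Sum>y\<in>cube n. hop_rate n \<beta> h x y)"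
    unfolding exit_rate_def using sum.remove[OF finite_cube x, of "hop_rate n \<beta> h x"]
    by (simp add: hop_rate_def not_cube_edge_self)
  also have "\<dots> = (\<Sum>i<n. 1 / (real n * tau \<beta> (h x)))"
    unfolding hop_rate_def by (rule sum_cube_edge[OF x])
  also have "\<dots> = 1 / tau \<beta> (h x)" using n by simp
  finally show ?thesis .
qed

text \<open>The rates depend on the starting vertex only, so normalising removes the environment:
  the chain is the simple random walk, and the traps act through the holding times alone. This is
  why a deterministic Green kernel suffices.\<close>

lemma jump_prob_hop:
  assumes x: "x \<in> cube n" and n: "1 \<le> n"
  shows "jump_prob (cube n) (hop_rate n \<beta> h) x y = (if cube_edge n x y then 1 / real n else 0)"
proof -
  have "tau \<beta> (h x) > 0" by (simp add: tau_def)
  then show ?thesis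
    unfolding jump_prob_def exit_rate_hop[OF x n] by (auto simp: hop_rate_def not_cube_edge_self)
qed

lemma sum_jump_prob_hop:
  assumes x: "x \<in> cube n" and n: "1 \<le> n"
  shows "(\<Sum>y\<in>cube n. jump_prob (cube n) (hop_rate n \<beta> h) x y * u y) = nbr_avg n u x"
proof -
  have "(\<Sum>y\<in>cube n. jump_prob (cube n) (hop_rate n \<beta> h) x y * u y) = (\<Sum>y\<in>cube n. if cube_edge n x y then u y / real n else 0)"
    by (rule sum.cong[OF refl]) (simp add: jump_prob_hop[OF x n])
  also have "\<dots> = nbr_avg n u x"
    unfolding sum_cube_edge[OF x] nbr_avg_def sum_divide_distrib ..
  finally show ?thesis .
qed

lemma cube_inner_eq_iff:
  assumes x: "x \<in> cube n" and y: "y \<in> cube n" and n: "1 \<le> n"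
  shows "cube_inner n x y / real n = 1 \<longleftrightarrow> x = y"
proof
  assume "x = y"
  then have "cube_inner n x y = (\<Sum>i<n. 1)"
    unfolding cube_inner_def using cube_vals[OF x] by (intro sum.cong) force+
  then show "cube_inner n x y / real n = 1" using n by simp
next
  assume a: "cube_inner n x y / real n = 1"
  show "x = y"
  proof (rule cube_ext[OF x y], rule ccontr)
    fix i assume i: "i < n" "x i \<noteq> y i"
    have "cube_inner n x y < (\<Sum>i<n. 1)"
      unfolding cube_inner_def
    proof (rule sum_strict_mono_ex1)
      show "\<forall>i\<in>{..<n}. x i * y i \<le> 1" using cube_vals[OF x] cube_vals[OF y] by force
      show "\<exists>i\<in>{..<n}. x i * y i < 1" using i cube_vals[OF x i(1)] cube_vals[OF y i(1)] by force
    qed simp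
    then show False using a n by (simp add: field_simps)
  qed
qed

text \<open>Rescaling time by \<open>c\<close> divides the holding times, and multiplies the exit rates, by \<open>c\<close>.\<close>

lemma hop_process_chain:
  assumes n: "1 \<le> n" and c: "0 < c"
    and mjp: "markov_jump_process (cube n) (hop_rate n \<beta> h) (pmf_of_set (cube n)) P X"
  obtains J T where
    "jump_chain P (cube n) (pmf (pmf_of_set (cube n))) (jump_prob (cube n) (hop_rate n \<beta> h)) (\<lambda>x. c / tau \<beta> (h x)) J T"
    and "\<And>t s. 0 \<le> t \<Longrightarrow> 0 < s \<Longrightarrow> correlation n c P X t s = measure P (jump_chain.no_jump P T t s)"
proof -
  let ?q = "hop_rate n \<beta> h" and ?V = "cube n"
  have "prob_space P" using mjp by (simp add: markov_jump_process_def)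
  then interpret prob_space P .
  from mjp[unfolded markov_jump_process_def, THEN conjunct2, THEN conjunct2, THEN conjunct2, THEN conjunct2, THEN conjunct2]
  obtain J T0 where jt: "(\<forall>k. J k \<in> measurable P (count_space ?V)) \<and>
        (\<forall>k. T0 k \<in> borel_measurable P) \<and>
        (\<forall>k x s. (\<forall>i\<le>k. x i \<in> ?V \<and> 0 \<le> s i) \<longrightarrow>
           measure P {w \<in> space P. \<forall>i\<le>k. J i w = x i \<and> s i < T0 i w} =
             pmf (pmf_of_set ?V) (x 0) * (\<Prod>i<k. jump_prob ?V ?q (x i) (x (Suc i)))
                         * (\<Prod>i\<le>k. exp (- exit_rate ?V ?q (x i) * s i))) \<and>
        (\<forall>w\<in>space P. (\<forall>k. 0 < T0 k w) \<and>
           filterlim (\<lambda>k. \<Sum>i<k. T0 i w) at_top sequentially \<and>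
           (\<forall>k t. (\<Sum>i<k. T0 i w) \<le> t \<and> t < (\<Sum>i<Suc k. T0 i w) \<longrightarrow> X t w = J k w))"
    by (elim exE)
  have J: "J k \<in> measurable P (count_space ?V)" and T0: "T0 k \<in> borel_measurable P" for k
    using jt by simp_all
  have law: "measure P {w \<in> space P. \<forall>i\<le>k. J i w = x i \<and> s i < T0 i w} =
         pmf (pmf_of_set ?V) (x 0) * (\<Prod>i<k. jump_prob ?V ?q (x i) (x (Suc i)))
           * (\<Prod>i\<le>k. exp (- exit_rate ?V ?q (x i) * s i))"
    if "\<forall>i\<le>k. x i \<in> ?V \<and> 0 \<le> s i" for k x s
    using jt[THEN conjunct2, THEN conjunct2, THEN conjunct1, rule_format, OF that[rule_format]] .
  have jt': "\<forall>w\<in>space P. (\<forall>k. 0 < T0 k w) \<and>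
           filterlim (\<lambda>k. \<Sum>i<k. T0 i w) at_top sequentially \<and>
           (\<forall>k t. (\<Sum>i<k. T0 i w) \<le> t \<and> t < (\<Sum>i<Suc k. T0 i w) \<longrightarrow> X t w = J k w)"
    using jt by (elim conjE)
  have T0_pos: "0 < T0 k w" and T0_inf: "filterlim (\<lambda>k. \<Sum>i<k. T0 i w) at_top sequentially"
    and X: "(\<Sum>i<k. T0 i w) \<le> t \<Longrightarrow> t < (\<Sum>i<Suc k. T0 i w) \<Longrightarrow> X t w = J k w"
    if "w \<in> space P" for w k t
    using jt'[rule_format, OF that] by blast+
  define T where "T k w = T0 k w / c" for k w
  have rate: "exit_rate ?V ?q x = 1 / tau \<beta> (h x)" if "x \<in> ?V" for x by (rule exit_rate_hop[OF that n])
  have taup: "0 < tau \<beta> (h x)" for x by (simp add: tau_def)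
  have chain: "jump_chain P ?V (pmf (pmf_of_set ?V)) (jump_prob ?V ?q) (\<lambda>x. c / tau \<beta> (h x)) J T"
  proof
    show "finite ?V" by (rule finite_cube)
    show "0 < c / tau \<beta> (h x)" for x using c taup by simp
    show "0 \<le> pmf (pmf_of_set ?V) x" for x by simp
    show "0 \<le> jump_prob ?V ?q x y" if "x \<in> ?V" for x y using jump_prob_hop[OF that n] by simp
    show "(\<Sum>y\<in>?V. jump_prob ?V ?q x y) \<le> 1" if "x \<in> ?V" for x
      using sum_jump_prob_hop[OF that n, of \<beta> h "\<lambda>_. 1"] nbr_avg_const[OF n, of 1 x] by simp
    show "J k \<in> measurable P (count_space ?V)" for k by (rule J)
    show "T k \<in> borel_measurable P" for k unfolding T_def[abs_def] using T0 by simp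
    show "0 < T k w" if "w \<in> space P" for k w unfolding T_def using T0_pos[OF that] c by simp
    show "filterlim (\<lambda>k. \<Sum>i<k. T i w) at_top sequentially" if "w \<in> space P" for w
    proof -
      have "filterlim (\<lambda>k. 1 / c * (\<Sum>i<k. T0 i w)) at_top sequentially"
        by (rule filterlim_tendsto_pos_mult_at_top[OF tendsto_const _ T0_inf[OF that]]) (use c in simp)
      then show ?thesis by (simp add: T_def sum_divide_distrib)
    qed
    show "measure P {w \<in> space P. \<forall>i\<le>k. J i w = x i \<and> s i < T i w} =
         pmf (pmf_of_set ?V) (x 0) * (\<Prod>i<k. jump_prob ?V ?q (x i) (x (Suc i)))
           * (\<Prod>i\<le>k. exp (- (c / tau \<beta> (h (x i))) * s i))"
      if xs: "\<forall>i\<le>k. x i \<in> ?V \<and> 0 \<le> s i" for k x s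
    proof -
      have "{w \<in> space P. \<forall>i\<le>k. J i w = x i \<and> s i < T i w} = {w \<in> space P. \<forall>i\<le>k. J i w = x i \<and> c * s i < T0 i w}"
        unfolding T_def using c by (simp add: pos_less_divide_eq mult.commute)
      moreover have "\<forall>i\<le>k. x i \<in> ?V \<and> 0 \<le> c * s i" using xs c by simp
      moreover have "(\<Prod>i\<le>k. exp (- exit_rate ?V ?q (x i) * (c * s i))) = (\<Prod>i\<le>k. exp (- (c / tau \<beta> (h (x i))) * s i))"
        using xs by (intro prod.cong) (auto simp: rate)
      ultimately show ?thesis using law[of k x "\<lambda>i. c * s i"] by simp
    qed
  qed
  interpret jump_chain P ?V "pmf (pmf_of_set ?V)" "jump_prob ?V ?q" "\<lambda>x. c / tau \<beta> (h x)" J T by (rule chain)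
  have clk: "(\<Sum>i<k. T0 i w) = c * clock k w" for k w
    unfolding clock_def T_def using c by (simp add: sum_divide_distrib[symmetric])
  have X': "X (c * u) w = J k w" if "w \<in> space P" "clock k w \<le> u" "u < clock (Suc k) w" for w k u
    by (rule X[OF that(1)]) (use that c in \<open>simp_all only: clk mult_le_cancel_left_pos mult_less_cancel_left_pos\<close>)
  \<comment> \<open>Inner product n characterises equality only for vertices of the cube, so the
    values of the process must be known to lie there.\<close>
  have XV: "X (c * u) w \<in> ?V" if w: "w \<in> space P" and u: "0 \<le> u" for w u
  proof -
    obtain k where "clock k w \<le> u" "u < clock (Suc k) w" by (rule clock_interval_exists[OF w u])
    then show ?thesis using X'[OF w] J_in[OF w] by simp
  qed
  have "correlation n c P X t s = measure P (no_jump t s)" if t: "0 \<le> t" and s: "0 < s" for t s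
  proof -
    have "{w \<in> space P. \<forall>u. t \<le> u \<and> u < t + s \<longrightarrow> cube_inner n (X (c * t) w) (X (c * u) w) / real n = 1} =
       {w \<in> space P. \<forall>u. t \<le> u \<and> u < t + s \<longrightarrow> X (c * u) w = X (c * t) w}"
    proof (rule Collect_cong, rule conj_cong[OF refl], rule all_cong1, rule imp_cong[OF refl])
      fix w u assume "w \<in> space P" "t \<le> u \<and> u < t + s"
      then show "(cube_inner n (X (c * t) w) (X (c * u) w) / real n = 1) = (X (c * u) w = X (c * t) w)"
        using cube_inner_eq_iff[OF XV XV n, of w t w u] t by auto
    qed
    then show ?thesis
      unfolding correlation_def
      using prob_constant_path[of "\<lambda>u. X (c * u)" t s] X' t s by (simp add: jump_prob_def)
  qed
  then show ?thesis using that[OF chain] by blast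
qed

text \<open>Allows convergence at arbitrary s to be squeezed between rational values.\<close>

lemma correlation_antimono:
  assumes n: "1 \<le> n" and c: "0 < c"
    and mjp: "markov_jump_process (cube n) (hop_rate n \<beta> h) (pmf_of_set (cube n)) P X"
    and t: "0 \<le> t" and s: "0 < s" "s \<le> s'"
  shows "correlation n c P X t s' \<le> correlation n c P X t s"
proof -
  obtain J T where ch: "jump_chain P (cube n) (pmf (pmf_of_set (cube n))) (jump_prob (cube n) (hop_rate n \<beta> h)) (\<lambda>x. c / tau \<beta> (h x)) J T"
    and corr: "\<And>t s. 0 \<le> t \<Longrightarrow> 0 < s \<Longrightarrow> correlation n c P X t s = measure P (jump_chain.no_jump P T t s)"
    using hop_process_chain[OF n c mjp] by blast
  interpret jump_chain P "cube n" "pmf (pmf_of_set (cube n))" "jump_prob (cube n) (hop_rate n \<beta> h)" "\<lambda>x. c / tau \<beta> (h x)" J T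
    by (rule ch)
  show ?thesis using corr[OF t] s no_jump_antimono[OF s(2), of t] by simp
qed

text \<open>The function \<open>D\<close> is the no-jump probability. It agrees with the correlation
  for nonnegative t and is measurable and bounded on the whole line, whereas the process is
  unconstrained at negative times. The number \<open>m\<close> is the mean value of the killed
  walk.\<close>

lemma correlation_laplace:
  assumes n: "1 \<le> n" and c: "0 < c"
    and mjp: "markov_jump_process (cube n) (hop_rate n \<beta> h) (pmf_of_set (cube n)) P X"
    and s: "0 < s"
  obtains D where "D \<in> borel_measurable borel" "\<And>t. 0 \<le> D t" "\<And>t. D t \<le> 1"
    and "\<And>t. 0 \<le> t \<Longrightarrow> D t = correlation n c P X t s"
    and "\<And>t t'. 0 \<le> t \<Longrightarrow> t \<le> t' \<Longrightarrow> D t \<le> D t' + 2 / s * (t' - t)"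
    and "\<And>l. 0 < l \<Longrightarrow> \<exists>m. 0 \<le> m \<and> m \<le> 1 \<and>
      (\<integral>\<^sup>+t. ennreal (indicator {0..} t * exp (- l * t) * D t) \<partial>lborel) = ennreal (m / l) \<and>
      \<bar>cube_mean n (\<lambda>x. trap_weight l s (- \<beta> * h x - ln c)) - m * cube_mean n (\<lambda>x. trap_weight l 0 (- \<beta> * h x - ln c))\<bar>
        \<le> (green n 1 + 1 / 2 ^ n) * cube_mean n (\<lambda>x. trap_weight l 0 (- \<beta> * h x - ln c))
          + pair_energy n (\<lambda>x. trap_weight l 0 (- \<beta> * h x - ln c))"
proof -
  obtain J T where ch: "jump_chain P (cube n) (pmf (pmf_of_set (cube n))) (jump_prob (cube n) (hop_rate n \<beta> h)) (\<lambda>x. c / tau \<beta> (h x)) J T"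
    and corr: "\<And>t s. 0 \<le> t \<Longrightarrow> 0 < s \<Longrightarrow> correlation n c P X t s = measure P (jump_chain.no_jump P T t s)"
    using hop_process_chain[OF n c mjp] by blast
  let ?r = "\<lambda>x. c / tau \<beta> (h x)"
  interpret jump_chain P "cube n" "pmf (pmf_of_set (cube n))" "jump_prob (cube n) (hop_rate n \<beta> h)" ?r J T
    by (rule ch)
  define z where "z x = - \<beta> * h x - ln c" for x
  have r: "?r x = exp (- z x)" for x
    using c by (simp add: z_def tau_def exp_add exp_minus field_simps)
  show ?thesis
  proof (rule that[of "\<lambda>t. prob (no_jump t s)"])
    show "(\<lambda>t. prob (no_jump t s)) \<in> borel_measurable borel" by (rule no_jump_measurable[OF s])
    show "prob (no_jump t s) = correlation n c P X t s" if "0 \<le> t" for t using corr[OF that s] by simp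
    show "prob (no_jump t s) \<le> prob (no_jump t' s) + 2 / s * (t' - t)" if "0 \<le> t" "t \<le> t'" for t t'
      by (rule no_jump_onesided[OF that s])
    fix l :: real assume l: "0 < l"
    obtain u where u: "\<And>x. x \<in> cube n \<Longrightarrow> 0 \<le> u x" "\<And>x. x \<in> cube n \<Longrightarrow> u x \<le> 1"
      and ueq: "\<And>x. x \<in> cube n \<Longrightarrow> u x = l / (l + ?r x) * exp (- ?r x * s) +
          (1 - l / (l + ?r x)) * (\<Sum>y\<in>cube n. jump_prob (cube n) (hop_rate n \<beta> h) x y * u y)"
      and lap: "(\<integral>\<^sup>+t. ennreal (indicator {0..} t * exp (- l * t) * prob (no_jump t s)) \<partial>lborel) =
          ennreal ((\<Sum>x\<in>cube n. pmf (pmf_of_set (cube n)) x * u x) / l)"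
      using no_jump_laplace[OF s l] by blast
    have mean: "(\<Sum>x\<in>cube n. pmf (pmf_of_set (cube n)) x * u x) = cube_mean n u"
      unfolding cube_mean_def sum_divide_distrib
      by (rule sum.cong[OF refl]) (simp add: pmf_of_set[OF cube_nonempty finite_cube] card_cube)
    have m0: "0 \<le> cube_mean n u" unfolding cube_mean_def using u by (intro divide_nonneg_nonneg sum_nonneg) auto
    have "(\<Sum>x\<in>cube n. u x) \<le> (\<Sum>x\<in>cube n. 1)" using u by (intro sum_mono) auto
    then have m1: "cube_mean n u \<le> 1" unfolding cube_mean_def by (simp add: card_cube)
    \<comment> \<open>The killing probability at x, as a function of the logarithmic depth; it is
      the trap weight without the survival factor.\<close>
    define \<phi> where "\<phi> x = trap_weight l 0 (z x)" for x
    have phi: "\<phi> x = l / (l + exp (- z x))" for x by (simp add: \<phi>_def trap_weight_def)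
    have phi01: "0 \<le> \<phi> x" "\<phi> x \<le> 1" for x
      using l unfolding phi by (auto intro!: divide_nonneg_nonneg add_nonneg_nonneg simp: pos_divide_le_eq add_pos_pos)
    have "\<bar>cube_mean n (\<lambda>x. \<phi> x * exp (- s * exp (- z x))) - cube_mean n u * cube_mean n \<phi>\<bar>
      \<le> (green n 1 + 1 / 2 ^ n) * cube_mean n \<phi> + pair_energy n \<phi>"
    proof (rule killed_mean_approx[OF n phi01 _ _ u])
      fix x assume x: "x \<in> cube n"
      show "u x = \<phi> x * exp (- s * exp (- z x)) + (1 - \<phi> x) * nbr_avg n u x"
        using ueq[OF x] unfolding sum_jump_prob_hop[OF x n] r phi by (simp add: mult.commute)
    qed (use s in auto)
    moreover have "(\<lambda>x. \<phi> x * exp (- s * exp (- z x))) = (\<lambda>x. trap_weight l s (z x))"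
      by (simp add: phi trap_weight_def)
    ultimately have "\<bar>cube_mean n (\<lambda>x. trap_weight l s (z x)) - cube_mean n u * cube_mean n (\<lambda>x. trap_weight l 0 (z x))\<bar>
      \<le> (green n 1 + 1 / 2 ^ n) * cube_mean n (\<lambda>x. trap_weight l 0 (z x)) + pair_energy n (\<lambda>x. trap_weight l 0 (z x))"
      by (simp add: \<phi>_def[abs_def])
    then show "\<exists>m. 0 \<le> m \<and> m \<le> 1 \<and>
      (\<integral>\<^sup>+t. ennreal (indicator {0..} t * exp (- l * t) * prob (no_jump t s)) \<partial>lborel) = ennreal (m / l) \<and>
      \<bar>cube_mean n (\<lambda>x. trap_weight l s (- \<beta> * h x - ln c)) - m * cube_mean n (\<lambda>x. trap_weight l 0 (- \<beta> * h x - ln c))\<bar>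
        \<le> (green n 1 + 1 / 2 ^ n) * cube_mean n (\<lambda>x. trap_weight l 0 (- \<beta> * h x - ln c))
          + pair_energy n (\<lambda>x. trap_weight l 0 (- \<beta> * h x - ln c))"
      using m0 m1 lap mean by (intro exI[of _ "cube_mean n u"]) (simp add: z_def)
  qed auto
qed

section \<open>Aging\<close>

text \<open>The hypotheses of the inversion theorem as a property of a single function, since the
  correlation as a function of t varies with n and with the environment.\<close>

definition admissible :: "real \<Rightarrow> (real \<Rightarrow> real) \<Rightarrow> bool" where
  "admissible C D \<longleftrightarrow> D \<in> borel_measurable borel \<and> (\<forall>t. 0 \<le> D t \<and> D t \<le> 1) \<and>
     (\<forall>t t'. 0 \<le> t \<longrightarrow> t \<le> t' \<longrightarrow> D t \<le> D t' + C * (t' - t))"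

definition transform :: "nat \<Rightarrow> (real \<Rightarrow> real) \<Rightarrow> real" where
  "transform k D = (\<integral>r. exp (- r) ^ k * D r \<partial>exp_law)"

text \<open>Finitely many transforms determine the value at t up to \<delta>, uniformly over
  admissible functions. This form separates probability from analysis: it remains to control
  finitely many random numbers. Counterexamples for the first N transforms and tolerance 1 / (N + 1)
  would form a sequence contradicting \<open>laplace_inversion\<close>.\<close>

lemma laplace_inversion_uniform:
  assumes G_meas: "G \<in> borel_measurable borel" and G01: "\<And>t. 0 \<le> G t" "\<And>t. G t \<le> 1"
    and G_cont: "continuous_on {0..} G" and G0: "G 0 = 0" and t: "0 \<le> t" and \<delta>: "0 < \<delta>"
  shows "\<exists>N \<eta>. 0 < \<eta> \<and> (\<forall>D. admissible C D \<longrightarrow> (\<forall>k<N. \<bar>transform k D - transform k G\<bar> < \<eta>) \<longrightarrow> \<bar>D t - G t\<bar> < \<delta>)"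
proof (rule ccontr)
  assume "\<not> ?thesis"
  then have neg: "\<not> (\<forall>D. admissible C D \<longrightarrow> (\<forall>k<N. \<bar>transform k D - transform k G\<bar> < \<eta>) \<longrightarrow> \<bar>D t - G t\<bar> < \<delta>)"
    if "0 < \<eta>" for N :: nat and \<eta> using that by blast
  have "\<exists>D. admissible C D \<and> (\<forall>k<N. \<bar>transform k D - transform k G\<bar> < 1 / real (Suc N)) \<and> \<not> \<bar>D t - G t\<bar> < \<delta>" for N
  proof -
    have "0 < 1 / real (Suc N)" by simp
    from neg[OF this, of N] show ?thesis by blast
  qed
  then have "\<forall>N. \<exists>D. admissible C D \<and> (\<forall>k<N. \<bar>transform k D - transform k G\<bar> < 1 / real (Suc N)) \<and> \<not> \<bar>D t - G t\<bar> < \<delta>" ..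
  from choice[OF this] obtain D where DD: "\<forall>N. admissible C (D N) \<and> (\<forall>k<N. \<bar>transform k (D N) - transform k G\<bar> < 1 / real (Suc N)) \<and> \<not> \<bar>D N t - G t\<bar> < \<delta>" ..
  have D: "admissible C (D N)" "k < N \<Longrightarrow> \<bar>transform k (D N) - transform k G\<bar> < 1 / real (Suc N)"
    "\<not> \<bar>D N t - G t\<bar> < \<delta>" for N k
    using DD by blast+
  have "(\<lambda>N. D N t) \<longlonglongrightarrow> G t"
  proof (rule laplace_inversion[of D G C, OF _ G_meas _ _ G01 _ G_cont G0 _ t])
    fix k
    show "(\<lambda>N. \<integral>r. exp (- r) ^ k * D N r \<partial>exp_law) \<longlonglongrightarrow> (\<integral>r. exp (- r) ^ k * G r \<partial>exp_law)"
      unfolding transform_def[symmetric]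
    proof (rule LIM_zero_cancel, rule Lim_null_comparison)
      show "(\<lambda>N. 1 / real (Suc N)) \<longlonglongrightarrow> 0" using LIMSEQ_inverse_real_of_nat by (simp add: inverse_eq_divide)
      show "eventually (\<lambda>N. norm (transform k (D N) - transform k G) \<le> 1 / real (Suc N)) sequentially"
        using eventually_gt_at_top[of k] by eventually_elim (simp only: real_norm_def less_imp_le[OF D(2)])
    qed
  qed (use D(1) in \<open>auto simp: admissible_def\<close>)
  then have "eventually (\<lambda>N. \<bar>D N t - G t\<bar> < \<delta>) sequentially"
    using \<delta> by (auto dest!: tendstoD simp: dist_real_def)
  then show False using D(3) by (auto simp: eventually_sequentially)
qed

section \<open>Transforms of the limiting profile\<close>

lemma transform_eq:
  assumes D[measurable]: "D \<in> borel_measurable borel" and nn: "\<And>t. 0 \<le> D t" and z: "0 \<le> z"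
    and lap: "(\<integral>\<^sup>+t. ennreal (indicator {0..} t * exp (- real (Suc k) * t) * D t) \<partial>lborel) = ennreal z"
  shows "transform k D = z"
proof -
  have "(\<integral>\<^sup>+r. ennreal (exp (- r) ^ k * D r) \<partial>exp_law) =
      (\<integral>\<^sup>+t. ennreal (indicator {0..} t * exp (- real (Suc k) * t) * D t) \<partial>lborel)"
  proof (subst nn_integral_density)
    show "(\<integral>\<^sup>+x. ennreal (exponential_density 1 x) * ennreal (exp (- x) ^ k * D x) \<partial>lborel) =
      (\<integral>\<^sup>+t. ennreal (indicator {0..} t * exp (- real (Suc k) * t) * D t) \<partial>lborel)"
    proof (rule nn_integral_cong)
      fix x :: real
      have "exp (- real (Suc k) * x) = exp (- x) * exp (- x) ^ k"
        by (simp add: exp_of_nat_mult[symmetric] exp_add[symmetric] algebra_simps)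
      then show "ennreal (exponential_density 1 x) * ennreal (exp (- x) ^ k * D x) =
          ennreal (indicator {0..} x * exp (- real (Suc k) * x) * D x)"
        using nn by (auto simp: exponential_density_def ennreal_mult'[symmetric] mult_ac split: split_indicator)
    qed
  qed auto
  then have "(\<integral>\<^sup>+r. ennreal (exp (- r) ^ k * D r) \<partial>exp_law) = ennreal z" using lap by simp
  then have "transform k D = enn2real (ennreal z)"
    unfolding transform_def using nn by (subst integral_eq_nn_integral) auto
  then show ?thesis using z by simp
qed

text \<open>Set to 0 for negative t, where the quotient may leave the unit interval, so that the
  bounds hold on the whole line.\<close>

definition aging :: "real \<Rightarrow> real \<Rightarrow> real \<Rightarrow> real" where
  "aging \<alpha> s t = (if 0 \<le> t then Asl \<alpha> (t / (t + s)) else 0)"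

definition trap_integral :: "real \<Rightarrow> real \<Rightarrow> real \<Rightarrow> real" where
  "trap_integral \<alpha> l s = (\<integral>x. trap_weight l s x * exp (- \<alpha> * x) \<partial>lborel)"

context
  fixes \<alpha> s :: real
  assumes \<alpha>: "0 < \<alpha>" "\<alpha> < 1" and s: "0 < s"
begin

lemma ratio_in: "0 \<le> t \<Longrightarrow> t / (t + s) \<in> {0..1}"
  using s by auto

lemma aging_bounds: "0 \<le> aging \<alpha> s t" "aging \<alpha> s t \<le> 1"
  using Asl_nonneg[OF \<alpha> ratio_in] Asl_le_1[OF \<alpha> ratio_in] by (auto simp: aging_def)

lemma aging_0: "aging \<alpha> s 0 = 0"
  by (simp add: aging_def Asl_0)

lemma aging_continuous: "continuous_on {0..} (aging \<alpha> s)"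
proof -
  have "continuous_on {0..} (\<lambda>t. Asl \<alpha> (t / (t + s)))"
    by (rule continuous_on_compose2[OF Asl_continuous[OF \<alpha>]])
       (use s ratio_in in \<open>auto intro!: continuous_intros\<close>)
  then show ?thesis by (rule continuous_on_eq) (simp add: aging_def)
qed

lemma aging_measurable: "aging \<alpha> s \<in> borel_measurable borel"
proof -
  have "(\<lambda>t. if t \<in> {0..} then aging \<alpha> s t else 0) \<in> borel_measurable borel"
    by (rule borel_measurable_continuous_on_if) (use aging_continuous in auto)
  moreover have "(\<lambda>t. if t \<in> {0..} then aging \<alpha> s t else 0) = aging \<alpha> s" by (auto simp: aging_def)
  ultimately show ?thesis by simp
qed

lemma trap_integral_nonneg: "0 < l \<Longrightarrow> 0 \<le> trap_integral \<alpha> l u"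
  unfolding trap_integral_def using trap_weight_nonneg by (intro Bochner_Integration.integral_nonneg) auto

lemma transform_aging: "transform k (aging \<alpha> s) = trap_integral \<alpha> (real (Suc k)) s / (real (Suc k) * trap_integral \<alpha> (real (Suc k)) 0)"
proof (rule transform_eq[OF aging_measurable aging_bounds(1)])
  have l: "0 < real (Suc k)" by simp
  show "0 \<le> trap_integral \<alpha> (real (Suc k)) s / (real (Suc k) * trap_integral \<alpha> (real (Suc k)) 0)"
    using trap_integral_nonneg[OF l] l by (intro divide_nonneg_nonneg mult_nonneg_nonneg) auto
  have "(\<integral>\<^sup>+t. ennreal (indicator {0..} t * exp (- real (Suc k) * t) * aging \<alpha> s t) \<partial>lborel) =
     (\<integral>\<^sup>+t. ennreal (indicator {0..} t * exp (- real (Suc k) * t) * Asl \<alpha> (t / (t + s))) \<partial>lborel)"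
    by (intro nn_integral_cong) (auto simp: aging_def split: split_indicator)
  then show "(\<integral>\<^sup>+t. ennreal (indicator {0..} t * exp (- real (Suc k) * t) * aging \<alpha> s t) \<partial>lborel) =
     ennreal (trap_integral \<alpha> (real (Suc k)) s / (real (Suc k) * trap_integral \<alpha> (real (Suc k)) 0))"
    unfolding trap_integral_def nn_integral_laplace_Asl[OF \<alpha> l s] .
qed

end

text \<open>The error in m B - A consists of e from A', at most e (B + 1) from d B', e from W and e
  from m (B' - B); this is the origin of B + 4.\<close>

lemma ratio_stable:
  fixes A B A' B' W d m e :: real
  assumes "\<bar>A' - A\<bar> \<le> e" "\<bar>B' - B\<bar> \<le> e" "W \<le> e" "d \<le> e" "e \<le> 1" "0 \<le> m" "m \<le> 1" "0 < B" "0 \<le> B'"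
    and "\<bar>A' - m * B'\<bar> \<le> d * B' + W"
  shows "\<bar>m - A / B\<bar> \<le> e * (B + 4) / B"
proof -
  have e0: "0 \<le> e" using assms(1) by linarith
  have "\<bar>m * (B' - B)\<bar> \<le> 1 * e"
    unfolding abs_mult using assms by (intro mult_mono) auto
  moreover have "d * B' \<le> e * (B + 1)"
  proof -
    have "d * B' \<le> e * B'" using assms by (intro mult_right_mono) auto
    also have "\<dots> \<le> e * (B + 1)" using assms e0 by (intro mult_left_mono) auto
    finally show ?thesis .
  qed
  moreover have "m * B - A = (A' - A) - (A' - m * B') - m * (B' - B)" by (simp add: algebra_simps)
  moreover have "e * (B + 4) = e + (e * (B + 1) + e) + e" by (simp add: algebra_simps)
  ultimately have "\<bar>m * B - A\<bar> \<le> e * (B + 4)"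
    using assms(1,3,10) by linarith
  moreover have "m - A / B = (m * B - A) / B" using assms by (simp add: field_simps)
  ultimately show ?thesis using assms by (simp add: divide_right_mono)
qed

section \<open>Concentration of the sums over the environment\<close>

locale random_environment = prob_space M for M :: "'w measure" +
  fixes H :: "nat \<Rightarrow> (nat \<Rightarrow> real) \<Rightarrow> 'w \<Rightarrow> real" and a c :: "nat \<Rightarrow> real" and \<epsilon> \<beta> :: real
  assumes gaussian: "\<And>n x. n \<ge> 1 \<Longrightarrow> x \<in> cube n \<Longrightarrow>
          distributed M lborel (H n x) (normal_density 0 (sqrt (real n)))"
    and indep: "\<And>n. n \<ge> 1 \<Longrightarrow> indep_vars (\<lambda>_. borel) (H n) (cube n)"
    and c_diverges: "filterlim c at_top sequentially"
    and a_def: "\<And>n x. n \<ge> 1 \<Longrightarrow> x \<in> cube n \<Longrightarrow>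
          a n * prob {\<omega> \<in> space M. tau \<beta> (H n x \<omega>) \<ge> c n} = 1"
    and scale: "intermediate_scale \<epsilon> a"
    and \<beta>_pos: "0 < \<beta>" and \<alpha>: "0 < alpha \<epsilon> \<beta>" "alpha \<epsilon> \<beta> < 1"
begin

definition depth :: "nat \<Rightarrow> real \<Rightarrow> real \<Rightarrow> (nat \<Rightarrow> real) \<Rightarrow> 'w \<Rightarrow> real" where
  "depth n l s x \<omega> = trap_weight l s (- \<beta> * H n x \<omega> - ln (c n))"

definition gauss_const :: "nat \<Rightarrow> real" where
  "gauss_const n = exp (- (ln (c n))\<^sup>2 / (2 * real n * \<beta>\<^sup>2)) / (\<beta> * sqrt (2 * pi * real n))"

definition tilt :: "nat \<Rightarrow> (real \<Rightarrow> real) \<Rightarrow> real" where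
  "tilt n F = gauss_tilt (1 / (2 * real n * \<beta>\<^sup>2)) (ln (c n) / (real n * \<beta>\<^sup>2)) F"

definition mean_depth :: "nat \<Rightarrow> real \<Rightarrow> real \<Rightarrow> real" where
  "mean_depth n l s = gauss_const n * tilt n (trap_weight l s)"

lemma \<epsilon>_pos: "0 < \<epsilon>" using scale by (simp add: intermediate_scale_def)

lemma a_pos:
  assumes n: "1 \<le> n" shows "0 < a n"
proof -
  obtain x where "x \<in> cube n" using cube_nonempty by blast
  from a_def[OF n this] show ?thesis
    using measure_nonneg[of M "{\<omega> \<in> space M. tau \<beta> (H n x \<omega>) \<ge> c n}"]
    by (metis zero_less_mult_pos2 less_eq_real_def mult_zero_right zero_less_one zero_neq_one)
qed

lemma H_measurable: "1 \<le> n \<Longrightarrow> x \<in> cube n \<Longrightarrow> H n x \<in> borel_measurable M"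
  using distributed_measurable[OF gaussian] by simp

lemma expectation_depth:
  assumes "1 \<le> n" "x \<in> cube n" shows "expectation (depth n l s x) = mean_depth n l s"
  unfolding depth_def[abs_def] mean_depth_def gauss_const_def tilt_def
  by (rule expectation_gaussian_tilt[OF gaussian[OF assms] assms(1) \<beta>_pos trap_weight_measurable])

text \<open>The definition of \<open>a n\<close> in terms of the tilted half-line integral. It
  serves twice: to identify the limiting tilt and to eliminate the Gaussian prefactor.\<close>

lemma tail_eq:
  assumes n: "1 \<le> n" and c: "0 < c n"
  shows "a n * (gauss_const n * tilt n (indicator {0..})) = 1"
proof -
  obtain x where x: "x \<in> cube n" using cube_nonempty by blast
  have [measurable]: "H n x \<in> borel_measurable M" by (rule H_measurable[OF n x])
  have "gauss_const n * tilt n (indicator {0..}) = expectation (\<lambda>\<omega>. indicator {0..} (- \<beta> * H n x \<omega> - ln (c n)))"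
    unfolding gauss_const_def tilt_def
    by (rule expectation_gaussian_tilt[OF gaussian[OF n x] n \<beta>_pos, symmetric]) simp
  also have "\<dots> = expectation (indicator {\<omega> \<in> space M. tau \<beta> (H n x \<omega>) \<ge> c n})"
  proof (rule Bochner_Integration.integral_cong[OF refl])
    fix \<omega> assume "\<omega> \<in> space M"
    moreover have "c n \<le> tau \<beta> (H n x \<omega>) \<longleftrightarrow> ln (c n) \<le> - \<beta> * H n x \<omega>"
      unfolding tau_def using c by (metis exp_le_cancel_iff exp_ln)
    ultimately show "indicator {0..} (- \<beta> * H n x \<omega> - ln (c n)) = (indicator {\<omega> \<in> space M. tau \<beta> (H n x \<omega>) \<ge> c n} \<omega> :: real)"
      by (auto split: split_indicator)
  qed
  also have "\<dots> = prob {\<omega> \<in> space M. tau \<beta> (H n x \<omega>) \<ge> c n}"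
    by (simp add: tau_def)
  finally show ?thesis using a_def[OF n x] by simp
qed

lemma eventually_scale: "eventually (\<lambda>n. 1 \<le> n \<and> 0 < c n) sequentially"
  using eventually_ge_at_top[of "1::nat"] filterlim_at_top_dense[THEN iffD1, OF c_diverges, rule_format, of 0]
  by eventually_elim simp

lemma log_a_tendsto: "(\<lambda>n. ln (a n) / (real n * ln 2)) \<longlonglongrightarrow> \<epsilon>"
  using scale by (simp add: intermediate_scale_def)

lemma \<theta>_tendsto: "(\<lambda>n. ln (c n) / (real n * \<beta>\<^sup>2)) \<longlonglongrightarrow> alpha \<epsilon> \<beta>"
  by (rule tilt_tendsto_alpha[OF \<beta>_pos \<epsilon>_pos c_diverges _ log_a_tendsto])
     (rule tail_eq[unfolded gauss_const_def tilt_def])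

text \<open>By \<open>tail_eq\<close> the rescaled mean is a quotient of two tilted integrals with
  the same prefactor, which cancels. The half-line integral tends to 1 / \<alpha>, hence the factor
  \<alpha> in the limit.\<close>

lemma scaled_mean_depth_tendsto:
  assumes l: "0 < l" and s: "0 \<le> s"
  shows "(\<lambda>n. a n * mean_depth n l s) \<longlonglongrightarrow> alpha \<epsilon> \<beta> * trap_integral (alpha \<epsilon> \<beta>) l s"
proof -
  have b: "(\<lambda>n. 1 / (2 * real n * \<beta>\<^sup>2)) \<longlonglongrightarrow> 0" using \<beta>_pos by real_asymp
  have b0: "0 \<le> 1 / (2 * real n * \<beta>\<^sup>2)" for n by simp
  have "(\<lambda>n. tilt n (trap_weight l s) / tilt n (indicator {0..})) \<longlonglongrightarrow> trap_integral (alpha \<epsilon> \<beta>) l s / (1 / alpha \<epsilon> \<beta>)"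
    unfolding tilt_def trap_integral_def
    by (intro tendsto_divide gauss_tilt_trap_weight[OF \<alpha> l s \<theta>_tendsto b b0] gauss_tilt_Ici[OF \<alpha>(1) \<theta>_tendsto b b0])
       (use \<alpha> in simp)
  moreover have "eventually (\<lambda>n. tilt n (trap_weight l s) / tilt n (indicator {0..}) = a n * mean_depth n l s) sequentially"
    using eventually_scale
  proof eventually_elim
    case (elim n)
    have t: "a n * (gauss_const n * tilt n (indicator {0..})) = 1" using elim by (intro tail_eq) auto
    then have "tilt n (indicator {0..}) \<noteq> 0" by auto
    then show ?case using t unfolding mean_depth_def by (simp add: field_simps)
  qed
  ultimately have "(\<lambda>n. a n * mean_depth n l s) \<longlonglongrightarrow> trap_integral (alpha \<epsilon> \<beta>) l s / (1 / alpha \<epsilon> \<beta>)"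
    by (rule Lim_transform_eventually)
  then show ?thesis by (simp add: mult.commute)
qed

lemma depth_bounds:
  assumes "0 < l" "0 \<le> s" shows "0 \<le> depth n l s x \<omega>" "depth n l s x \<omega> \<le> 1"
proof -
  show "0 \<le> depth n l s x \<omega>" unfolding depth_def by (rule trap_weight_nonneg[OF assms(1)])
  show "depth n l s x \<omega> \<le> 1" unfolding depth_def trap_weight_def
    using assms by (intro mult_le_one) (auto intro!: divide_nonneg_nonneg add_nonneg_nonneg simp: pos_divide_le_eq add_pos_pos)
qed

lemma indep_depth: "1 \<le> n \<Longrightarrow> indep_vars (\<lambda>_. borel) (depth n l s) (cube n)"
  unfolding depth_def[abs_def]
  by (rule indep_vars_compose2[OF indep, of n "\<lambda>_ h. trap_weight l s (- \<beta> * h - ln (c n))"]) auto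

abbreviation "mean n l s \<omega> \<equiv> cube_mean n (\<lambda>x. depth n l s x \<omega>)"

abbreviation "energy n l \<omega> \<equiv> pair_energy n (\<lambda>x. depth n l 0 x \<omega>)"

abbreviation "approx n l s \<omega> m \<equiv>
  \<bar>mean n l s \<omega> - m * mean n l 0 \<omega>\<bar> \<le> (green n 1 + 1 / 2 ^ n) * mean n l 0 \<omega> + energy n l \<omega>"

text \<open>The three ways in which the quotient can fail: a deviating numerator, a deviating
  denominator, interacting traps. The time t does not occur, so one exceptional set serves all
  t.\<close>

definition bad :: "nat \<Rightarrow> real \<Rightarrow> real \<Rightarrow> real \<Rightarrow> 'w set" where
  "bad n l s \<eta> =
    {\<omega> \<in> space M. \<eta> \<le> \<bar>a n * mean n l s \<omega> - a n * mean_depth n l s\<bar>} \<union>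
    {\<omega> \<in> space M. \<eta> \<le> \<bar>a n * mean n l 0 \<omega> - a n * mean_depth n l 0\<bar>} \<union>
    {\<omega> \<in> space M. \<eta> \<le> a n * energy n l \<omega>}"

lemma bad_antimono: "\<eta> \<le> \<eta>' \<Longrightarrow> bad n l s \<eta>' \<subseteq> bad n l s \<eta>"
  unfolding bad_def by auto

lemma bad_small:
  assumes l: "0 < l" and s: "0 < s" and \<eta>: "0 < \<eta>"
  obtains B where "0 < B" "eventually (\<lambda>n. bad n l s \<eta> \<in> events \<and> prob (bad n l s \<eta>) \<le> B * (a n / 2 ^ n + (real n)\<^sup>2 / a n)) sequentially"
proof -
  have "convergent (\<lambda>n. a n * mean_depth n l s)"
    by (rule convergentI[OF scaled_mean_depth_tendsto[OF l]]) (use s in simp)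
  then have "Bseq (\<lambda>n. a n * mean_depth n l s)" by (rule convergent_imp_Bseq)
  then obtain B1 where B1: "\<forall>n. norm (a n * mean_depth n l s) \<le> B1" unfolding Bseq_def by blast
  have "convergent (\<lambda>n. a n * mean_depth n l 0)"
    by (rule convergentI[OF scaled_mean_depth_tendsto[OF l]]) simp
  then have "Bseq (\<lambda>n. a n * mean_depth n l 0)" by (rule convergent_imp_Bseq)
  then obtain B2 where B2: "\<forall>n. norm (a n * mean_depth n l 0) \<le> B2" unfolding Bseq_def by blast
  note B = B1[unfolded real_norm_def, rule_format] B2[unfolded real_norm_def, rule_format]
  have B0: "0 \<le> B1" "0 \<le> B2" using B(1)[of 0] B(2)[of 0] by linarith+
  \<comment> \<open>The two Chebyshev constants and the Markov constant; the added 1 makes the sum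
    positive.\<close>
  define K where "K = B1 / \<eta>\<^sup>2 + B2 / \<eta>\<^sup>2 + 2 * B2\<^sup>2 / \<eta> + 1"
  have "0 < K" unfolding K_def using B0 \<eta> by (intro add_nonneg_pos add_nonneg_nonneg divide_nonneg_nonneg) auto
  moreover have "eventually (\<lambda>n. bad n l s \<eta> \<in> events \<and> prob (bad n l s \<eta>) \<le> K * (a n / 2 ^ n + (real n)\<^sup>2 / a n)) sequentially"
    using eventually_ge_at_top[of "1::nat"]
  proof eventually_elim
    case (elim n)
    note an = a_pos[OF elim]
    have s0: "0 \<le> s" using s by simp
    let ?A = "{\<omega> \<in> space M. \<eta> \<le> \<bar>a n * mean n l s \<omega> - a n * mean_depth n l s\<bar>}"
    let ?B = "{\<omega> \<in> space M. \<eta> \<le> \<bar>a n * mean n l 0 \<omega> - a n * mean_depth n l 0\<bar>}"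
    let ?C = "{\<omega> \<in> space M. \<eta> \<le> a n * energy n l \<omega>}"
    note A = cube_mean_concentration[OF indep_depth[OF elim] depth_bounds[OF l s0] expectation_depth[OF elim] an \<eta>]
    note B' = cube_mean_concentration[OF indep_depth[OF elim] depth_bounds[OF l order_refl] expectation_depth[OF elim] an \<eta>]
    note C = pair_energy_concentration[OF indep_depth[OF elim] depth_bounds[OF l order_refl] expectation_depth[OF elim] an \<eta>]
    have Am: "?A \<in> events" and Bm: "?B \<in> events" and Cm: "?C \<in> events"
      by (rule A(1) B'(1) C(1); assumption)+
    have r: "0 \<le> a n / 2 ^ n" "0 \<le> (real n)\<^sup>2 / a n" using an by auto
    have "prob ?A \<le> a n / 2 ^ n * (a n * mean_depth n l s) / \<eta>\<^sup>2" by (rule A(2))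
    also have "\<dots> \<le> a n / 2 ^ n * B1 / \<eta>\<^sup>2"
      using B(1)[of n] r by (intro divide_right_mono mult_left_mono) auto
    finally have pA: "prob ?A \<le> B1 / \<eta>\<^sup>2 * (a n / 2 ^ n)" by (simp add: mult_ac)
    have "prob ?B \<le> a n / 2 ^ n * (a n * mean_depth n l 0) / \<eta>\<^sup>2" by (rule B'(2))
    also have "\<dots> \<le> a n / 2 ^ n * B2 / \<eta>\<^sup>2"
      using B(2)[of n] r by (intro divide_right_mono mult_left_mono) auto
    finally have pB: "prob ?B \<le> B2 / \<eta>\<^sup>2 * (a n / 2 ^ n)" by (simp add: mult_ac)
    have "prob ?C \<le> 2 * (real n)\<^sup>2 / a n * (a n * mean_depth n l 0)\<^sup>2 / \<eta>" by (rule C(2))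
    also have "\<dots> \<le> 2 * (real n)\<^sup>2 / a n * B2\<^sup>2 / \<eta>"
      using B(2)[of n] an \<eta> B0 by (intro divide_right_mono mult_left_mono) (auto simp: abs_le_square_iff[symmetric])
    finally have pC: "prob ?C \<le> 2 * B2\<^sup>2 / \<eta> * ((real n)\<^sup>2 / a n)" by (simp add: mult_ac)
    have "prob (bad n l s \<eta>) \<le> prob ?A + prob ?B + prob ?C"
      unfolding bad_def using Am Bm Cm
      by (intro order_trans[OF measure_Un_le] add_mono measure_Un_le) auto
    also have "\<dots> \<le> (B1 / \<eta>\<^sup>2 + B2 / \<eta>\<^sup>2) * (a n / 2 ^ n) + 2 * B2\<^sup>2 / \<eta> * ((real n)\<^sup>2 / a n)"
      using pA pB pC unfolding distrib_right by linarith
    also have "\<dots> \<le> K * (a n / 2 ^ n) + K * ((real n)\<^sup>2 / a n)"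
      using r B0 \<eta> by (intro add_mono mult_right_mono) (auto simp: K_def)
    finally show ?case using Am Bm Cm by (auto simp: bad_def distrib_left)
  qed
  ultimately show ?thesis by (rule that)
qed

lemma square_over_a_summable: "summable (\<lambda>n. (real n)\<^sup>2 / a n)"
proof (rule summable_square_over_growth)
  show "0 < \<epsilon> * ln 2 / 2" using \<epsilon>_pos by simp
  show "eventually (\<lambda>n. exp (\<epsilon> * ln 2 / 2 * real n) \<le> a n) sequentially"
    by (rule eventually_exponential_growth[OF log_a_tendsto \<epsilon>_pos a_pos])
qed

text \<open>A deterministic statement: off the bad set any m satisfying the approximate linear
  equation is close to the quotient of the limits.\<close>

lemma good_ratio:
  assumes l: "0 < l" and s: "0 < s" and \<delta>: "0 < \<delta>"
  obtains \<eta> where "0 < \<eta>"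
    "eventually (\<lambda>n. \<forall>\<omega>\<in>space M - bad n l s \<eta>. \<forall>m. 0 \<le> m \<longrightarrow> m \<le> 1 \<longrightarrow>
      approx n l s \<omega> m \<longrightarrow>
      \<bar>m - trap_integral (alpha \<epsilon> \<beta>) l s / trap_integral (alpha \<epsilon> \<beta>) l 0\<bar> < \<delta>) sequentially"
proof -
  define A where "A = alpha \<epsilon> \<beta> * trap_integral (alpha \<epsilon> \<beta>) l s"
  define B where "B = alpha \<epsilon> \<beta> * trap_integral (alpha \<epsilon> \<beta>) l 0"
  have B: "0 < B" unfolding B_def trap_integral_def using trap_weight_integral_0_pos[OF \<alpha> l] \<alpha> by simp
  have ratio: "A / B = trap_integral (alpha \<epsilon> \<beta>) l s / trap_integral (alpha \<epsilon> \<beta>) l 0"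
    unfolding A_def B_def using \<alpha> by simp
  \<comment> \<open>Chosen so that e (B + 4) / B < \<delta> in \<open>ratio_stable\<close>. Half of
    e is spent on the fluctuations, half on the convergence of the means.\<close>
  define e where "e = min 1 (\<delta> * B / (2 * (B + 4)))"
  have e: "0 < e" "e \<le> 1" using B \<delta> by (auto simp: e_def)
  have "e * (B + 4) \<le> \<delta> * B / (2 * (B + 4)) * (B + 4)"
    unfolding e_def using B by (intro mult_right_mono) auto
  also have "\<dots> = \<delta> * B / 2" using B by (simp add: field_simps)
  also have "\<dots> < \<delta> * B" using B \<delta> by simp
  finally have small: "e * (B + 4) / B < \<delta>" using B by (simp only: pos_divide_less_eq)
  have evA: "eventually (\<lambda>n. \<bar>a n * mean_depth n l s - A\<bar> < e / 2) sequentially"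
    using tendstoD[OF scaled_mean_depth_tendsto[OF l, of s], of "e / 2"] e s by (simp add: dist_real_def A_def)
  have evB: "eventually (\<lambda>n. \<bar>a n * mean_depth n l 0 - B\<bar> < e / 2) sequentially"
    using tendstoD[OF scaled_mean_depth_tendsto[OF l, of 0], of "e / 2"] e by (simp add: dist_real_def B_def)
  have "(\<lambda>n. green n 1 + 1 / 2 ^ n) \<longlonglongrightarrow> 0 + 0"
    by (intro tendsto_add green_one_tendsto) real_asymp
  then have evG: "eventually (\<lambda>n. green n 1 + 1 / 2 ^ n < e) sequentially"
    using e by (intro order_tendstoD(2)) auto
  have "eventually (\<lambda>n. \<forall>\<omega>\<in>space M - bad n l s (e / 2). \<forall>m. 0 \<le> m \<longrightarrow> m \<le> 1 \<longrightarrow>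
      approx n l s \<omega> m \<longrightarrow>
      \<bar>m - trap_integral (alpha \<epsilon> \<beta>) l s / trap_integral (alpha \<epsilon> \<beta>) l 0\<bar> < \<delta>) sequentially"
    using evA evB evG eventually_ge_at_top[of "1::nat"]
  proof eventually_elim
    case (elim n)
    show ?case
    proof (intro ballI allI impI)
      fix \<omega> m assume \<omega>: "\<omega> \<in> space M - bad n l s (e / 2)" and m: "0 \<le> m" "m \<le> 1"
        and app: "approx n l s \<omega> m"
      let ?A' = "a n * mean n l s \<omega>" and ?B' = "a n * mean n l 0 \<omega>"
        and ?W = "a n * energy n l \<omega>"
      note an = a_pos[OF elim(4)]
      have b: "\<bar>?A' - a n * mean_depth n l s\<bar> < e / 2" "\<bar>?B' - a n * mean_depth n l 0\<bar> < e / 2" "?W < e / 2"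
        using \<omega> by (auto simp: bad_def not_le)
      have "\<bar>m - A / B\<bar> \<le> e * (B + 4) / B"
      proof (rule ratio_stable[of ?A' A e ?B' B ?W "green n 1 + 1 / 2 ^ n" m])
        show "\<bar>?A' - A\<bar> \<le> e" using b(1) elim(1) by linarith
        show "\<bar>?B' - B\<bar> \<le> e" using b(2) elim(2) by linarith
        show "?W \<le> e" using b(3) e by linarith
        show "green n 1 + 1 / 2 ^ n \<le> e" using elim(3) by linarith
        show "0 \<le> ?B'" unfolding cube_mean_def using an depth_bounds(1)[OF l order_refl]
          by (intro mult_nonneg_nonneg divide_nonneg_nonneg sum_nonneg) auto
        have "\<bar>?A' - m * ?B'\<bar> = a n * \<bar>mean n l s \<omega> - m * mean n l 0 \<omega>\<bar>"
        proof -
          have "?A' - m * ?B' = a n * (mean n l s \<omega> - m * mean n l 0 \<omega>)"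
            by (simp add: algebra_simps)
          then show ?thesis using an by (simp only: abs_mult abs_of_pos)
        qed
        also have "\<dots> \<le> a n * ((green n 1 + 1 / 2 ^ n) * mean n l 0 \<omega> + energy n l \<omega>)"
          using app an by (intro mult_left_mono) auto
        also have "\<dots> = (green n 1 + 1 / 2 ^ n) * ?B' + ?W" by (simp add: distrib_left mult_ac)
        finally show "\<bar>?A' - m * ?B'\<bar> \<le> (green n 1 + 1 / 2 ^ n) * ?B' + ?W" .
      qed (use e B m in auto)
      then show "\<bar>m - trap_integral (alpha \<epsilon> \<beta>) l s / trap_integral (alpha \<epsilon> \<beta>) l 0\<bar> < \<delta>"
        using small unfolding ratio by linarith
    qed
  qed
  then show ?thesis using that[of "e / 2"] e by simp
qed

end

section \<open>Convergence of the correlation function\<close>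

locale trap_dynamics = random_environment M H a c \<epsilon> \<beta>
  for M :: "'w measure" and H a c \<epsilon> \<beta> +
  fixes P :: "nat \<Rightarrow> 'w \<Rightarrow> 'b measure" and X :: "nat \<Rightarrow> 'w \<Rightarrow> real \<Rightarrow> 'b \<Rightarrow> (nat \<Rightarrow> real)"
  assumes process: "\<And>n \<omega>. n \<ge> 1 \<Longrightarrow> \<omega> \<in> space M \<Longrightarrow>
          markov_jump_process (cube n) (hop_rate n \<beta> (\<lambda>x. H n x \<omega>))
            (pmf_of_set (cube n)) (P n \<omega>) (X n \<omega>)"
begin

abbreviation "corr n \<omega> t s \<equiv> correlation n (c n) (P n \<omega>) (X n \<omega>) t s"

abbreviation "limit t s \<equiv> Asl (alpha \<epsilon> \<beta>) (t / (t + s))"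

text \<open>All randomness is confined to finitely many bad sets with l = 1, ..., N; outside them
  the estimate holds uniformly in the environment.\<close>

lemma corr_near_limit:
  assumes t: "0 \<le> t" and s: "0 < s" and \<delta>: "0 < \<delta>"
  obtains N \<eta> where "0 < \<eta>"
    "eventually (\<lambda>n. \<forall>\<omega>\<in>space M. (\<forall>k<N. \<omega> \<notin> bad n (real (Suc k)) s \<eta>) \<longrightarrow> \<bar>corr n \<omega> t s - limit t s\<bar> < \<delta>) sequentially"
proof -
  let ?\<alpha> = "alpha \<epsilon> \<beta>"
  let ?R = "\<lambda>l. trap_integral ?\<alpha> l s / trap_integral ?\<alpha> l 0"
  obtain N \<eta>0 where N\<eta>0: "0 < \<eta>0 \<and> (\<forall>D. admissible (2 / s) D \<longrightarrow> (\<forall>k<N. \<bar>transform k D - transform k (aging ?\<alpha> s)\<bar> < \<eta>0) \<longrightarrow> \<bar>D t - aging ?\<alpha> s t\<bar> < \<delta>)"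
    using laplace_inversion_uniform[OF aging_measurable[OF \<alpha> s] aging_bounds[OF \<alpha> s] aging_continuous[OF \<alpha> s] aging_0[OF \<alpha> s] t \<delta>, of "2 / s"]
    by (elim exE)
  note \<eta>0 = N\<eta>0[THEN conjunct1] and inv = N\<eta>0[THEN conjunct2]
  let ?G = "\<lambda>k \<eta>. eventually (\<lambda>n. \<forall>\<omega>\<in>space M - bad n (real (Suc k)) s \<eta>. \<forall>m. 0 \<le> m \<longrightarrow> m \<le> 1 \<longrightarrow>
      approx n (real (Suc k)) s \<omega> m \<longrightarrow>
      \<bar>m - ?R (real (Suc k))\<bar> < \<eta>0) sequentially"
  have "\<exists>\<eta>. 0 < \<eta> \<and> ?G k \<eta>" for k
  proof -
    have "0 < real (Suc k)" by simp
    then show ?thesis by (rule good_ratio[OF _ s \<eta>0]) (intro exI conjI)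
  qed
  then have "\<forall>k. \<exists>\<eta>. 0 < \<eta> \<and> ?G k \<eta>" ..
  from choice[OF this] obtain f where f: "\<forall>k. 0 < f k \<and> ?G k (f k)" ..
  \<comment> \<open>One tolerance for all N transforms; the element 1 keeps the set nonempty when N
    = 0.\<close>
  define \<eta> where "\<eta> = Min (insert 1 (f ` {..<N}))"
  have \<eta>: "0 < \<eta>" unfolding \<eta>_def using f by (subst Min_gr_iff) auto
  have \<eta>_le: "\<eta> \<le> f k" if "k < N" for k unfolding \<eta>_def using that by (intro Min_le) auto
  have ev: "eventually (\<lambda>n. \<forall>k\<in>{..<N}. \<forall>\<omega>\<in>space M - bad n (real (Suc k)) s (f k). \<forall>m. 0 \<le> m \<longrightarrow> m \<le> 1 \<longrightarrow>
      approx n (real (Suc k)) s \<omega> m \<longrightarrow>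
      \<bar>m - ?R (real (Suc k))\<bar> < \<eta>0) sequentially"
    by (rule eventually_ball_finite[OF finite_lessThan ballI]) (rule f[rule_format, THEN conjunct2])
  have "eventually (\<lambda>n. \<forall>\<omega>\<in>space M. (\<forall>k<N. \<omega> \<notin> bad n (real (Suc k)) s \<eta>) \<longrightarrow> \<bar>corr n \<omega> t s - limit t s\<bar> < \<delta>) sequentially"
    using ev eventually_scale
  proof eventually_elim
    case (elim n)
    then have n: "1 \<le> n" and c: "0 < c n" by auto
    show ?case
    proof (intro ballI impI)
      fix \<omega> assume \<omega>: "\<omega> \<in> space M" and nb: "\<forall>k<N. \<omega> \<notin> bad n (real (Suc k)) s \<eta>"
      obtain D where Dm: "D \<in> borel_measurable borel" and D01: "\<And>t. 0 \<le> D t" "\<And>t. D t \<le> 1"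
        and Dc: "\<And>t. 0 \<le> t \<Longrightarrow> D t = corr n \<omega> t s"
        and Do: "\<And>t t'. 0 \<le> t \<Longrightarrow> t \<le> t' \<Longrightarrow> D t \<le> D t' + 2 / s * (t' - t)"
        and Dl: "\<And>l. 0 < l \<Longrightarrow> \<exists>m. 0 \<le> m \<and> m \<le> 1 \<and>
          (\<integral>\<^sup>+t. ennreal (indicator {0..} t * exp (- l * t) * D t) \<partial>lborel) = ennreal (m / l) \<and>
          \<bar>cube_mean n (\<lambda>x. trap_weight l s (- \<beta> * H n x \<omega> - ln (c n))) - m * cube_mean n (\<lambda>x. trap_weight l 0 (- \<beta> * H n x \<omega> - ln (c n)))\<bar>
          \<le> (green n 1 + 1 / 2 ^ n) * cube_mean n (\<lambda>x. trap_weight l 0 (- \<beta> * H n x \<omega> - ln (c n)))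
            + pair_energy n (\<lambda>x. trap_weight l 0 (- \<beta> * H n x \<omega> - ln (c n)))"
        by (rule correlation_laplace[OF n c process[OF n \<omega>] s]) blast
      have "\<bar>D t - aging ?\<alpha> s t\<bar> < \<delta>"
      proof (rule inv[rule_format])
        show "admissible (2 / s) D" unfolding admissible_def using Dm D01 Do by blast
        fix k assume k: "k < N"
        let ?l = "real (Suc k)"
        have l: "0 < ?l" by simp
        obtain m where m: "0 \<le> m" "m \<le> 1"
          and ml: "(\<integral>\<^sup>+t. ennreal (indicator {0..} t * exp (- ?l * t) * D t) \<partial>lborel) = ennreal (m / ?l)"
          and app: "approx n ?l s \<omega> m"
          using Dl[OF l] unfolding depth_def by blast
        have "\<omega> \<notin> bad n ?l s (f k)"
          using nb k bad_antimono[OF \<eta>_le[OF k], of n ?l s] by blast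
        then have mR: "\<bar>m - ?R ?l\<bar> < \<eta>0" using elim(1) k \<omega> m app by blast
        have "transform k D = m / ?l" by (rule transform_eq[OF Dm D01(1) _ ml]) (use m in simp)
        moreover have "transform k (aging ?\<alpha> s) = ?R ?l / ?l"
          unfolding transform_aging[OF \<alpha> s] by (simp add: mult.commute)
        ultimately have "transform k D - transform k (aging ?\<alpha> s) = (m - ?R ?l) / ?l"
          by (simp only: diff_divide_distrib)
        then have "\<bar>transform k D - transform k (aging ?\<alpha> s)\<bar> = \<bar>m - ?R ?l\<bar> / ?l"
          by (simp only: abs_divide abs_of_pos[OF l])
        \<comment> \<open>Since l = k + 1 is at least 1, passing from \<open>m\<close> to the
          transform m / l does not increase the error.\<close>
        also have "\<dots> \<le> \<bar>m - ?R ?l\<bar> / 1" by (intro divide_left_mono) auto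
        finally show "\<bar>transform k D - transform k (aging ?\<alpha> s)\<bar> < \<eta>0" using mR by simp
      qed
      then show "\<bar>corr n \<omega> t s - limit t s\<bar> < \<delta>" using t by (simp add: Dc aging_def)
    qed
  qed
  then show ?thesis using that[OF \<eta>] by blast
qed

text \<open>Each of the finitely many bad sets has probability of order a n / 2 ^ n + n^2 / a n, and
  both terms tend to 0.\<close>

lemma corr_converges_in_probability:
  assumes t: "0 \<le> t" and s: "0 < s"
  shows "converges_in_probability M (\<lambda>n \<omega>. corr n \<omega> t s) (limit t s)"
  unfolding converges_in_probability_def
proof (intro allI impI)
  fix \<delta> :: real assume \<delta>: "0 < \<delta>"
  obtain N \<eta> where \<eta>: "0 < \<eta>" and
    near: "eventually (\<lambda>n. \<forall>\<omega>\<in>space M. (\<forall>k<N. \<omega> \<notin> bad n (real (Suc k)) s \<eta>) \<longrightarrow> \<bar>corr n \<omega> t s - limit t s\<bar> < \<delta>) sequentially"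
    using corr_near_limit[OF t s \<delta>] by blast
  have "\<exists>B. 0 < B \<and> eventually (\<lambda>n. bad n (real (Suc k)) s \<eta> \<in> events \<and>
      prob (bad n (real (Suc k)) s \<eta>) \<le> B * (a n / 2 ^ n + (real n)\<^sup>2 / a n)) sequentially" for k
  proof -
    have "0 < real (Suc k)" by simp
    then show ?thesis by (rule bad_small[OF _ s \<eta>]) (intro exI conjI)
  qed
  then have "\<forall>k. \<exists>B. 0 < B \<and> eventually (\<lambda>n. bad n (real (Suc k)) s \<eta> \<in> events \<and>
      prob (bad n (real (Suc k)) s \<eta>) \<le> B * (a n / 2 ^ n + (real n)\<^sup>2 / a n)) sequentially" ..
  from choice[OF this] obtain B where B: "\<forall>k. 0 < B k \<and> eventually (\<lambda>n. bad n (real (Suc k)) s \<eta> \<in> events \<and>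
      prob (bad n (real (Suc k)) s \<eta>) \<le> B k * (a n / 2 ^ n + (real n)\<^sup>2 / a n)) sequentially" ..
  have evB: "eventually (\<lambda>n. \<forall>k\<in>{..<N}. bad n (real (Suc k)) s \<eta> \<in> events \<and>
      prob (bad n (real (Suc k)) s \<eta>) \<le> B k * (a n / 2 ^ n + (real n)\<^sup>2 / a n)) sequentially"
    by (rule eventually_ball_finite[OF finite_lessThan ballI]) (rule B[rule_format, THEN conjunct2])
  show "(\<lambda>n. prob {\<omega> \<in> space M. \<delta> < \<bar>corr n \<omega> t s - limit t s\<bar>}) \<longlonglongrightarrow> 0"
  proof (rule tendsto_sandwich[of "\<lambda>_. 0" _ _ "\<lambda>n. \<Sum>k<N. B k * (a n / 2 ^ n + (real n)\<^sup>2 / a n)"])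
    show "eventually (\<lambda>n. prob {\<omega> \<in> space M. \<delta> < \<bar>corr n \<omega> t s - limit t s\<bar>} \<le> (\<Sum>k<N. B k * (a n / 2 ^ n + (real n)\<^sup>2 / a n))) sequentially"
      using near evB
    proof eventually_elim
      case (elim n)
      \<comment> \<open>The deviation event is covered by the bad sets, which are measurable for all
        large n.\<close>
      have "{\<omega> \<in> space M. \<delta> < \<bar>corr n \<omega> t s - limit t s\<bar>} \<subseteq> (\<Union>k<N. bad n (real (Suc k)) s \<eta>)"
        using elim(1) by force
      then have "prob {\<omega> \<in> space M. \<delta> < \<bar>corr n \<omega> t s - limit t s\<bar>} \<le> prob (\<Union>k<N. bad n (real (Suc k)) s \<eta>)"
        using elim(2) by (intro finite_measure_mono) auto
      also have "\<dots> \<le> (\<Sum>k<N. prob (bad n (real (Suc k)) s \<eta>))"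
        using elim(2) by (intro measure_UNION_le) auto
      also have "\<dots> \<le> (\<Sum>k<N. B k * (a n / 2 ^ n + (real n)\<^sup>2 / a n))"
        using elim(2) by (intro sum_mono) auto
      finally show ?case .
    qed
    have "(\<lambda>n. a n / 2 ^ n) \<longlonglongrightarrow> 0" using scale by (simp add: intermediate_scale_def)
    then have "(\<lambda>n. \<Sum>k<N. B k * (a n / 2 ^ n + (real n)\<^sup>2 / a n)) \<longlonglongrightarrow> (\<Sum>k<N. B k * (0 + 0))"
      using summable_LIMSEQ_zero[OF square_over_a_summable] by (intro tendsto_intros)
    then show "(\<lambda>n. \<Sum>k<N. B k * (a n / 2 ^ n + (real n)\<^sup>2 / a n)) \<longlonglongrightarrow> 0" by simp
  qed auto
qed

text \<open>Borel-Cantelli: a n / 2 ^ n is summable by assumption, n^2 / a n by exponential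
  growth.\<close>

lemma eventually_good:
  assumes sum: "summable (\<lambda>n. a n / 2 ^ n)" and l: "0 < l" and s: "0 < s" and \<eta>: "0 < \<eta>"
  shows "AE \<omega> in M. eventually (\<lambda>n. \<omega> \<notin> bad n l s \<eta>) sequentially"
proof -
  obtain B where "0 < B" and ev: "eventually (\<lambda>n. bad n l s \<eta> \<in> events \<and> prob (bad n l s \<eta>) \<le> B * (a n / 2 ^ n + (real n)\<^sup>2 / a n)) sequentially"
    using bad_small[OF l s \<eta>] by blast
  \<comment> \<open>Measurability of the bad set is known only for large n; the default empty set
    makes every \<open>E n\<close> an event.\<close>
  define E where "E n = (if bad n l s \<eta> \<in> events then bad n l s \<eta> else {})" for n
  have "summable (\<lambda>n. prob (E n))"
  proof (rule summable_comparison_test_ev)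
    show "eventually (\<lambda>n. norm (prob (E n)) \<le> B * (a n / 2 ^ n + (real n)\<^sup>2 / a n)) sequentially"
      using ev by eventually_elim (simp add: E_def)
    show "summable (\<lambda>n. B * (a n / 2 ^ n + (real n)\<^sup>2 / a n))"
      by (intro summable_mult summable_add sum square_over_a_summable)
  qed
  then have "AE \<omega> in M. eventually (\<lambda>n. \<omega> \<in> space M - E n) sequentially"
    by (intro borel_cantelli_AE1) (auto simp: E_def emeasure_eq_measure)
  then show ?thesis
  proof eventually_elim
    case (elim \<omega>)
    then show ?case using ev by eventually_elim (simp add: E_def)
  qed
qed

text \<open>The exceptional null set must not depend on t or s. The bad sets do not involve t, and
  their other parameters are restricted to countably many values.\<close>

lemma corr_converges_AE:
  assumes sum: "summable (\<lambda>n. a n / 2 ^ n)"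
  shows "AE \<omega> in M. \<forall>t\<ge>0. \<forall>s>0. (\<lambda>n. corr n \<omega> t s) \<longlonglongrightarrow> limit t s"
proof -
  have "AE \<omega> in M. \<forall>s\<in>\<rat> \<inter> {0<..}. \<forall>k j. eventually (\<lambda>n. \<omega> \<notin> bad n (real (Suc k)) s (1 / real (Suc j))) sequentially"
    by (subst AE_ball_countable) (auto simp: AE_all_countable countable_rat intro!: eventually_good[OF sum])
  then show ?thesis using AE_space
  proof eventually_elim
    case (elim \<omega>)
    have rational: "(\<lambda>n. corr n \<omega> t s) \<longlonglongrightarrow> limit t s" if t: "0 \<le> t" and s: "s \<in> \<rat>" "0 < s" for t s
    proof (rule LIMSEQ_I)
      fix \<delta> :: real assume \<delta>: "0 < \<delta>"
      obtain N \<eta> where \<eta>: "0 < \<eta>" and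
        near: "eventually (\<lambda>n. \<forall>\<omega>\<in>space M. (\<forall>k<N. \<omega> \<notin> bad n (real (Suc k)) s \<eta>) \<longrightarrow> \<bar>corr n \<omega> t s - limit t s\<bar> < \<delta>) sequentially"
        using corr_near_limit[OF t s(2) \<delta>] by blast
      \<comment> \<open>Bad sets grow as the tolerance shrinks, so the tolerances 1 / (j + 1) cover
        every \<eta>.\<close>
      obtain j where j: "1 / real (Suc j) < \<eta>" using \<eta> nat_approx_posE by blast
      have "eventually (\<lambda>n. \<forall>k\<in>{..<N}. \<omega> \<notin> bad n (real (Suc k)) s (1 / real (Suc j))) sequentially"
        by (rule eventually_ball_finite) (use elim(1) s in auto)
      then have "eventually (\<lambda>n. \<bar>corr n \<omega> t s - limit t s\<bar> < \<delta>) sequentially"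
        using near
      proof eventually_elim
        case (elim n)
        have "\<omega> \<notin> bad n (real (Suc k)) s \<eta>" if "k < N" for k
          using elim(1) that bad_antimono[OF less_imp_le[OF j], of n "real (Suc k)" s] by blast
        then show ?case using elim(2) \<open>\<omega> \<in> space M\<close> by blast
      qed
      then show "\<exists>n0. \<forall>n\<ge>n0. norm (corr n \<omega> t s - limit t s) < \<delta>"
        by (simp add: eventually_sequentially)
    qed
    show ?case
    proof (intro allI impI LIMSEQ_I)
      fix t s \<delta> :: real assume t: "0 \<le> t" and s: "0 < s" and \<delta>: "0 < \<delta>"
      \<comment> \<open>For real s the correlation lies between its values at rational s1 < s < s2,
        and continuity of the limit in s closes the gap.\<close>
      have "continuous_on {0<..} (\<lambda>s. limit t s)"
        by (rule continuous_on_compose2[OF Asl_continuous[OF \<alpha>]])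
           (use t in \<open>auto intro!: continuous_intros\<close>)
      then obtain d where d: "0 < d" "\<And>s'. 0 < s' \<Longrightarrow> \<bar>s' - s\<bar> < d \<Longrightarrow> \<bar>limit t s' - limit t s\<bar> < \<delta> / 2"
        unfolding continuous_on_iff dist_real_def using s \<delta> by (metis greaterThan_iff half_gt_zero)
      obtain s1 where s1: "s1 \<in> \<rat>" "max 0 (s - d) < s1" "s1 < s"
        \<comment> \<open>The maximum with 0 keeps s1 positive even if d exceeds s.\<close>
        using Rats_dense_in_real[of "max 0 (s - d)" s] s d by auto
      obtain s2 where s2: "s2 \<in> \<rat>" "s < s2" "s2 < s + d"
        using Rats_dense_in_real[of s "s + d"] d by auto
      have near: "\<bar>limit t s1 - limit t s\<bar> < \<delta> / 2" "\<bar>limit t s2 - limit t s\<bar> < \<delta> / 2"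
        using d(2)[of s1] d(2)[of s2] s1 s2 s by auto
      have "eventually (\<lambda>n. \<bar>corr n \<omega> t s1 - limit t s1\<bar> < \<delta> / 2) sequentially"
        "eventually (\<lambda>n. \<bar>corr n \<omega> t s2 - limit t s2\<bar> < \<delta> / 2) sequentially"
        using tendstoD[OF rational[OF t s1(1)], of "\<delta> / 2"] tendstoD[OF rational[OF t s2(1)], of "\<delta> / 2"] s1 s2 s \<delta>
        by (simp_all add: dist_real_def)
      then have "eventually (\<lambda>n. \<bar>corr n \<omega> t s - limit t s\<bar> < \<delta>) sequentially"
        using eventually_scale
      proof eventually_elim
        case (elim n)
        then have n: "1 \<le> n" and c: "0 < c n" by auto
        have "corr n \<omega> t s \<le> corr n \<omega> t s1"
          by (rule correlation_antimono[OF n c process[OF n \<open>\<omega> \<in> space M\<close>] t]) (use s1 in auto)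
        moreover have "corr n \<omega> t s2 \<le> corr n \<omega> t s"
          by (rule correlation_antimono[OF n c process[OF n \<open>\<omega> \<in> space M\<close>] t]) (use s s2 in auto)
        ultimately show ?case using elim(1,2) near by linarith
      qed
      then show "\<exists>n0. \<forall>n\<ge>n0. norm (corr n \<omega> t s - limit t s) < \<delta>"
        by (simp add: eventually_sequentially)
    qed
  qed
qed

end

theorem theorem1p3:
  fixes M :: "'w measure"
    and H :: "nat \<Rightarrow> (nat \<Rightarrow> real) \<Rightarrow> 'w \<Rightarrow> real"
    and P :: "nat \<Rightarrow> 'w \<Rightarrow> 'b measure"
    and X :: "nat \<Rightarrow> 'w \<Rightarrow> real \<Rightarrow> 'b \<Rightarrow> (nat \<Rightarrow> real)"
    and a c :: "nat \<Rightarrow> real"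
    and \<epsilon> \<beta> :: real
  assumes "prob_space M"
    and gaussian: "\<And>n x. n \<ge> 1 \<Longrightarrow> x \<in> cube n \<Longrightarrow>
          distributed M lborel (H n x) (normal_density 0 (sqrt (real n)))"
    and indep: "\<And>n. n \<ge> 1 \<Longrightarrow> prob_space.indep_vars M (\<lambda>_. borel) (H n) (cube n)"
    and process: "\<And>n \<omega>. n \<ge> 1 \<Longrightarrow> \<omega> \<in> space M \<Longrightarrow>
          markov_jump_process (cube n) (hop_rate n \<beta> (\<lambda>x. H n x \<omega>))
            (pmf_of_set (cube n)) (P n \<omega>) (X n \<omega>)"
    and c_diverges: "filterlim c at_top sequentially"
    and a_def: "\<And>n x. n \<ge> 1 \<Longrightarrow> x \<in> cube n \<Longrightarrow>
          a n * measure M {\<omega> \<in> space M. tau \<beta> (H n x \<omega>) \<ge> c n} = 1"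
    and scale: "intermediate_scale \<epsilon> a"
    and "0 < \<epsilon>" and "\<epsilon> \<le> 1" and "0 < \<beta>"
    and "0 < alpha \<epsilon> \<beta>" and "alpha \<epsilon> \<beta> < 1"
  shows "(summable (\<lambda>n. a n / 2 ^ n) \<longrightarrow>
            (AE \<omega> in M. \<forall>t\<ge>0. \<forall>s>0.
               (\<lambda>n. correlation n (c n) (P n \<omega>) (X n \<omega>) t s)
                 \<longlonglongrightarrow> Asl (alpha \<epsilon> \<beta>) (t / (t + s)))) \<and>
         (\<not> summable (\<lambda>n. a n / 2 ^ n) \<longrightarrow>
            (\<forall>t\<ge>0. \<forall>s>0.
               converges_in_probability M
                 (\<lambda>n \<omega>. correlation n (c n) (P n \<omega>) (X n \<omega>) t s)
                 (Asl (alpha \<epsilon> \<beta>) (t / (t + s)))))"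
proof -
  interpret prob_space M by fact
  interpret trap_dynamics M H a c \<epsilon> \<beta> P X
    by unfold_locales (use assms in auto)
  show ?thesis
    using corr_converges_AE corr_converges_in_probability by blast
qed

end
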